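(* Let $k$ be a field containing all roots of unity, with absolute Galois group $G_k$. Then $G_k$ is totally torsion free.
   Context: A profinite group $G$ is called totally torsion free if for every closed subgroup $K\subseteq G$ the profinite abelianization $K^{ab}=K/[K,K]$ is torsion free, where $[K,K]$ denotes the closure of the subgroup generated by all commutators $ghg^{-1}h^{-1}$ in $K$. In this statement $k$ is an arbitrary field containing all roots of unity (not assumed algebraically closed). *)

theory Defs
  imports "HOL-Analysis.Analysis" "HOL-Algebra.Algebra" "HOL-Algebra.Algebraic_Closure_Type"
begin

section \<open>Profinite groups\<close>

definition topological_group :: "('g, 'm) monoid_scheme \<Rightarrow> 'g topology \<Rightarrow> bool" where
  "topological_group G T \<longleftrightarrow>
     Group.group G \<and> topspace T = carrier G \<and>
     continuous_map (prod_topology T T) T (\<lambda>(x, y). x \<otimes>\<^bsub>G\<^esub> y) \<and>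
     continuous_map T T (\<lambda>x. inv\<^bsub>G\<^esub> x)"

definition profinite_group :: "('g, 'm) monoid_scheme \<Rightarrow> 'g topology \<Rightarrow> bool" where
  "profinite_group G T \<longleftrightarrow>
     topological_group G T \<and> compact_space T \<and> Hausdorff_space T \<and>
     (\<forall>x\<in>topspace T. connected_component_of_set T x = {x})"

definition torsion_free :: "('g, 'm) monoid_scheme \<Rightarrow> bool" where
  "torsion_free G \<longleftrightarrow>
     (\<forall>x\<in>carrier G. \<forall>n::nat. n > 0 \<longrightarrow> x [^]\<^bsub>G\<^esub> n = \<one>\<^bsub>G\<^esub> \<longrightarrow> x = \<one>\<^bsub>G\<^esub>)"

text \<open>For closed \<open>K\<close>, the closure of the commutator subgroup in \<open>K\<close> and in \<open>G\<close> agree.\<close>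

definition profinite_abelianization ::
  "('g, 'm) monoid_scheme \<Rightarrow> 'g topology \<Rightarrow> 'g set \<Rightarrow> 'g set monoid" where
  "profinite_abelianization G T K =
     (G\<lparr>carrier := K\<rparr>) Mod (T closure_of (derived G K))"

definition totally_torsion_free :: "('g, 'm) monoid_scheme \<Rightarrow> 'g topology \<Rightarrow> bool" where
  "totally_torsion_free G T \<longleftrightarrow>
     profinite_group G T \<and>
     (\<forall>K. subgroup K G \<longrightarrow> closedin T K \<longrightarrow> torsion_free (profinite_abelianization G T K))"

section \<open>The absolute Galois group of a field\<close>

text \<open>
  The base field \<open>k\<close> is the type \<open>'a\<close>, embedded by \<^const>\<open>to_ac\<close> into its algebraic closure
  \<open>'a alg_closure\<close>.
\<close>

definition separable_closure :: "'a::field alg_closure set" where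
  "separable_closure =
     {x. \<exists>p :: 'a poly. Factorial_Ring.irreducible p \<and> poly (map_poly to_ac p) x = 0 \<and>
                      rsquarefree (map_poly to_ac p)}"

text \<open>The automorphisms of \<open>k\<^sup>s\<^sup>e\<^sup>p\<close> fixing \<open>E\<close> pointwise; elements of \<^const>\<open>Bij\<close> are
  \<^const>\<open>undefined\<close> outside their domain.\<close>

definition galois_fixing :: "'a::field alg_closure set \<Rightarrow> ('a alg_closure \<Rightarrow> 'a alg_closure) set" where
  "galois_fixing E =
     {\<sigma> \<in> Bij separable_closure.
        (\<forall>x\<in>separable_closure. \<forall>y\<in>separable_closure.
           \<sigma> (x + y) = \<sigma> x + \<sigma> y \<and> \<sigma> (x * y) = \<sigma> x * \<sigma> y) \<and>
        (\<forall>x\<in>E. \<sigma> x = x)}"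

definition absolute_galois_group :: "('a::field alg_closure \<Rightarrow> 'a alg_closure) monoid" where
  "absolute_galois_group = (BijGroup separable_closure)\<lparr>carrier := galois_fixing (range to_ac)\<rparr>"

definition finite_separable_extension :: "'a::field alg_closure set \<Rightarrow> bool" where
  "finite_separable_extension E \<longleftrightarrow>
     subfield E ring_of_type_algebra \<and> range to_ac \<subseteq> E \<and> E \<subseteq> separable_closure \<and>
     ring.finite_dimension ring_of_type_algebra (range to_ac) E"

definition krull_topology :: "('a::field alg_closure \<Rightarrow> 'a alg_closure) topology" where
  "krull_topology = topology_generated_by
     {\<sigma> <#\<^bsub>absolute_galois_group\<^esub> galois_fixing E | \<sigma> E.
        \<sigma> \<in> carrier absolute_galois_group \<and> finite_separable_extension E}"

end

theory Submission
  imports Defs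
begin

text \<open>
Let \<open>K\<close> be a closed subgroup of the absolute Galois group and \<open>D\<close> the closure of its commutator
subgroup.  The quotient of \<open>K\<close> by \<open>D\<close> is torsion free as soon as every continuous character \<open>\<theta>\<close> of finite
order of \<open>K\<close> is divisible by every prime \<open>q\<close>: if \<open>s\<close> is not in \<open>D\<close>, but \<open>s ^ q\<close> is, choose \<open>\<theta>\<close> with \<open>\<theta> s\<close>
non-trivial and \<open>\<psi>\<close> with \<open>\<psi> ^ q = \<theta>\<close>; then \<open>\<psi>\<close> is trivial on \<open>D\<close>, although its value at \<open>s ^ q\<close> is
\<open>\<theta> s\<close>.  The character \<open>\<theta>\<close> comes from the duality of finite abelian groups, applied to a finite quotient
of \<open>K\<close> (\<open>exists_level_character\<close>), and the deduction is \<open>prime_pow_in_derived_closure\<close>.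

Divisibility is where the roots of unity enter.  If \<open>q\<close> is not the characteristic, \<open>\<theta>\<close> may be given
values in the roots of unity of the field.  They are fixed by \<open>K\<close>, so that Hilbert 90 gives an element \<open>a\<close>
with \<open>\<theta> g = g(a) / a\<close>, and a \<open>q\<close>-th root of \<open>a\<close> defines \<open>\<psi>\<close> (\<open>kummer_step\<close>).  If \<open>q\<close> is the characteristic,
\<open>\<theta>\<close> is a homomorphism to the integers modulo some \<open>N\<close>, and the obstruction to lifting it modulo \<open>N * q\<close>
is a class in the second cohomology of \<open>K\<close> with coefficients in the prime field.  This class vanishes
because the additive group of the separable closure has no higher cohomology and Artin--Schreier
equations are solvable in it; the cochains are written down explicitly (\<open>artin_schreier_step\<close>).

All this happens in terms of an action with finite orbits and of pointwise approximation.  Two things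
connect it to the Galois group.  First, the separable elements form a field, closed under the roots
just used.  Being separable means being a simple root of some polynomial
(\<open>separable_iff_simple_root\<close>), and closure under sums and products follows from MacLane's criterion
(\<open>separable_of_Frobenius_span\<close>).  Second, the Krull topology is the topology of pointwise convergence
(\<open>openin_krull_iff\<close>).  This identifies \<open>D\<close> (\<open>closure_of_derived_eq\<close>), and it exhibits the Galois group
as a closed subgroup of a product of finite sets, whence it is profinite
(\<open>profinite_group_krull\<close>).
\<close>

section \<open>Characters of finite abelian groups and Dedekind independence\<close>

definition (in group) character_on :: "'a set \<Rightarrow> ('a \<Rightarrow> 'f::Fields.field) \<Rightarrow> bool" where
  "character_on H \<theta> \<longleftrightarrow> (\<forall>x\<in>H. \<theta> x \<noteq> 0) \<and> (\<forall>x\<in>H. \<forall>y\<in>H. \<theta> (x \<otimes> y) = \<theta> x * \<theta> y)"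

lemma (in group) character_on_one:
  assumes "character_on H \<theta>" "\<one> \<in> H"
  shows "\<theta> \<one> = 1"
proof -
  have "\<theta> \<one> * \<theta> \<one> = \<theta> \<one> * 1" "\<theta> \<one> \<noteq> 0"
    using assms unfolding character_on_def by (force, force)
  then show ?thesis by (metis mult_cancel_left)
qed

lemma (in group) subgroup_nat_pow_closed:
  assumes "subgroup H G" "x \<in> H"
  shows "x [^] (n::nat) \<in> H"
  by (induction n) (use assms in \<open>auto simp: subgroup.one_closed subgroup.m_closed\<close>)

lemma (in group) character_on_pow:
  assumes "character_on H \<theta>" "subgroup H G" "x \<in> H"
  shows "\<theta> (x [^] (n::nat)) = \<theta> x ^ n"
proof (induction n)
  case 0
  then show ?case using character_on_one[OF assms(1)] subgroup.one_closed[OF assms(2)] by simp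
next
  case (Suc n)
  have "x [^] n \<in> H"
    using assms(2,3) by (rule subgroup_nat_pow_closed)
  then show ?case using Suc assms unfolding character_on_def by (simp add: mult.commute)
qed

text \<open>
If \<open>m\<close> is the least positive exponent with \<open>g ^ m \<in> H\<close>, the only relations between \<open>g\<close> and \<open>H\<close> are
the multiples of this one, so \<open>g\<close> may be sent to any \<open>m\<close>-th root \<open>z\<close> of the value at \<open>g ^ m\<close>.  The
freedom in the choice of \<open>z\<close> is what makes a character non-trivial at a prescribed element.
\<close>

lemma (in comm_group) extend_character_by_element:
  fixes \<theta> :: "'a \<Rightarrow> 'f::alg_closed_field"
  assumes fin: "finite (carrier G)" and H: "subgroup H G" and \<theta>: "character_on H \<theta>"
    and g: "g \<in> carrier G"
    and m: "m > 0" "g [^] m \<in> H" "\<And>i. g [^] (i::nat) \<in> H \<Longrightarrow> m dvd i"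
    and z: "z ^ m = \<theta> (g [^] m)"
  obtains H' \<theta>' where "subgroup H' G" "H \<subseteq> H'" "g \<in> H'" "character_on H' \<theta>'"
    "\<And>h. h \<in> H \<Longrightarrow> \<theta>' h = \<theta> h" "\<theta>' g = z"
proof -
  have Hc: "h \<in> carrier G" if "h \<in> H" for h using H that by (rule subgroup.mem_carrier)
  define H' where "H' = (\<lambda>(h, i::nat). h \<otimes> g [^] i) ` (H \<times> UNIV)"
  define \<theta>' where "\<theta>' x = (let (h, i) = (SOME (h, i::nat). h \<in> H \<and> x = h \<otimes> g [^] i) in \<theta> h * z ^ i)" for x
  have z0: "z \<noteq> 0"
  proof
    assume "z = 0"
    then have "\<theta> (g [^] m) = 0" using z m(1) by (metis power_0_left less_irrefl)
    then show False using \<theta> m(2) unfolding character_on_def by auto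
  qed
  have wd0: "\<theta> h * z ^ i = \<theta> h' * z ^ j"
    if "h \<in> H" "h' \<in> H" "h \<otimes> g [^] i = h' \<otimes> g [^] j" "i \<le> j" for h h' and i j :: nat
  proof -
    have "h \<otimes> g [^] i = (h' \<otimes> g [^] (j - i)) \<otimes> g [^] i"
      using that g Hc by (simp add: m_assoc nat_pow_mult)
    then have h: "h = h' \<otimes> g [^] (j - i)"
      using that g Hc by (metis m_closed nat_pow_closed right_cancel)
    then have "g [^] (j - i) = inv h' \<otimes> h"
      using that g Hc by (simp add: m_assoc[symmetric])
    then have inH: "g [^] (j - i) \<in> H"
      using that H by (simp add: subgroup.m_closed subgroup.m_inv_closed)
    then obtain q where q: "j - i = m * q" using m(3) by (auto elim: dvdE)
    have "\<theta> (g [^] (j - i)) = \<theta> ((g [^] m) [^] q)"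
      using q g by (simp add: nat_pow_pow)
    also have "\<dots> = z ^ (j - i)"
      using character_on_pow[OF \<theta> H m(2)] z q by (simp add: power_mult)
    finally have "\<theta> h = \<theta> h' * z ^ (j - i)"
      using h inH that \<theta> unfolding character_on_def by simp
    then show ?thesis using that(4)
      by (simp add: mult.assoc power_add[symmetric])
  qed
  have wd: "\<theta> h * z ^ i = \<theta> h' * z ^ j"
    if "h \<in> H" "h' \<in> H" "h \<otimes> g [^] i = h' \<otimes> g [^] j" for h h' and i j :: nat
    using wd0[OF that] wd0[OF that(2,1) that(3)[symmetric]] by (metis nat_le_linear)
  have val: "\<theta>' (h \<otimes> g [^] i) = \<theta> h * z ^ i" if "h \<in> H" for h and i :: nat
  proof -
    have ex: "\<exists>p. case p of (h', j::nat) \<Rightarrow> h' \<in> H \<and> h \<otimes> g [^] i = h' \<otimes> g [^] j"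
      using that by auto
    obtain h' j where p: "(SOME (h', j::nat). h' \<in> H \<and> h \<otimes> g [^] i = h' \<otimes> g [^] j) = (h', j)"
      by (meson surj_pair)
    have "h' \<in> H \<and> h \<otimes> g [^] i = h' \<otimes> g [^] j"
      using someI_ex[OF ex] unfolding p by simp
    then show ?thesis using wd[of h h' i j] that unfolding \<theta>'_def p by simp
  qed
  have one: "\<one> \<in> H" using H by (rule subgroup.one_closed)
  have mul: "(h \<otimes> g [^] i) \<otimes> (h' \<otimes> g [^] j) = (h \<otimes> h') \<otimes> g [^] (i + j)"
    if "h \<in> H" "h' \<in> H" for h h' and i j :: nat
    using that g Hc by (simp add: m_ac nat_pow_mult[symmetric])
  have "subgroup H' G"
  proof (rule subgroupI)
    show "H' \<subseteq> carrier G" using g Hc unfolding H'_def by auto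
    show "H' \<noteq> {}" using one unfolding H'_def by auto
  next
    fix a b assume "a \<in> H'" "b \<in> H'"
    then show "a \<otimes> b \<in> H'"
      unfolding H'_def using mul H by (force simp: subgroup.m_closed)
  next
    fix a assume "a \<in> H'"
    then obtain h and i :: nat where a: "h \<in> H" "a = h \<otimes> g [^] i" unfolding H'_def by auto
    \<comment> \<open>With this exponent \<open>g ^ n\<close> is the inverse of \<open>g ^ i\<close>.\<close>
    define n where "n = i * (ord g - 1)"
    have "ord g > 0" using ord_ge_1[OF fin g] by simp
    then have "i + n = ord g * i" unfolding n_def by (cases "ord g") auto
    then have "g [^] (i + n) = \<one>"
      using g pow_ord_eq_1[OF g] by (simp add: nat_pow_pow[symmetric])
    then have "a \<otimes> (inv h \<otimes> g [^] n) = \<one>"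
      using mul[of h "inv h" i n] a H Hc by (simp add: subgroup.m_inv_closed)
    then have "inv a = inv h \<otimes> g [^] n"
      using a g Hc by (metis inv_closed inv_equality m_closed m_comm nat_pow_closed)
    then show "inv a \<in> H'"
      unfolding H'_def using a H by (force simp: subgroup.m_inv_closed)
  qed
  moreover have "h \<in> H'" "\<theta>' h = \<theta> h" if "h \<in> H" for h
    using val[OF that, of 0] that Hc unfolding H'_def by (auto intro!: image_eqI[of _ _ "(h, 0)"])
  moreover have "g \<in> H'" "\<theta>' g = z"
    using val[OF one, of 1] one g character_on_one[OF \<theta> one] unfolding H'_def
    by (auto intro!: image_eqI[of _ _ "(\<one>, 1)"])
  moreover have "character_on H' \<theta>'"
    unfolding character_on_def H'_def using val mul \<theta> z0 H
    by (auto simp: character_on_def power_add subgroup.m_closed)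
  ultimately show ?thesis using that by blast
qed

lemma alg_closed_nth_root:
  fixes a :: "'f::alg_closed_field"
  assumes "n > 0"
  obtains z where "z ^ n = a"
  using nth_root_exists assms by (metis)

lemma (in group) least_pow_in_subgroup:
  assumes fin: "finite (carrier G)" and H: "subgroup H G" and g: "g \<in> carrier G"
  obtains m where "m > 0" "g [^] m \<in> H" "\<And>i. g [^] (i::nat) \<in> H \<Longrightarrow> m dvd i"
proof -
  define m where "m = (LEAST m::nat. m > 0 \<and> g [^] m \<in> H)"
  have "ord g > 0 \<and> g [^] ord g \<in> H"
    using ord_ge_1[OF fin g] pow_ord_eq_1[OF g] subgroup.one_closed[OF H] by simp
  then have m: "m > 0 \<and> g [^] m \<in> H" unfolding m_def by (rule LeastI)
  have "m dvd i" if i: "g [^] (i::nat) \<in> H" for i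
  proof -
    have "(g [^] m) [^] (i div m) \<in> H"
      using m H by (simp add: subgroup_nat_pow_closed)
    moreover have "g [^] i = (g [^] m) [^] (i div m) \<otimes> g [^] (i mod m)"
      using g by (simp add: nat_pow_pow nat_pow_mult)
    ultimately have "g [^] (i mod m) = inv ((g [^] m) [^] (i div m)) \<otimes> g [^] i"
      using g by (simp add: m_assoc[symmetric])
    then have "g [^] (i mod m) \<in> H"
      using H i \<open>(g [^] m) [^] (i div m) \<in> H\<close> by (simp add: subgroup.m_closed subgroup.m_inv_closed)
    moreover have "i mod m < m" using m by simp
    ultimately have "i mod m = 0"
      using not_less_Least[of "i mod m" "\<lambda>m. m > 0 \<and> g [^] m \<in> H"] unfolding m_def by auto
    then show ?thesis by auto
  qed
  then show ?thesis using m that by blast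
qed

lemma (in comm_group) extend_character:
  fixes \<theta> :: "'a \<Rightarrow> 'f::alg_closed_field"
  assumes fin: "finite (carrier G)" and "subgroup H G" "character_on H \<theta>"
  obtains \<theta>' where "character_on (carrier G) \<theta>'" "\<And>h. h \<in> H \<Longrightarrow> \<theta>' h = \<theta> h"
  using assms(2,3)
proof (induction "card (carrier G - H)" arbitrary: H \<theta> thesis rule: less_induct)
  case less
  show ?case
  proof (cases "H = carrier G")
    case True
    then show ?thesis using less.prems by blast
  next
    case False
    then obtain g where g: "g \<in> carrier G" "g \<notin> H"
      using subgroup.subset[OF less.prems(2)] by auto
    obtain m where m: "m > 0" "g [^] m \<in> H" "\<And>i. g [^] (i::nat) \<in> H \<Longrightarrow> m dvd i"
      using least_pow_in_subgroup[OF fin less.prems(2) g(1)] by metis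
    obtain z where z: "z ^ m = \<theta> (g [^] m)" using alg_closed_nth_root[OF m(1)] by metis
    obtain H' \<theta>' where H': "subgroup H' G" "H \<subseteq> H'" "g \<in> H'" "character_on H' \<theta>'"
      "\<And>h. h \<in> H \<Longrightarrow> \<theta>' h = \<theta> h"
      using extend_character_by_element[OF fin less.prems(2,3) g(1) m z] by metis
    have "card (carrier G - H') < card (carrier G - H)"
      by (rule psubset_card_mono) (use fin g H' in auto)
    then obtain \<theta>'' where "character_on (carrier G) \<theta>''" "\<And>h. h \<in> H' \<Longrightarrow> \<theta>'' h = \<theta>' h"
      using less.hyps[OF _ _ H'(1,4)] by metis
    then show ?thesis using less.prems(1) H' by (metis subsetD)
  qed
qed

text \<open>
The values lie in the multiplicative group of a field \<open>'f\<close> whose characteristic may divide the group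
order; a character that detects \<open>g\<close> then exists as soon as \<open>'f\<close> has one non-trivial root of unity \<open>\<zeta>\<close>
that \<open>g\<close> can be sent to.
\<close>

lemma (in comm_group) exists_character_nontrivial_at:
  fixes \<zeta> :: "'f::alg_closed_field"
  assumes fin: "finite (carrier G)" and g: "g \<in> carrier G" and \<zeta>: "\<zeta> \<noteq> 1" "\<zeta> ^ ord g = 1"
  obtains \<theta> :: "'a \<Rightarrow> 'f" where "character_on (carrier G) \<theta>" "\<theta> g \<noteq> 1"
proof -
  have 1: "character_on {\<one>} (\<lambda>_. 1::'f)" unfolding character_on_def by simp
  have t: "subgroup {\<one>} G" by (rule triv_subgroup)
  have m: "ord g > 0" "g [^] ord g \<in> {\<one>}" "\<And>i. g [^] (i::nat) \<in> {\<one>} \<Longrightarrow> ord g dvd i"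
    using ord_ge_1[OF fin g] pow_ord_eq_1[OF g] pow_eq_id[OF g] by auto
  obtain H' \<theta>' where H': "subgroup H' G" "{\<one>} \<subseteq> H'" "g \<in> H'" "character_on H' \<theta>'" "\<theta>' g = \<zeta>"
    by (rule extend_character_by_element[OF fin t 1 g m, of \<zeta>]) (use \<zeta>(2) in auto)
  obtain \<theta>'' where "character_on (carrier G) \<theta>''" "\<And>h. h \<in> H' \<Longrightarrow> \<theta>'' h = \<theta>' h"
    using extend_character[OF fin H'(1,4)] by metis
  then show ?thesis using that H' \<zeta> by metis
qed

text \<open>
Dedekind's argument: comparing the relation at \<open>y * x\<close> with \<open>f k y\<close> times the relation at \<open>x\<close>
eliminates the character \<open>f k\<close>.
\<close>

lemma dedekind_independence:
  fixes f :: "'i \<Rightarrow> 'm::times \<Rightarrow> 'f::Fields.field"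
  assumes "finite I"
    and M: "\<And>x y. x \<in> M \<Longrightarrow> y \<in> M \<Longrightarrow> x * y \<in> M"
    and mult: "\<And>i x y. i \<in> I \<Longrightarrow> x \<in> M \<Longrightarrow> y \<in> M \<Longrightarrow> f i (x * y) = f i x * f i y"
    and nz: "\<And>i. i \<in> I \<Longrightarrow> \<exists>x\<in>M. f i x \<noteq> 0"
    and distinct: "\<And>i j. i \<in> I \<Longrightarrow> j \<in> I \<Longrightarrow> i \<noteq> j \<Longrightarrow> \<exists>x\<in>M. f i x \<noteq> f j x"
    and rel: "\<And>x. x \<in> M \<Longrightarrow> (\<Sum>i\<in>I. c i * f i x) = 0"
    and "i \<in> I"
  shows "c i = 0"
  using \<open>finite I\<close> mult nz distinct rel \<open>i \<in> I\<close>
proof (induction I arbitrary: c i)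
  case (insert k I)
  have cj: "c j = 0" if j: "j \<in> I" for j
  proof -
    have "j \<noteq> k" using j insert by auto
    then obtain y where y: "y \<in> M" "f j y \<noteq> f k y"
      using insert.prems(3)[of j k] j by auto
    have "(\<Sum>i\<in>I. (c i * (f i y - f k y)) * f i x) = 0" if x: "x \<in> M" for x
    proof -
      have "c k * f k (y * x) + (\<Sum>i\<in>I. c i * f i (y * x)) = 0"
        using insert.prems(4)[OF M[OF y(1) x]] insert.hyps by simp
      then have a: "c k * (f k y * f k x) + (\<Sum>i\<in>I. c i * (f i y * f i x)) = 0"
        using insert.prems(1) x y by simp
      have "c k * f k x + (\<Sum>i\<in>I. c i * f i x) = 0"
        using insert.prems(4)[OF x] insert.hyps by simp
      then have "f k y * (c k * f k x + (\<Sum>i\<in>I. c i * f i x)) = 0" by simp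
      then have "c k * (f k y * f k x) + f k y * (\<Sum>i\<in>I. c i * f i x) = 0"
        by (simp add: algebra_simps)
      with a have "(\<Sum>i\<in>I. c i * (f i y * f i x)) - f k y * (\<Sum>i\<in>I. c i * f i x) = 0"
        by (metis add_left_cancel diff_self)
      then show ?thesis
        by (simp add: sum_distrib_left sum_subtractf[symmetric] algebra_simps)
    qed
    then have "c j * (f j y - f k y) = 0"
      using insert.IH[where c = "\<lambda>i. c i * (f i y - f k y)" and i = j] insert.prems j by auto
    then show ?thesis using y by simp
  qed
  show ?case
  proof (cases "i = k")
    case True
    obtain x where x: "x \<in> M" "f k x \<noteq> 0" using insert.prems(2)[of k] by auto
    have "c k * f k x + (\<Sum>i\<in>I. c i * f i x) = 0"
      using insert.prems(4)[OF x(1)] insert.hyps by simp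
    then show ?thesis using x cj True by simp
  qed (use cj insert.prems in auto)
qed simp

section \<open>Group actions on fields and their finite quotients\<close>

text \<open>
The finiteness of the orbits expresses that the action is continuous.
\<close>

locale field_action = group K for K :: "('k, 'm) monoid_scheme" (structure) +
  fixes F :: "'f::alg_closed_field set" and act :: "'k \<Rightarrow> 'f \<Rightarrow> 'f"
  assumes one_F: "1 \<in> F" and add_F: "x \<in> F \<Longrightarrow> y \<in> F \<Longrightarrow> x + y \<in> F"
    and mult_F: "x \<in> F \<Longrightarrow> y \<in> F \<Longrightarrow> x * y \<in> F" and uminus_F: "x \<in> F \<Longrightarrow> - x \<in> F"
    and inverse_F: "x \<in> F \<Longrightarrow> inverse x \<in> F"
    and act_F: "g \<in> carrier K \<Longrightarrow> x \<in> F \<Longrightarrow> act g x \<in> F"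
    and act_add: "g \<in> carrier K \<Longrightarrow> x \<in> F \<Longrightarrow> y \<in> F \<Longrightarrow> act g (x + y) = act g x + act g y"
    and act_mult: "g \<in> carrier K \<Longrightarrow> x \<in> F \<Longrightarrow> y \<in> F \<Longrightarrow> act g (x * y) = act g x * act g y"
    and act_one: "x \<in> F \<Longrightarrow> act \<one> x = x"
    and act_comp: "g \<in> carrier K \<Longrightarrow> h \<in> carrier K \<Longrightarrow> x \<in> F \<Longrightarrow> act (g \<otimes> h) x = act g (act h x)"
    and finite_orbit: "x \<in> F \<Longrightarrow> finite ((\<lambda>g. act g x) ` carrier K)"
begin

lemma zero_F: "0 \<in> F"
  using add_F[OF one_F uminus_F[OF one_F]] by simp

lemma diff_F: "x \<in> F \<Longrightarrow> y \<in> F \<Longrightarrow> x - y \<in> F"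
  using add_F[OF _ uminus_F] by force

lemma divide_F: "x \<in> F \<Longrightarrow> y \<in> F \<Longrightarrow> x / y \<in> F"
  using mult_F[OF _ inverse_F] by (simp add: divide_inverse)

lemma power_F: "x \<in> F \<Longrightarrow> x ^ n \<in> F"
  by (induction n) (auto simp: one_F mult_F)

lemma of_nat_F: "of_nat n \<in> F"
  by (induction n) (auto simp: zero_F one_F add_F)

lemma of_int_F: "of_int n \<in> F"
  by (cases n) (auto intro: of_nat_F uminus_F simp del: of_nat_Suc)

lemma sum_F: "(\<And>i. i \<in> I \<Longrightarrow> f i \<in> F) \<Longrightarrow> sum f I \<in> F"
  by (induction I rule: infinite_finite_induct) (auto simp: zero_F add_F)

lemmas F_closed = zero_F one_F add_F diff_F mult_F uminus_F inverse_F divide_F power_F of_nat_F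
  of_int_F sum_F act_F

lemma act_inv [simp]: "g \<in> carrier K \<Longrightarrow> x \<in> F \<Longrightarrow> act (inv g) (act g x) = x"
  using act_comp[of "inv g" g x] act_one by simp

lemma act_eq_iff: "g \<in> carrier K \<Longrightarrow> x \<in> F \<Longrightarrow> y \<in> F \<Longrightarrow> act g x = act g y \<longleftrightarrow> x = y"
  using act_inv by metis

lemma act_zero [simp]: "g \<in> carrier K \<Longrightarrow> act g 0 = 0"
  using act_add[OF _ zero_F zero_F] by (metis add_cancel_right_right add_0)

lemma act_1 [simp]: assumes "g \<in> carrier K" shows "act g 1 = 1"
proof -
  have "act g 1 * act g 1 = act g 1 * 1" using act_mult[OF assms one_F one_F] by simp
  moreover have "act g 1 \<noteq> act g 0" by (subst act_eq_iff) (simp_all add: assms F_closed)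
  ultimately show ?thesis using assms by simp
qed

lemma act_eq_0_iff: "g \<in> carrier K \<Longrightarrow> x \<in> F \<Longrightarrow> act g x = 0 \<longleftrightarrow> x = 0"
  using act_eq_iff[OF _ _ zero_F] by simp

lemma act_uminus: "g \<in> carrier K \<Longrightarrow> x \<in> F \<Longrightarrow> act g (- x) = - act g x"
  using act_add[of g x "- x"] by (simp add: F_closed add_eq_0_iff)

lemma act_diff: "g \<in> carrier K \<Longrightarrow> x \<in> F \<Longrightarrow> y \<in> F \<Longrightarrow> act g (x - y) = act g x - act g y"
  using act_add[of g x "- y"] by (simp add: F_closed act_uminus)

lemma act_inverse:
  assumes "g \<in> carrier K" "x \<in> F" shows "act g (inverse x) = inverse (act g x)"
proof (cases "x = 0")
  case False
  then have "act g x * act g (inverse x) = 1"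
    using act_mult[OF assms(1,2) inverse_F[OF assms(2)]] assms by simp
  then show ?thesis by (metis inverse_unique)
qed (use assms in simp)

lemma act_divide: "g \<in> carrier K \<Longrightarrow> x \<in> F \<Longrightarrow> y \<in> F \<Longrightarrow> act g (x / y) = act g x / act g y"
  by (simp add: divide_inverse act_mult act_inverse F_closed)

lemma act_power: "g \<in> carrier K \<Longrightarrow> x \<in> F \<Longrightarrow> act g (x ^ n) = act g x ^ n"
  by (induction n) (simp_all add: act_mult F_closed)

lemma act_of_nat: "g \<in> carrier K \<Longrightarrow> act g (of_nat n) = of_nat n"
  by (induction n) (simp_all add: act_add F_closed)

lemma act_of_int: "g \<in> carrier K \<Longrightarrow> act g (of_int n) = of_int n"
  by (cases n) (simp_all add: act_of_nat act_uminus F_closed del: of_nat_Suc)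

lemma act_sum:
  "g \<in> carrier K \<Longrightarrow> (\<And>i. i \<in> I \<Longrightarrow> f i \<in> F) \<Longrightarrow> act g (sum f I) = (\<Sum>i\<in>I. act g (f i))"
  by (induction I rule: infinite_finite_induct) (simp_all add: act_add F_closed)

text \<open>
The closure of the commutator subgroup in the topology of pointwise convergence on \<open>F\<close>.
\<close>

definition derived_closure :: "'k set" where
  "derived_closure = {t \<in> carrier K. \<forall>A. finite A \<longrightarrow> A \<subseteq> F \<longrightarrow>
     (\<exists>d\<in>derived K (carrier K). \<forall>x\<in>A. act d x = act t x)}"

text \<open>
A character is trivial on commutators; if it depends only on the restriction of a group element to
finitely many points, it is continuous and hence trivial on their closure.
\<close>

lemma character_trivial_on_derived_closure:
  fixes \<psi> :: "'k \<Rightarrow> 'c::Fields.field"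
  assumes \<psi>: "character_on (carrier K) \<psi>" and A: "finite A" "A \<subseteq> F"
    and loc: "\<And>g h. g \<in> carrier K \<Longrightarrow> h \<in> carrier K \<Longrightarrow> (\<And>x. x \<in> A \<Longrightarrow> act g x = act h x) \<Longrightarrow> \<psi> g = \<psi> h"
    and t: "t \<in> derived_closure"
  shows "\<psi> t = 1"
proof -
  define N where "N = {g \<in> carrier K. \<psi> g = 1}"
  have one: "\<psi> \<one> = 1" using character_on_one[OF \<psi>] by simp
  have inv: "\<psi> (inv g) = inverse (\<psi> g)" if "g \<in> carrier K" for g
  proof -
    have "\<psi> g * \<psi> (inv g) = 1" using \<psi> that one unfolding character_on_def by (metis inv_closed r_inv)
    then show ?thesis by (metis inverse_unique)
  qed
  have "subgroup N K"
    by (rule subgroupI) (use \<psi> inv one in \<open>auto simp: N_def character_on_def\<close>)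
  moreover have "derived_set K (carrier K) \<subseteq> N"
  proof clarsimp
    fix h1 h2 assume h: "h1 \<in> carrier K" "h2 \<in> carrier K"
    then have "\<psi> h1 \<noteq> 0" "\<psi> h2 \<noteq> 0" using \<psi> unfolding character_on_def by auto
    moreover have "\<psi> (h1 \<otimes> h2 \<otimes> inv h1 \<otimes> inv h2) = \<psi> h1 * \<psi> h2 * \<psi> (inv h1) * \<psi> (inv h2)"
      using \<psi> h unfolding character_on_def by simp
    ultimately show "h1 \<otimes> h2 \<otimes> inv h1 \<otimes> inv h2 \<in> N" using inv h unfolding N_def by (simp add: field_simps)
  qed
  ultimately have "derived K (carrier K) \<subseteq> N"
    unfolding derived_def by (intro generate_subgroup_incl)
  moreover obtain d where "d \<in> derived K (carrier K)" "\<forall>x\<in>A. act d x = act t x"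
    using t A unfolding derived_closure_def by auto
  ultimately have d: "d \<in> carrier K" "\<psi> d = 1" "\<And>x. x \<in> A \<Longrightarrow> act d x = act t x"
    unfolding N_def by blast+
  have "t \<in> carrier K" using t unfolding derived_closure_def by blast
  from loc[OF d(1) this d(3)] d(2) show ?thesis by simp
qed

end

text \<open>
A finite stable subset \<open>Y\<close> of \<open>F\<close> plays the role of a finite normal extension: the group acts on \<open>Y\<close>
through a finite quotient, whose elements are the restrictions \<open>level g\<close>.
\<close>

locale finite_level = field_action K F act
  for K :: "('k, 'm) monoid_scheme" (structure) and F :: "'f::alg_closed_field set" and act +
  fixes Y :: "'f set"
  assumes finite_Y: "finite Y" and Y_F: "Y \<subseteq> F"
    and Y_stable: "g \<in> carrier K \<Longrightarrow> y \<in> Y \<Longrightarrow> act g y \<in> Y"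
begin

definition level :: "'k \<Rightarrow> 'f \<Rightarrow> 'f" where "level g = restrict (act g) Y"

lemma level_eq_iff: "level g = level h \<longleftrightarrow> (\<forall>y\<in>Y. act g y = act h y)"
  unfolding level_def by (metis restrict_apply' restrict_ext)

lemma level_mult:
  "g \<in> carrier K \<Longrightarrow> g' \<in> carrier K \<Longrightarrow> h \<in> carrier K \<Longrightarrow> h' \<in> carrier K \<Longrightarrow>
   level g = level g' \<Longrightarrow> level h = level h' \<Longrightarrow> level (g \<otimes> h) = level (g' \<otimes> h')"
  unfolding level_eq_iff using Y_F Y_stable by (auto simp: act_comp subset_iff)

lemma level_inv:
  assumes "g \<in> carrier K" "h \<in> carrier K" "level g = level h" shows "level (inv g) = level (inv h)"
proof -
  have "level (inv g \<otimes> g \<otimes> inv h) = level (inv g \<otimes> h \<otimes> inv h)"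
    by (intro level_mult) (use assms in auto)
  then show ?thesis using assms by (simp add: m_assoc)
qed

lemma finite_levels: "finite (level ` carrier K)"
proof (rule finite_subset)
  show "level ` carrier K \<subseteq> Y \<rightarrow>\<^sub>E Y" using Y_stable by (auto simp: level_def)
qed (simp add: finite_PiE finite_Y)

definition rep :: "('f \<Rightarrow> 'f) \<Rightarrow> 'k" where "rep = inv_into (carrier K) level"

lemma rep: "l \<in> level ` carrier K \<Longrightarrow> rep l \<in> carrier K \<and> level (rep l) = l"
  unfolding rep_def by (simp add: f_inv_into_f inv_into_into)

definition level_sum :: "('k \<Rightarrow> 'f) \<Rightarrow> 'f" where
  "level_sum f = (\<Sum>l\<in>level ` carrier K. f (rep l))"

text \<open>
Left translation by \<open>t\<close> permutes the finite quotient.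
\<close>

lemma level_sum_translate:
  assumes inv: "\<And>g h. g \<in> carrier K \<Longrightarrow> h \<in> carrier K \<Longrightarrow> level g = level h \<Longrightarrow> f g = f h"
    and t: "t \<in> carrier K"
  shows "level_sum (\<lambda>g. f (t \<otimes> g)) = level_sum f"
  unfolding level_sum_def
proof (rule sum.reindex_bij_witness[where i = "\<lambda>l. level (inv t \<otimes> rep l)" and j = "\<lambda>l. level (t \<otimes> rep l)"])
  have cancel: "level (s \<otimes> rep (level (s' \<otimes> rep l))) = l"
    if l: "l \<in> level ` carrier K" and s: "s \<in> carrier K" "s' \<in> carrier K" "s \<otimes> s' = \<one>" for l s s'
  proof -
    have "level (s \<otimes> rep (level (s' \<otimes> rep l))) = level (s \<otimes> (s' \<otimes> rep l))"
      using rep[OF l] s rep[of "level (s' \<otimes> rep l)"] by (intro level_mult) auto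
    then show ?thesis using rep[OF l] s by (simp add: m_assoc[symmetric])
  qed
  fix l assume l: "l \<in> level ` carrier K"
  show "level (inv t \<otimes> rep (level (t \<otimes> rep l))) = l" "level (t \<otimes> rep (level (inv t \<otimes> rep l))) = l"
    using cancel[OF l] t by auto
  show "level (inv t \<otimes> rep l) \<in> level ` carrier K" "level (t \<otimes> rep l) \<in> level ` carrier K"
    using rep[OF l] t by simp_all
  have "rep l \<in> carrier K" using rep[OF l] by simp
  then show "f (rep (level (t \<otimes> rep l))) = f (t \<otimes> rep l)"
    using rep[of "level (t \<otimes> rep l)"] t by (intro inv) simp_all
qed

text \<open>
The fixed field of the kernel of \<open>level\<close>; on it the finite quotient acts.
\<close>

definition level_field :: "'f set" where
  "level_field = {x \<in> F. \<forall>g\<in>carrier K. \<forall>h\<in>carrier K. level g = level h \<longrightarrow> act g x = act h x}"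

lemma level_field_F: "x \<in> level_field \<Longrightarrow> x \<in> F"
  unfolding level_field_def by simp

lemma level_field_act:
  "x \<in> level_field \<Longrightarrow> g \<in> carrier K \<Longrightarrow> h \<in> carrier K \<Longrightarrow> level g = level h \<Longrightarrow> act g x = act h x"
  unfolding level_field_def by blast

text \<open>
Distinct elements of the finite quotient are distinct characters of the level field, because they
already differ on \<open>Y\<close>; so a combination with non-zero coefficients does not vanish identically.
\<close>

lemma exists_twisted_trace_nonzero:
  fixes u :: "'k \<Rightarrow> 'f"
  assumes "\<And>g. g \<in> carrier K \<Longrightarrow> u g \<noteq> 0"
  obtains c where "c \<in> level_field" "level_sum (\<lambda>g. u g * act g c) \<noteq> 0"
proof (rule ccontr)
  note obtained = that
  assume contra: "\<not> thesis"
  have rel: "level_sum (\<lambda>g. u g * act g c) = 0" if c: "c \<in> level_field" for c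
  proof (rule ccontr)
    assume "level_sum (\<lambda>g. u g * act g c) \<noteq> 0"
    with c have thesis by (rule obtained)
    with contra show False by (rule notE)
  qed
  have 1: "level \<one> \<in> level ` carrier K" by simp
  have "u (rep (level \<one>)) = 0"
  proof (rule dedekind_independence[where M = level_field and I = "level ` carrier K" and c = "\<lambda>l. u (rep l)"
        and f = "\<lambda>l. act (rep l)" and i = "level \<one>"])
    show "finite (level ` carrier K)" by (rule finite_levels)
    show "x * y \<in> level_field" if xy: "x \<in> level_field" "y \<in> level_field" for x y
    proof -
      have "x \<in> F" "y \<in> F" using xy by (simp_all add: level_field_F)
      moreover have "act g (x * y) = act h (x * y)"
        if "g \<in> carrier K" "h \<in> carrier K" "level g = level h" for g h
        using level_field_act[OF xy(1) that] level_field_act[OF xy(2) that] calculation that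
        by (simp add: act_mult)
      ultimately show ?thesis unfolding level_field_def using mult_F by blast
    qed
    fix l assume l: "l \<in> level ` carrier K"
    show "act (rep l) (x * y) = act (rep l) x * act (rep l) y"
      if "x \<in> level_field" "y \<in> level_field" for x y
      using that rep[OF l] by (simp add: act_mult level_field_F)
    show "\<exists>x\<in>level_field. act (rep l) x \<noteq> 0"
      using rep[OF l] by (intro bexI[of _ 1]) (auto simp: level_field_def one_F)
    fix l' assume l': "l' \<in> level ` carrier K" "l \<noteq> l'"
    then have "level (rep l) \<noteq> level (rep l')" using rep l by metis
    then obtain y where "y \<in> Y" "act (rep l) y \<noteq> act (rep l') y" unfolding level_eq_iff by auto
    moreover from this have "y \<in> level_field" using Y_F unfolding level_field_def level_eq_iff by auto
    ultimately show "\<exists>x\<in>level_field. act (rep l) x \<noteq> act (rep l') x" by auto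
  next
    fix c assume "c \<in> level_field"
    then show "(\<Sum>l\<in>level ` carrier K. u (rep l) * act (rep l) c) = 0"
      using rel[of c] unfolding level_sum_def by simp
  qed (use 1 in auto)
  then show False using assms rep[OF 1] by blast
qed

definition derived_level :: "'k set" where
  "derived_level = {g \<in> carrier K. \<exists>d\<in>derived K (carrier K). level g = level d}"

lemma derived_level_normal: "derived_level \<lhd> K"
proof -
  have D: "derived K (carrier K) \<lhd> K" by (rule derived_self_is_normal)
  interpret D: normal "derived K (carrier K)" K by (rule D)
  have sub: "subgroup derived_level K"
  proof (rule subgroupI)
    show "derived_level \<subseteq> carrier K" unfolding derived_level_def by auto
    have "\<one> \<in> derived_level" using D.one_closed unfolding derived_level_def by auto
    then show "derived_level \<noteq> {}" by auto
    fix a assume "a \<in> derived_level"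
    then obtain d where d: "d \<in> derived K (carrier K)" "a \<in> carrier K" "level a = level d"
      unfolding derived_level_def by auto
    then show "inv a \<in> derived_level"
      using level_inv[of a d] D.m_inv_closed unfolding derived_level_def by auto
    fix b assume "b \<in> derived_level"
    then obtain e where e: "e \<in> derived K (carrier K)" "b \<in> carrier K" "level b = level e"
      unfolding derived_level_def by auto
    show "a \<otimes> b \<in> derived_level"
      using level_mult[of a d b e] d e unfolding derived_level_def by auto
  qed
  show ?thesis
  proof (rule normal_invI[OF sub])
    fix g a assume g: "g \<in> carrier K" and "a \<in> derived_level"
    then obtain d where d: "d \<in> derived K (carrier K)" "a \<in> carrier K" "level a = level d"
      unfolding derived_level_def by auto
    have "level (g \<otimes> a \<otimes> inv g) = level (g \<otimes> d \<otimes> inv g)"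
      using d g by (intro level_mult) auto
    moreover have "g \<otimes> d \<otimes> inv g \<in> derived K (carrier K)" using D.inv_op_closed2 d g by auto
    ultimately show "g \<otimes> a \<otimes> inv g \<in> derived_level" using d g unfolding derived_level_def by auto
  qed
qed

text \<open>
Modulo \<open>derived_level\<close> the group is finite and abelian, and the coset of \<open>s\<close> has order exactly the
prime \<open>q\<close>, so there is a character of the quotient that detects it.
\<close>

lemma exists_level_character:
  fixes \<zeta> :: "'c::alg_closed_field"
  assumes s: "s \<in> carrier K" "s \<notin> derived_level" and q: "s [^] q \<in> derived_level" "Factorial_Ring.prime (q::nat)"
    and \<zeta>: "\<zeta> \<noteq> 1" "\<zeta> ^ q = 1"
  obtains \<theta> :: "'k \<Rightarrow> 'c" where "character_on (carrier K) \<theta>" "\<theta> s \<noteq> 1"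
    "\<And>g h. g \<in> carrier K \<Longrightarrow> h \<in> carrier K \<Longrightarrow> level g = level h \<Longrightarrow> \<theta> g = \<theta> h"
proof -
  let ?N = derived_level
  interpret N: normal ?N K by (rule derived_level_normal)
  have D_le: "derived K (carrier K) \<subseteq> ?N"
    using derived_in_carrier[of "carrier K"] unfolding derived_level_def by auto
  have coset_eq: "?N #> g = ?N #> h" if "g \<in> carrier K" "h \<in> carrier K" "g \<otimes> inv h \<in> ?N" for g h
  proof -
    have "g \<otimes> inv h \<otimes> h \<in> ?N #> h" using that N.subset by (intro rcosI) auto
    then have "g \<in> ?N #> h" using that by (simp add: m_assoc)
    then show ?thesis using repr_independence that N.subgroup_axioms by metis
  qed
  have coset_level: "?N #> g = ?N #> h" if "g \<in> carrier K" "h \<in> carrier K" "level g = level h" for g h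
  proof (rule coset_eq)
    have "level (g \<otimes> inv h) = level (h \<otimes> inv h)" using that by (intro level_mult) auto
    then show "g \<otimes> inv h \<in> ?N"
      using that subgroup.one_closed[OF derived_is_subgroup[of "carrier K"]]
      unfolding derived_level_def by auto
  qed (use that in auto)
  have fin: "finite (carrier (K Mod ?N))"
  proof -
    have "carrier (K Mod ?N) \<subseteq> (\<lambda>l. ?N #> rep l) ` (level ` carrier K)"
    proof
      fix C assume "C \<in> carrier (K Mod ?N)"
      then obtain g where g: "g \<in> carrier K" "C = ?N #> g" by (auto simp: FactGroup_def RCOSETS_def)
      then have "C = ?N #> rep (level g)" using coset_level[of g "rep (level g)"] rep[of "level g"] by auto
      then show "C \<in> (\<lambda>l. ?N #> rep l) ` (level ` carrier K)" using g by auto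
    qed
    then show ?thesis using finite_levels by (meson finite_imageI finite_subset)
  qed
  interpret Q: comm_group "K Mod ?N"
  proof (rule group.group_comm_groupI[OF N.factorgroup_is_group])
    fix C E assume "C \<in> carrier (K Mod ?N)" "E \<in> carrier (K Mod ?N)"
    then obtain g h where g: "g \<in> carrier K" "C = ?N #> g" and h: "h \<in> carrier K" "E = ?N #> h"
      by (auto simp: carrier_FactGroup)
    have "g \<otimes> h \<otimes> inv g \<otimes> inv h \<in> derived K (carrier K)"
      unfolding derived_def using g h by (intro generate.incl) auto
    moreover have "(g \<otimes> h) \<otimes> inv (h \<otimes> g) = g \<otimes> h \<otimes> inv g \<otimes> inv h"
      using g h by (simp add: inv_mult_group m_assoc)
    ultimately have "?N #> (g \<otimes> h) = ?N #> (h \<otimes> g)"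
      using D_le g h by (intro coset_eq) auto
    then show "C \<otimes>\<^bsub>K Mod ?N\<^esub> E = E \<otimes>\<^bsub>K Mod ?N\<^esub> C"
      using g h by (simp add: N.rcos_sum)
  qed
  let ?C = "?N #> s"
  have C: "?C \<in> carrier (K Mod ?N)" using s by (auto simp: carrier_FactGroup)
  have "?C [^]\<^bsub>K Mod ?N\<^esub> q = \<one>\<^bsub>K Mod ?N\<^esub>"
    using s q coset_join2[OF _ N.subgroup_axioms] by (simp add: N.FactGroup_pow)
  then have "Q.ord ?C dvd q" using Q.pow_eq_id[OF C] by blast
  moreover have "?C \<noteq> \<one>\<^bsub>K Mod ?N\<^esub>"
    using s coset_join1[OF _ _ N.subgroup_axioms] by auto
  then have "Q.ord ?C \<noteq> 1" using Q.ord_eq_1[OF C] by blast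
  ultimately have "Q.ord ?C = q" using q(2) unfolding prime_nat_iff by blast
  then have "\<zeta> ^ Q.ord ?C = 1" using \<zeta>(2) by simp
  then obtain \<theta>' :: "'k set \<Rightarrow> 'c" where \<theta>': "Q.character_on (carrier (K Mod ?N)) \<theta>'" "\<theta>' ?C \<noteq> 1"
    by (rule Q.exists_character_nontrivial_at[OF fin C \<zeta>(1)])
  show ?thesis
  proof (rule that[of "\<lambda>g. \<theta>' (?N #> g)"])
    show "character_on (carrier K) (\<lambda>g. \<theta>' (?N #> g))"
      unfolding character_on_def
    proof (intro conjI ballI)
      fix g h assume "g \<in> carrier K" "h \<in> carrier K"
      then show "\<theta>' (?N #> g) \<noteq> 0" "\<theta>' (?N #> (g \<otimes> h)) = \<theta>' (?N #> g) * \<theta>' (?N #> h)"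
        using \<theta>'(1) N.rcos_sum[of g h] unfolding Q.character_on_def carrier_FactGroup by force+
    qed
  next
    show "\<theta>' (?N #> s) \<noteq> 1" by (rule \<theta>'(2))
  next
    fix g h assume "g \<in> carrier K" "h \<in> carrier K" "level g = level h"
    then show "\<theta>' (?N #> g) = \<theta>' (?N #> h)" by (rule coset_level[THEN arg_cong])
  qed
qed

text \<open>
Two powers of \<open>g\<close> have the same level since there are only finitely many levels.
\<close>

lemma level_character_root_of_unity:
  assumes \<theta>: "character_on (carrier K) \<theta>"
    and inv: "\<And>g h. g \<in> carrier K \<Longrightarrow> h \<in> carrier K \<Longrightarrow> level g = level h \<Longrightarrow> \<theta> g = \<theta> h"
    and g: "g \<in> carrier K"
  obtains n :: nat where "n > 0" "\<theta> g ^ n = 1"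
proof -
  have "\<not> inj_on (\<lambda>i::nat. level (g [^] i)) UNIV"
  proof
    assume "inj_on (\<lambda>i::nat. level (g [^] i)) UNIV"
    moreover have "(\<lambda>i::nat. level (g [^] i)) ` UNIV \<subseteq> level ` carrier K" using g by auto
    ultimately have "finite (UNIV :: nat set)" using finite_levels inj_on_finite by blast
    then show False by simp
  qed
  then obtain i j :: nat where ij: "i < j" "level (g [^] i) = level (g [^] j)"
    unfolding inj_on_def by (metis linorder_neqE_nat)
  then have "\<theta> g ^ i = \<theta> g ^ j"
    using inv[of "g [^] i" "g [^] j"] character_on_pow[OF \<theta> subgroup_self g] g by simp
  moreover have "\<theta> g \<noteq> 0" using \<theta> g unfolding character_on_def by auto
  ultimately have "\<theta> g ^ (j - i) = 1" using ij(1) by (simp add: power_diff)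
  then show ?thesis using that[of "j - i"] ij(1) by simp
qed

lemma level_character_exponent:
  assumes \<theta>: "character_on (carrier K) \<theta>"
    and inv: "\<And>g h. g \<in> carrier K \<Longrightarrow> h \<in> carrier K \<Longrightarrow> level g = level h \<Longrightarrow> \<theta> g = \<theta> h"
  obtains N :: nat where "N > 0" "\<And>g. g \<in> carrier K \<Longrightarrow> \<theta> g ^ N = 1"
proof -
  have "\<exists>n::nat. n > 0 \<and> \<theta> (rep l) ^ n = 1" if "l \<in> level ` carrier K" for l
    using level_character_root_of_unity[OF \<theta> inv, of "rep l"] rep[OF that] by metis
  then obtain n :: "_ \<Rightarrow> nat" where n: "\<And>l. l \<in> level ` carrier K \<Longrightarrow> n l > 0 \<and> \<theta> (rep l) ^ n l = 1"
    by metis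
  show ?thesis
  proof (rule that)
    show "prod n (level ` carrier K) > 0" using n by (auto intro!: prod_pos)
    fix g assume g: "g \<in> carrier K"
    then have l: "level g \<in> level ` carrier K" by simp
    have "n (level g) dvd prod n (level ` carrier K)" using finite_levels l by (rule dvd_prodI)
    then obtain k where k: "prod n (level ` carrier K) = n (level g) * k" by (auto elim: dvdE)
    have "\<theta> g = \<theta> (rep (level g))" using inv[of g "rep (level g)"] rep[OF l] g by simp
    then show "\<theta> g ^ prod n (level ` carrier K) = 1"
      using n[OF l] unfolding k by (simp add: power_mult)
  qed
qed

end

section \<open>Roots of unity and the prime field\<close>

lemma cis_2pi_eq_1_iff:
  assumes "N > 0"
  shows "cis (2 * pi * of_int a / of_nat N) = 1 \<longleftrightarrow> int N dvd a"
proof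
  assume "cis (2 * pi * of_int a / of_nat N) = 1"
  then have "cos (2 * pi * of_int a / of_nat N) = 1" by (simp add: complex_eq_iff)
  then obtain n :: int where "2 * pi * of_int a / of_nat N = of_int n * 2 * pi"
    unfolding cos_one_2pi_int by blast
  then have "of_int a = (of_int (n * int N) :: real)" using assms by (simp add: field_simps)
  then have "a = n * int N" using of_int_eq_iff by blast
  then show "int N dvd a" by simp
next
  assume "int N dvd a"
  then obtain n where "a = int N * n" by (auto elim: dvdE)
  then have "2 * pi * of_int a / of_nat N = 2 * pi * of_int n" using assms by simp
  then show "cis (2 * pi * of_int a / of_nat N) = 1" by (simp add: cis_multiple_2pi)
qed

lemma root_of_unity_eq_cis:
  assumes "N > 0" "z ^ N = 1"
  obtains a :: int where "z = cis (2 * pi * of_int a / of_nat N)"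
proof -
  have "z \<in> (\<lambda>k. cis (2 * pi * real k / real N)) ` {..<N}"
    using Complex.bij_betw_roots_unity[OF assms(1)] assms(2) unfolding bij_betw_def by auto
  then obtain k where "z = cis (2 * pi * real k / real N)" by auto
  then show ?thesis using that[of "int k"] by simp
qed

lemma of_int_power_CHAR:
  assumes "Factorial_Ring.prime CHAR('f::Fields.field)"
  shows "(of_int a :: 'f) ^ CHAR('f) = of_int a"
proof -
  have nat: "(of_nat n :: 'f) ^ CHAR('f) = of_nat n" for n
    by (induction n) (simp_all add: freshmans_dream[OF assms refl] CHAR_not_1' zero_power prime_gt_0_nat[OF assms])
  have m: "a mod int CHAR('f) \<ge> 0" using prime_gt_0_nat[OF assms] by simp
  have "(of_int a :: 'f) = of_int (a mod int CHAR('f))"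
    using of_int_eq_0_iff_char_dvd[where ?'a = 'f, of "a - a mod int CHAR('f)"] by simp
  also have "\<dots> = of_nat (nat (a mod int CHAR('f)))" using m by simp
  finally show ?thesis using nat by metis
qed

text \<open>
The \<open>p\<close> elements of the prime field exhaust the roots of \<open>t ^ p - t\<close>.
\<close>

lemma artin_schreier_kernel:
  fixes x :: "'f::Fields.field"
  assumes p: "Factorial_Ring.prime CHAR('f)" and x: "x ^ CHAR('f) = x"
  obtains a :: int where "x = of_int a"
proof -
  let ?p = "CHAR('f)" and ?P = "Polynomial.monom 1 CHAR('f) - [:0, 1:] :: 'f poly"
  have p1: "?p > 1" using p by (rule prime_gt_1_nat)
  have "Polynomial.coeff ?P ?p = 1" using p1 by (simp add: coeff_pCons split: nat.splits)
  then have P0: "?P \<noteq> 0" by (metis coeff_0 zero_neq_one)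
  have deg: "Polynomial.degree ?P \<le> ?p"
    using p1 by (intro degree_diff_le) (auto simp: degree_monom_le)
  let ?R = "{y. poly ?P y = 0}" and ?I = "(of_nat :: nat \<Rightarrow> 'f) ` {..<?p}"
  have R: "y \<in> ?R \<longleftrightarrow> y ^ ?p = y" for y by (simp add: poly_monom)
  have "inj_on (of_nat :: nat \<Rightarrow> 'f) {..<?p}"
  proof (rule inj_onI)
    fix i j assume ij: "i \<in> {..<?p}" "j \<in> {..<?p}" "(of_nat i :: 'f) = of_nat j"
    then have "(of_int (int i - int j) :: 'f) = 0" by simp
    then have "int ?p dvd int i - int j" by (simp only: of_int_eq_0_iff_char_dvd)
    then have "int i mod int ?p = int j mod int ?p" by (simp only: mod_eq_dvd_iff)
    then show "i = j" using ij by simp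
  qed
  then have card: "card ?I = ?p" by (simp add: card_image)
  have sub: "?I \<subseteq> ?R" using of_int_power_CHAR[OF p, of "int _"] by (auto simp: poly_monom)
  have fin: "finite ?R" using poly_roots_finite[OF P0] .
  have "card ?R \<le> ?p" using card_poly_roots_bound[OF P0] deg by simp
  then have "?I = ?R" using card_seteq[OF fin sub] card by simp
  then have "x \<in> ?I" using R x by blast
  then show ?thesis using that by (metis imageE of_int_of_nat_eq)
qed

lemma exists_nontrivial_root_of_unity:
  assumes "Factorial_Ring.prime q" "of_nat q \<noteq> (0::'f::alg_closed_field)"
  obtains \<zeta> :: "'f::alg_closed_field" where "\<zeta> \<noteq> 1" "\<zeta> ^ q = 1"
proof -
  \<comment> \<open>Its roots are \<open>q\<close>-th roots of unity, and its value at 1 is \<open>q \<noteq> 0\<close>.\<close>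
  let ?P = "\<Sum>i<q. Polynomial.monom 1 i :: 'f poly"
  have q: "q > 1" using assms(1) by (rule prime_gt_1_nat)
  have "Polynomial.coeff ?P 1 = 1" using q by (simp add: coeff_sum sum.delta)
  then have "Polynomial.degree ?P > 0" by (metis le_degree zero_less_one zero_neq_one less_le_trans)
  then obtain \<zeta> where "poly ?P \<zeta> = 0" using alg_closed_imp_poly_has_root by blast
  then have \<zeta>: "(\<Sum>i<q. \<zeta> ^ i) = 0" by (simp add: poly_sum poly_monom)
  have "\<zeta> ^ q - 1 = (\<zeta> - 1) * (\<Sum>i<q. \<zeta> ^ i)" by (rule power_diff_1_eq)
  then have "\<zeta> ^ q = 1" using \<zeta> by simp
  moreover have "\<zeta> \<noteq> 1" using \<zeta> assms(2) by auto
  ultimately show ?thesis using that by blast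
qed

section \<open>Divisibility of characters\<close>

text \<open>
What the separable closure of a field that contains all roots of unity provides: roots of unity are
fixed, and Kummer as well as Artin--Schreier equations are solvable.
\<close>

locale galois_action = field_action K F act
  for K :: "('k, 'm) monoid_scheme" (structure) and F :: "'f::alg_closed_field set" and act +
  assumes root_of_unity_F: "n > 0 \<Longrightarrow> z ^ n = 1 \<Longrightarrow> z \<in> F"
    and act_root_of_unity: "n > 0 \<Longrightarrow> z ^ n = 1 \<Longrightarrow> g \<in> carrier K \<Longrightarrow> act g z = z"
    and prime_root_F: "Factorial_Ring.prime q \<Longrightarrow> of_nat q \<noteq> (0::'f) \<Longrightarrow> b ^ q \<in> F \<Longrightarrow> b \<in> F"
    and artin_schreier_root_F: "Factorial_Ring.prime CHAR('f) \<Longrightarrow> b ^ CHAR('f) - b \<in> F \<Longrightarrow> b \<in> F"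
begin

lemma finite_level_orbits:
  assumes "finite A" "A \<subseteq> F"
  shows "finite_level K F act (\<Union>x\<in>A. (\<lambda>g. act g x) ` carrier K)"
proof unfold_locales
  show "finite (\<Union>x\<in>A. (\<lambda>g. act g x) ` carrier K)" using assms finite_orbit by auto
  show "(\<Union>x\<in>A. (\<lambda>g. act g x) ` carrier K) \<subseteq> F" using assms by (auto simp: act_F)
  fix g y assume "g \<in> carrier K" "y \<in> (\<Union>x\<in>A. (\<lambda>g. act g x) ` carrier K)"
  then obtain x h where x: "x \<in> A" "h \<in> carrier K" "y = act h x" "g \<in> carrier K" by auto
  then have "act g y = act (g \<otimes> h) x" using assms by (auto simp: act_comp)
  then show "act g y \<in> (\<Union>x\<in>A. (\<lambda>g. act g x) ` carrier K)" using x by auto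
qed

text \<open>
Away from the characteristic, every continuous character \<open>\<theta>\<close> with values in roots of unity has a \<open>q\<close>-th
root.  As the values of \<open>\<theta>\<close> are fixed by the action, \<open>\<theta>\<close> is a cocycle, and by Hilbert 90
\<open>\<theta> g = act g a / a\<close>.  If \<open>b ^ q = a\<close>, then \<open>\<psi> g = act g b / b\<close> satisfies \<open>\<psi> g ^ q = \<theta> g\<close>; its values
are roots of unity again, hence fixed, and therefore \<open>\<psi>\<close> is a homomorphism.
\<close>

lemma kummer_step:
  assumes level: "finite_level K F act Y"
    and q: "Factorial_Ring.prime q" "of_nat q \<noteq> (0::'f)"
    and \<theta>: "character_on (carrier K) \<theta>"
    and inv: "\<And>g h. g \<in> carrier K \<Longrightarrow> h \<in> carrier K \<Longrightarrow> (\<forall>y\<in>Y. act g y = act h y) \<Longrightarrow> \<theta> g = (\<theta> h :: 'f)"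
  obtains \<psi> :: "'k \<Rightarrow> 'f" and b where "character_on (carrier K) \<psi>" "\<And>g. g \<in> carrier K \<Longrightarrow> \<psi> g ^ q = \<theta> g"
    "b \<in> F" "\<And>g h. act g b = act h b \<Longrightarrow> \<psi> g = \<psi> h"
proof -
  interpret finite_level K F act Y by (rule level)
  have inv': "\<theta> g = \<theta> h" if "g \<in> carrier K" "h \<in> carrier K" "level g = level h" for g h
    by (rule inv) (use that in \<open>auto simp: level_eq_iff\<close>)
  have \<theta>0: "\<theta> g \<noteq> 0" if "g \<in> carrier K" for g using \<theta> that unfolding character_on_def by blast
  have \<theta>m: "\<theta> (g \<otimes> h) = \<theta> g * \<theta> h" if "g \<in> carrier K" "h \<in> carrier K" for g h
    using \<theta> that unfolding character_on_def by blast
  have \<theta>F: "\<theta> g \<in> F" "h \<in> carrier K \<Longrightarrow> act h (\<theta> g) = \<theta> g" if g: "g \<in> carrier K" for g h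
  proof -
    obtain n :: nat where n: "n > 0" "\<theta> g ^ n = 1"
      by (rule level_character_root_of_unity[OF \<theta> inv' g])
    show "\<theta> g \<in> F" using root_of_unity_F[OF n] .
    show "h \<in> carrier K \<Longrightarrow> act h (\<theta> g) = \<theta> g" using act_root_of_unity[OF n] .
  qed
  obtain c where c: "c \<in> level_field" "level_sum (\<lambda>g. inverse (\<theta> g) * act g c) \<noteq> 0"
    by (rule exists_twisted_trace_nonzero[of "\<lambda>g. inverse (\<theta> g)"]) (use \<theta>0 in auto)
  have cF: "c \<in> F" using c(1) by (rule level_field_F)
  define a where "a = level_sum (\<lambda>g. inverse (\<theta> g) * act g c)"
  have aF: "a \<in> F"
    unfolding a_def level_sum_def using rep cF \<theta>F by (intro F_closed) auto
  have a: "act t a = \<theta> t * a" if t: "t \<in> carrier K" for t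
  proof -
    have "act t a = (\<Sum>l\<in>level ` carrier K. act t (inverse (\<theta> (rep l)) * act (rep l) c))"
      unfolding a_def level_sum_def using rep cF \<theta>F t by (intro act_sum F_closed) auto
    also have "\<dots> = (\<Sum>l\<in>level ` carrier K. \<theta> t * (inverse (\<theta> (t \<otimes> rep l)) * act (t \<otimes> rep l) c))"
    proof (rule sum.cong[OF refl])
      fix l assume "l \<in> level ` carrier K"
      then have r: "rep l \<in> carrier K" using rep by blast
      then show "act t (inverse (\<theta> (rep l)) * act (rep l) c) = \<theta> t * (inverse (\<theta> (t \<otimes> rep l)) * act (t \<otimes> rep l) c)"
        using t \<theta>F[OF r] cF \<theta>m[OF t r] \<theta>0[OF t] by (simp add: act_mult act_inverse act_comp F_closed)
    qed
    also have "\<dots> = \<theta> t * level_sum (\<lambda>g. inverse (\<theta> (t \<otimes> g)) * act (t \<otimes> g) c)"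
      unfolding level_sum_def by (simp add: sum_distrib_left)
    also have "level_sum (\<lambda>g. inverse (\<theta> (t \<otimes> g)) * act (t \<otimes> g) c) = a"
      unfolding a_def
    proof (rule level_sum_translate[OF _ t])
      fix g h assume gh: "g \<in> carrier K" "h \<in> carrier K" "level g = level h"
      show "inverse (\<theta> g) * act g c = inverse (\<theta> h) * act h c"
        using inv'[OF gh] level_field_act[OF c(1) gh] by simp
    qed
    finally show ?thesis .
  qed
  have q0: "q > 0" using q(1) by (rule prime_gt_0_nat)
  obtain b where b: "b ^ q = a" using alg_closed_nth_root[OF q0] by metis
  have bF: "b \<in> F" using prime_root_F[OF q, of b] aF b by simp
  have b0: "b \<noteq> 0" using c(2) b q0 unfolding a_def[symmetric] by auto
  have a0: "a \<noteq> 0" using b b0 by auto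
  define \<psi> where "\<psi> g = act g b / b" for g
  have pow: "\<psi> g ^ q = \<theta> g" if g: "g \<in> carrier K" for g
    using a[OF g] a0 b unfolding \<psi>_def power_divide act_power[OF g bF, symmetric] by simp
  have fix_\<psi>: "\<psi> h \<in> F" "act g (\<psi> h) = \<psi> h" if g: "g \<in> carrier K" and h: "h \<in> carrier K" for g h
  proof -
    obtain n :: nat where n: "n > 0" "\<theta> h ^ n = 1"
      by (rule level_character_root_of_unity[OF \<theta> inv' h])
    then have "q * n > 0" "\<psi> h ^ (q * n) = 1" using pow[OF h] q0 by (simp_all add: power_mult)
    then show "\<psi> h \<in> F" "act g (\<psi> h) = \<psi> h" using root_of_unity_F act_root_of_unity g by blast+
  qed
  show ?thesis
  proof (rule that)
    show "character_on (carrier K) \<psi>"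
      unfolding character_on_def
    proof (intro conjI ballI)
      fix g h assume g: "g \<in> carrier K" and h: "h \<in> carrier K"
      show "\<psi> g \<noteq> 0" using act_eq_0_iff[OF g bF] b0 unfolding \<psi>_def by simp
      have "act h b = \<psi> h * b" using b0 unfolding \<psi>_def by simp
      then have "act (g \<otimes> h) b = \<psi> h * act g b"
        using g h bF fix_\<psi>[OF g h] by (simp add: act_comp act_mult)
      then show "\<psi> (g \<otimes> h) = \<psi> g * \<psi> h" unfolding \<psi>_def[of "g \<otimes> h"] \<psi>_def[of g] by simp
    qed
    show "\<psi> g = \<psi> h" if "act g b = act h b" for g h using that unfolding \<psi>_def by simp
  qed (use pow bF in auto)
qed

text \<open>
In characteristic \<open>p\<close>, a continuous homomorphism to the integers modulo \<open>N\<close>, given by an integer lift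
\<open>h\<close>, lifts to one modulo \<open>N * p\<close>.  The obstruction is the carry cocycle
\<open>c g k = (h g + h k - h (g \<otimes> k)) div N\<close> modulo \<open>p\<close>, and it vanishes for the following reason.  With an
element \<open>t\<close> of trace 1, averaging against \<open>t\<close> makes \<open>c\<close> the coboundary of a cochain \<open>b\<close> with values in
\<open>F\<close>.  The Frobenius fixes the values of \<open>c\<close>, so \<open>w = b ^ p - b\<close> is a 1-cocycle, and averaging again
writes it as \<open>act g d - d\<close>.  If \<open>e ^ p - e = d\<close>, subtracting \<open>act g e - e\<close> from \<open>b\<close> makes it take values
in the prime field without changing its coboundary \<open>c\<close>.  The result \<open>\<beta>\<close> corrects the carry:
\<open>\<psi> = h - N * \<beta>\<close>.
\<close>

lemma artin_schreier_step:
  fixes h :: "'k \<Rightarrow> int"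
  assumes level: "finite_level K F act Y" and p: "Factorial_Ring.prime CHAR('f)" and N: "N > 0"
    and hom: "\<And>g k. g \<in> carrier K \<Longrightarrow> k \<in> carrier K \<Longrightarrow> int N dvd h g + h k - h (g \<otimes> k)"
    and inv: "\<And>g k. g \<in> carrier K \<Longrightarrow> k \<in> carrier K \<Longrightarrow> (\<forall>y\<in>Y. act g y = act k y) \<Longrightarrow> h g = h k"
  obtains \<psi> :: "'k \<Rightarrow> int" and e where
    "\<And>g k. g \<in> carrier K \<Longrightarrow> k \<in> carrier K \<Longrightarrow> int (N * CHAR('f)) dvd \<psi> g + \<psi> k - \<psi> (g \<otimes> k)"
    "\<And>g. g \<in> carrier K \<Longrightarrow> int N dvd \<psi> g - h g" "e \<in> F"
    "\<And>g k. g \<in> carrier K \<Longrightarrow> k \<in> carrier K \<Longrightarrow> (\<forall>y\<in>insert e Y. act g y = act k y) \<Longrightarrow> \<psi> g = \<psi> k"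
proof -
  interpret finite_level K F act Y by (rule level)
  let ?p = "CHAR('f)"
  have inv': "h g = h k" if "g \<in> carrier K" "k \<in> carrier K" "level g = level k" for g k
    by (rule inv) (use that in \<open>auto simp: level_eq_iff\<close>)
  obtain c0 where c0: "c0 \<in> level_field" "level_sum (\<lambda>g. 1 * act g c0) \<noteq> 0"
    by (rule exists_twisted_trace_nonzero[of "\<lambda>g. 1"]) auto
  have c0F: "c0 \<in> F" using c0(1) by (rule level_field_F)
  define s where "s = level_sum (\<lambda>g. act g c0)"
  have s0: "s \<noteq> 0" using c0 unfolding s_def by simp
  have sF: "s \<in> F" unfolding s_def level_sum_def using rep c0F by (intro F_closed) auto
  have s: "act g s = s" if g: "g \<in> carrier K" for g
  proof -
    have "act g s = (\<Sum>l\<in>level ` carrier K. act g (act (rep l) c0))"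
      unfolding s_def level_sum_def using rep c0F g by (intro act_sum F_closed) auto
    also have "\<dots> = level_sum (\<lambda>k. act (g \<otimes> k) c0)"
      unfolding level_sum_def using rep c0F g by (intro sum.cong) (auto simp: act_comp)
    also have "\<dots> = s" unfolding s_def
      by (rule level_sum_translate[OF _ g]) (use level_field_act[OF c0(1)] in blast)
    finally show ?thesis .
  qed
  define t where "t = c0 / s"
  have tF: "t \<in> F" unfolding t_def using c0F sF by (rule divide_F)
  have act_t: "act g t = act g c0 / s" if "g \<in> carrier K" for g
    unfolding t_def using that c0F sF s by (simp add: act_divide)
  have t_level: "act g t = act k t" if "g \<in> carrier K" "k \<in> carrier K" "level g = level k" for g k
    using act_t that level_field_act[OF c0(1) that] by simp
  have trace_t: "level_sum (\<lambda>g. act g t) = 1"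
  proof -
    have "level_sum (\<lambda>g. act g t) = (\<Sum>l\<in>level ` carrier K. act (rep l) c0 / s)"
      unfolding level_sum_def using rep act_t by (intro sum.cong) auto
    also have "\<dots> = s / s" unfolding sum_divide_distrib[symmetric] by (simp add: s_def level_sum_def)
    finally show ?thesis using s0 by simp
  qed
  \<comment> \<open>Averaging against \<open>t\<close> is the contracting homotopy for cochains with values in \<open>F\<close>.\<close>
  define T where "T g f = level_sum (\<lambda>r. f r * act (g \<otimes> r) t)" for g f
  have T_cong: "T g f = T g f'" if "\<And>r. r \<in> carrier K \<Longrightarrow> f r = f' r" for g f f'
    unfolding T_def level_sum_def using rep that by (intro sum.cong) auto
  have T_add: "T g (\<lambda>r. f r + f' r) = T g f + T g f'" for g f f'
    unfolding T_def level_sum_def by (simp add: distrib_right sum.distrib)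
  have T_const: "T g (\<lambda>r. x) = x" if g: "g \<in> carrier K" for g x
  proof -
    have "T g (\<lambda>r. x) = x * level_sum (\<lambda>k. act (g \<otimes> k) t)"
      unfolding T_def level_sum_def by (rule sum_distrib_left[symmetric])
    also have "level_sum (\<lambda>k. act (g \<otimes> k) t) = level_sum (\<lambda>k. act k t)"
      by (rule level_sum_translate[OF t_level g])
    finally show ?thesis unfolding trace_t by simp
  qed
  have T_translate: "T g f = T (g \<otimes> k) (\<lambda>r. f (k \<otimes> r))"
    if f: "\<And>r r'. r \<in> carrier K \<Longrightarrow> r' \<in> carrier K \<Longrightarrow> level r = level r' \<Longrightarrow> f r = f r'"
      and g: "g \<in> carrier K" and k: "k \<in> carrier K" for f g k
  proof -
    have "T g f = level_sum (\<lambda>r. f (k \<otimes> r) * act (g \<otimes> (k \<otimes> r)) t)"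
      unfolding T_def
    proof (rule level_sum_translate[symmetric, OF _ k])
      fix r r' assume r: "r \<in> carrier K" "r' \<in> carrier K" "level r = level r'"
      have "act (g \<otimes> r) t = act (g \<otimes> r') t"
        by (intro t_level level_mult m_closed) (use r g in simp_all)
      then show "f r * act (g \<otimes> r) t = f r' * act (g \<otimes> r') t" using f[OF r] by simp
    qed
    also have "\<dots> = T (g \<otimes> k) (\<lambda>r. f (k \<otimes> r))"
      unfolding T_def level_sum_def using rep g k by (intro sum.cong) (auto simp: m_assoc)
    finally show ?thesis .
  qed
  have act_T: "act g (T k f) = T (g \<otimes> k) (\<lambda>r. act g (f r))"
    if f: "\<And>r. r \<in> carrier K \<Longrightarrow> f r \<in> F" and g: "g \<in> carrier K" and k: "k \<in> carrier K" for f g k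
  proof -
    have "act g (T k f) = (\<Sum>l\<in>level ` carrier K. act g (f (rep l) * act (k \<otimes> rep l) t))"
      unfolding T_def level_sum_def using rep tF g k f by (intro act_sum F_closed) auto
    also have "\<dots> = T (g \<otimes> k) (\<lambda>r. act g (f r))"
      unfolding T_def level_sum_def using rep tF g k f
      by (intro sum.cong) (auto simp: act_comp act_mult F_closed)
    finally show ?thesis .
  qed
  have T_F: "T g f \<in> F" if "\<And>k. k \<in> carrier K \<Longrightarrow> f k \<in> F" "g \<in> carrier K" for f g
    unfolding T_def level_sum_def using rep tF that by (intro F_closed) auto
  define c where "c g k = (h g + h k - h (g \<otimes> k)) div int N" for g k
  have Nc: "int N * c g k = h g + h k - h (g \<otimes> k)" if "g \<in> carrier K" "k \<in> carrier K" for g k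
    unfolding c_def using hom[OF that] by simp
  have cocycle: "c g k + c (g \<otimes> k) r = c k r + c g (k \<otimes> r)"
    if "g \<in> carrier K" "k \<in> carrier K" "r \<in> carrier K" for g k r
  proof -
    have "int N * (c g k + c (g \<otimes> k) r) = int N * (c k r + c g (k \<otimes> r))"
      using that by (simp add: distrib_left Nc m_assoc)
    then show ?thesis using N by simp
  qed
  have c_level: "c g k = c g' k'"
    if "g \<in> carrier K" "g' \<in> carrier K" "k \<in> carrier K" "k' \<in> carrier K" "level g = level g'" "level k = level k'"
    for g g' k k'
  proof -
    have "h g = h g'" "h k = h k'" "h (g \<otimes> k) = h (g' \<otimes> k')"
      by (intro inv' m_closed level_mult; use that in simp)+
    then show ?thesis unfolding c_def by simp
  qed
  define b where "b g = T g (\<lambda>r. of_int (c g r))" for g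
  have bF: "b g \<in> F" if "g \<in> carrier K" for g unfolding b_def using that by (intro T_F of_int_F)
  have b_level: "b g = b k" if gk: "g \<in> carrier K" "k \<in> carrier K" "level g = level k" for g k
    unfolding b_def T_def level_sum_def
  proof (rule sum.cong[OF refl])
    fix l assume "l \<in> level ` carrier K"
    then have r: "rep l \<in> carrier K" using rep by blast
    have "c g (rep l) = c k (rep l)" by (rule c_level) (use gk r in simp_all)
    moreover have "act (g \<otimes> rep l) t = act (k \<otimes> rep l) t"
      by (intro t_level level_mult m_closed) (use gk r in simp_all)
    ultimately show "of_int (c g (rep l)) * act (g \<otimes> rep l) t = of_int (c k (rep l)) * act (k \<otimes> rep l) t" by simp
  qed
  have b_cocycle: "b g + act g (b k) = b (g \<otimes> k) + of_int (c g k)" if g: "g \<in> carrier K" and k: "k \<in> carrier K" for g k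
  proof -
    have gk: "g \<otimes> k \<in> carrier K" using g k by simp
    have 1: "b g = T (g \<otimes> k) (\<lambda>r. of_int (c g (k \<otimes> r)))"
      unfolding b_def
    proof (rule T_translate[of "\<lambda>r. of_int (c g r)" g k, OF _ g k])
      fix r r' assume "r \<in> carrier K" "r' \<in> carrier K" "level r = level r'"
      then have "c g r = c g r'" by (intro c_level g refl)
      then show "(of_int (c g r) :: 'f) = of_int (c g r')" by simp
    qed
    have 2: "act g (b k) = T (g \<otimes> k) (\<lambda>r. of_int (c k r))"
      unfolding b_def act_T[of "\<lambda>r. of_int (c k r)" g k, OF of_int_F g k] act_of_int[OF g] ..
    have "b g + act g (b k) = T (g \<otimes> k) (\<lambda>r. of_int (c g (k \<otimes> r)) + of_int (c k r))"
      unfolding 1 2 T_add ..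
    also have "\<dots> = T (g \<otimes> k) (\<lambda>r. of_int (c (g \<otimes> k) r) + of_int (c g k))"
    proof (rule T_cong)
      fix r assume r: "r \<in> carrier K"
      have "c g (k \<otimes> r) + c k r = c (g \<otimes> k) r + c g k" using cocycle[OF g k r] by linarith
      then show "(of_int (c g (k \<otimes> r)) + of_int (c k r) :: 'f) = of_int (c (g \<otimes> k) r) + of_int (c g k)"
        by (metis of_int_add)
    qed
    also have "\<dots> = b (g \<otimes> k) + of_int (c g k)"
      unfolding T_add T_const[OF gk] b_def ..
    finally show ?thesis .
  qed
  define w where "w g = b g ^ ?p - b g" for g
  have wF: "w g \<in> F" if "g \<in> carrier K" for g unfolding w_def using bF[OF that] by (intro F_closed)
  have w_level: "w g = w k" if "g \<in> carrier K" "k \<in> carrier K" "level g = level k" for g k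
    unfolding w_def using b_level[OF that] by simp
  have w_cocycle: "act g (w k) = w (g \<otimes> k) + - w g" if g: "g \<in> carrier K" and k: "k \<in> carrier K" for g k
  proof -
    have "(b g + act g (b k)) ^ ?p = (b (g \<otimes> k) + of_int (c g k)) ^ ?p" using b_cocycle[OF g k] by simp
    then have "b g ^ ?p + act g (b k) ^ ?p = b (g \<otimes> k) ^ ?p + of_int (c g k)"
      by (simp add: freshmans_dream[OF p refl] of_int_power_CHAR[OF p])
    then have "act g (b k) ^ ?p = b (g \<otimes> k) ^ ?p + of_int (c g k) - b g ^ ?p"
      by (simp add: eq_diff_eq add.commute)
    moreover have "act g (b k) = b (g \<otimes> k) + of_int (c g k) - b g"
      using b_cocycle[OF g k] by (simp add: eq_diff_eq add.commute)
    moreover have "y' - y = (z' - z) - (x' - x)" if "y' = z' + C - x'" "y = z + C - x" for x x' y y' z z' C :: 'f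
      unfolding that by (simp add: algebra_simps)
    ultimately have "act g (b k) ^ ?p - act g (b k) = w (g \<otimes> k) - w g"
      unfolding w_def by blast
    moreover have "act g (w k) = act g (b k) ^ ?p - act g (b k)"
      unfolding w_def using g bF[OF k] by (simp add: act_diff act_power F_closed)
    ultimately show ?thesis by simp
  qed
  define d where "d = - T \<one> w"
  have dF: "d \<in> F" unfolding d_def using wF by (intro uminus_F T_F) auto
  have act_d: "act g d = d + w g" if g: "g \<in> carrier K" for g
  proof -
    have "act g (T \<one> w) = T g (\<lambda>r. act g (w r))" using act_T[OF wF g one_closed] g by simp
    also have "\<dots> = T g (\<lambda>r. w (g \<otimes> r) + - w g)" by (rule T_cong) (rule w_cocycle[OF g])
    also have "\<dots> = T g (\<lambda>r. w (g \<otimes> r)) + - w g" unfolding T_add T_const[OF g] ..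
    also have "T g (\<lambda>r. w (g \<otimes> r)) = T \<one> w" using T_translate[OF w_level one_closed g] g by simp
    finally show ?thesis unfolding d_def using g T_F[OF wF one_closed] by (simp add: act_uminus)
  qed
  have p1: "?p > 1" using p by (rule prime_gt_1_nat)
  obtain e where e: "e ^ ?p - e = d"
  proof -
    let ?P = "Polynomial.monom 1 ?p - [:d, 1:] :: 'f poly"
    have "Polynomial.coeff ?P ?p = 1" using p1 by (simp add: coeff_pCons split: nat.splits)
    then have "Polynomial.degree ?P > 0" using p1 by (metis le_degree less_le_trans zero_less_one less_trans zero_neq_one)
    then obtain e where "poly ?P e = 0" using alg_closed_imp_poly_has_root by blast
    then show ?thesis using that[of e] by (simp add: poly_monom algebra_simps)
  qed
  have eF: "e \<in> F" by (rule artin_schreier_root_F[OF p]) (simp add: e dF)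
  define \<beta>' where "\<beta>' g = b g - (act g e - e)" for g
  define \<beta> where "\<beta> g = (SOME a. \<beta>' g = of_int a)" for g
  have \<beta>: "\<beta>' g = of_int (\<beta> g)" if g: "g \<in> carrier K" for g
  proof -
    have "(\<beta>' g + act g e) ^ ?p = (b g + e) ^ ?p" unfolding \<beta>'_def by simp
    then have "\<beta>' g ^ ?p + act g e ^ ?p = b g ^ ?p + e ^ ?p" by (simp add: freshmans_dream[OF p refl])
    then have 1: "\<beta>' g ^ ?p = b g ^ ?p + e ^ ?p - act g e ^ ?p" by (simp add: eq_diff_eq)
    have "act g (e ^ ?p - e) = act g e ^ ?p - act g e"
      using g eF by (simp add: act_diff act_power F_closed)
    then have "act g e ^ ?p - act g e = d + w g" using act_d[OF g] unfolding e by simp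
    then have 2: "act g e ^ ?p = d + w g + act g e" by (simp only: diff_eq_eq)
    have "\<beta>' g ^ ?p = \<beta>' g"
      unfolding 1 2 w_def e[symmetric] by (simp add: \<beta>'_def algebra_simps)
    then obtain a where "\<beta>' g = of_int a" by (rule artin_schreier_kernel[OF p])
    then show ?thesis unfolding \<beta>_def by (rule someI)
  qed
  have \<beta>_hom: "int ?p dvd c g k - (\<beta> g + \<beta> k - \<beta> (g \<otimes> k))" if g: "g \<in> carrier K" and k: "k \<in> carrier K" for g k
  proof -
    have gk: "g \<otimes> k \<in> carrier K" using g k by simp
    have "act g (\<beta>' k) = \<beta>' k" unfolding \<beta>[OF k] using g by (rule act_of_int)
    moreover have "act g (\<beta>' k) = act g (b k) - (act (g \<otimes> k) e - act g e)"
      unfolding \<beta>'_def using g k eF bF[OF k] by (simp add: act_diff act_comp F_closed)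
    ultimately have 1: "\<beta>' k = act g (b k) - (act (g \<otimes> k) e - act g e)" by simp
    have 2: "act g (b k) = b (g \<otimes> k) + of_int (c g k) - b g"
      using b_cocycle[OF g k] by (simp add: eq_diff_eq add.commute)
    have "\<beta>' g + \<beta>' k - \<beta>' (g \<otimes> k) = of_int (c g k)"
      unfolding 1 2 \<beta>'_def[of g] \<beta>'_def[of "g \<otimes> k"] by (simp add: algebra_simps)
    then have "(of_int (c g k - (\<beta> g + \<beta> k - \<beta> (g \<otimes> k))) :: 'f) = 0"
      unfolding \<beta>[OF g] \<beta>[OF k] \<beta>[OF gk] by simp
    then show ?thesis by (simp only: of_int_eq_0_iff_char_dvd)
  qed
  show ?thesis
  proof (rule that)
    fix g k assume g: "g \<in> carrier K" and k: "k \<in> carrier K"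
    have "(h g - int N * \<beta> g) + (h k - int N * \<beta> k) - (h (g \<otimes> k) - int N * \<beta> (g \<otimes> k))
        = int N * (c g k - (\<beta> g + \<beta> k - \<beta> (g \<otimes> k)))"
      unfolding right_diff_distrib Nc[OF g k] by (simp add: algebra_simps)
    then show "int (N * ?p) dvd (h g - int N * \<beta> g) + (h k - int N * \<beta> k) - (h (g \<otimes> k) - int N * \<beta> (g \<otimes> k))"
      using \<beta>_hom[OF g k] by simp
  next
    fix g assume "g \<in> carrier K"
    show "int N dvd h g - int N * \<beta> g - h g" by simp
  next
    show "e \<in> F" by (rule eF)
  next
    fix g k assume gk: "g \<in> carrier K" "k \<in> carrier K" and agree: "\<forall>y\<in>insert e Y. act g y = act k y"
    have l: "level g = level k" using agree unfolding level_eq_iff by simp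
    have "\<beta>' g = \<beta>' k" unfolding \<beta>'_def using b_level[OF gk l] agree by simp
    then have "\<beta> g = \<beta> k" unfolding \<beta>_def by simp
    then show "h g - int N * \<beta> g = h k - int N * \<beta> k" using inv'[OF gk l] by simp
  qed
qed

text \<open>
If \<open>s\<close> is not in the closure, some continuous character \<open>\<theta>\<close> has \<open>\<theta> s \<noteq> 1\<close>.  Dividing \<open>\<theta>\<close> by \<open>q\<close> in the
group of continuous characters gives \<open>\<psi>\<close> with \<open>\<psi> (s ^ q) = \<theta> s\<close>, yet \<open>\<psi>\<close> is trivial at \<open>s ^ q\<close>.  The
values are taken in \<open>'f\<close> if \<open>q\<close> differs from the characteristic; otherwise \<open>'f\<close> has no
non-trivial \<open>q\<close>-th root of unity, and complex values, read as classes of integers modulo \<open>N\<close>, take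
their place.
\<close>

lemma prime_pow_in_derived_closure:
  assumes s: "s \<in> carrier K" and q: "Factorial_Ring.prime (q::nat)" and sq: "s [^] q \<in> derived_closure"
  shows "s \<in> derived_closure"
proof (rule ccontr)
  assume "s \<notin> derived_closure"
  then have "\<exists>A. finite A \<and> A \<subseteq> F \<and> \<not> (\<exists>d\<in>derived K (carrier K). \<forall>x\<in>A. act d x = act s x)"
    using s unfolding derived_closure_def mem_Collect_eq by metis
  then obtain A where A: "finite A" "A \<subseteq> F"
    and no: "\<not> (\<exists>d\<in>derived K (carrier K). \<forall>x\<in>A. act d x = act s x)"
    by (elim exE conjE)
  define Y where "Y = (\<Union>x\<in>A. (\<lambda>g. act g x) ` carrier K)"
  have level: "finite_level K F act Y" unfolding Y_def using A(1,2) by (rule finite_level_orbits)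
  interpret finite_level K F act Y by (rule level)
  have AY: "A \<subseteq> Y"
  proof
    fix x assume "x \<in> A"
    then have "x = act \<one> x" using A(2) act_one by auto
    then show "x \<in> Y" unfolding Y_def using \<open>x \<in> A\<close> by blast
  qed
  have s': "s \<notin> derived_level"
  proof
    assume "s \<in> derived_level"
    then obtain d where d: "d \<in> derived K (carrier K)" "level s = level d" unfolding derived_level_def by auto
    then have "\<forall>x\<in>A. act d x = act s x" using AY unfolding level_eq_iff by (metis subsetD)
    then have "\<exists>d\<in>derived K (carrier K). \<forall>x\<in>A. act d x = act s x" using d(1) by (rule bexI)
    with no show False by (rule notE)
  qed
  obtain d where d: "d \<in> derived K (carrier K)" "\<forall>y\<in>Y. act d y = act (s [^] q) y"
    using sq finite_Y Y_F unfolding derived_closure_def by blast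
  then have "level (s [^] q) = level d" unfolding level_eq_iff by simp
  then have sq': "s [^] q \<in> derived_level" using d(1) s unfolding derived_level_def by auto
  note level_char = exists_level_character[OF s s' sq' q]
  show False
  proof (cases "of_nat q = (0 :: 'f)")
    case False
    obtain \<zeta> :: 'f where \<zeta>: "\<zeta> \<noteq> 1" "\<zeta> ^ q = 1" by (rule exists_nontrivial_root_of_unity[OF q False])
    obtain \<theta> :: "'k \<Rightarrow> 'f" where \<theta>: "character_on (carrier K) \<theta>" "\<theta> s \<noteq> 1"
      "\<And>g h. g \<in> carrier K \<Longrightarrow> h \<in> carrier K \<Longrightarrow> level g = level h \<Longrightarrow> \<theta> g = \<theta> h"
      using level_char[OF \<zeta>] by blast
    have inv: "\<theta> g = \<theta> h" if "g \<in> carrier K" "h \<in> carrier K" "\<forall>y\<in>Y. act g y = act h y" for g h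
      by (rule \<theta>(3)) (use that in \<open>auto simp: level_eq_iff\<close>)
    obtain \<psi> b where \<psi>: "character_on (carrier K) \<psi>" "\<And>g. g \<in> carrier K \<Longrightarrow> \<psi> g ^ q = \<theta> g"
      "b \<in> F" "\<And>g h. act g b = act h b \<Longrightarrow> \<psi> g = \<psi> h"
    proof (rule kummer_step[OF level q False \<theta>(1)])
      fix \<psi> b
      assume "character_on (carrier K) \<psi>" "\<And>g. g \<in> carrier K \<Longrightarrow> \<psi> g ^ q = \<theta> g"
        "b \<in> F" "\<And>g h. act g b = act h b \<Longrightarrow> \<psi> g = \<psi> h"
      then show thesis by (rule that)
    qed (rule inv)
    have "\<psi> (s [^] q) = 1"
    proof (rule character_trivial_on_derived_closure[OF \<psi>(1) _ _ _ sq])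
      show "finite {b}" "{b} \<subseteq> F" using \<psi>(3) by auto
      fix g h assume "\<And>x. x \<in> {b} \<Longrightarrow> act g x = act h x"
      then have "act g b = act h b" by blast
      then show "\<psi> g = \<psi> h" by (rule \<psi>(4))
    qed
    then have "\<theta> s = 1"
      using character_on_pow[OF \<psi>(1) subgroup_self s] \<psi>(2)[OF s] by simp
    with \<theta>(2) show False by simp
  next
    case True
    then have "CHAR('f) dvd q" by (simp add: of_nat_eq_0_iff_char_dvd)
    moreover have "CHAR('f) \<noteq> 1" using CHAR_not_1'[where ?'a = 'f] by simp
    ultimately have p: "CHAR('f) = q" using q unfolding prime_nat_iff by blast
    have "of_nat q \<noteq> (0 :: complex)" using prime_gt_0_nat[OF q] by simp
    then obtain \<zeta> :: complex where \<zeta>: "\<zeta> \<noteq> 1" "\<zeta> ^ q = 1" by (rule exists_nontrivial_root_of_unity[OF q])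
    obtain \<theta> :: "'k \<Rightarrow> complex" where \<theta>: "character_on (carrier K) \<theta>" "\<theta> s \<noteq> 1"
      "\<And>g h. g \<in> carrier K \<Longrightarrow> h \<in> carrier K \<Longrightarrow> level g = level h \<Longrightarrow> \<theta> g = \<theta> h"
      using level_char[OF \<zeta>] by blast
    obtain N where N: "N > 0" "\<And>g. g \<in> carrier K \<Longrightarrow> \<theta> g ^ N = 1"
    proof (rule level_character_exponent[OF \<theta>(1)])
      fix N :: nat
      assume "N > 0" "\<And>g. g \<in> carrier K \<Longrightarrow> \<theta> g ^ N = 1"
      then show thesis by (rule that)
    qed (rule \<theta>(3))
    \<comment> \<open>The choice depends on \<open>\<theta> g\<close> alone, so \<open>h\<close> is constant on levels like \<open>\<theta>\<close>.\<close>
    define h :: "'k \<Rightarrow> int" where "h g = (SOME a. \<theta> g = cis (2 * pi * of_int a / of_nat N))" for g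
    have h: "\<theta> g = cis (2 * pi * of_int (h g) / of_nat N)" if g: "g \<in> carrier K" for g
    proof -
      obtain a :: int where "\<theta> g = cis (2 * pi * of_int a / of_nat N)"
        by (rule root_of_unity_eq_cis[OF N(1) N(2)[OF g]])
      then show ?thesis unfolding h_def by (rule someI)
    qed
    have cis3: "cis (2 * pi * of_int (a + b - c) / of_nat M)
        = cis (2 * pi * of_int a / of_nat M) * cis (2 * pi * of_int b / of_nat M) / cis (2 * pi * of_int c / of_nat M)"
      for a b c :: int and M :: nat
      by (simp add: cis_mult cis_divide add_divide_distrib diff_divide_distrib algebra_simps)
    have hom: "int N dvd h g + h k - h (g \<otimes> k)" if g: "g \<in> carrier K" and k: "k \<in> carrier K" for g k
    proof -
      have "\<theta> (g \<otimes> k) = \<theta> g * \<theta> k" "\<theta> (g \<otimes> k) \<noteq> 0" using \<theta>(1) g k unfolding character_on_def by auto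
      then have "cis (2 * pi * of_int (h g + h k - h (g \<otimes> k)) / of_nat N) = 1"
        unfolding cis3 using h[OF g] h[OF k] h[of "g \<otimes> k"] g k by simp
      then show ?thesis using cis_2pi_eq_1_iff[OF N(1)] by blast
    qed
    have inv: "h g = h k" if "g \<in> carrier K" "k \<in> carrier K" "\<forall>y\<in>Y. act g y = act k y" for g k
    proof -
      have "\<theta> g = \<theta> k" by (rule \<theta>(3)) (use that in \<open>auto simp: level_eq_iff\<close>)
      then show ?thesis unfolding h_def by simp
    qed
    have char_prime: "Factorial_Ring.prime CHAR('f)" using p q by simp
    obtain \<psi> :: "'k \<Rightarrow> int" and e where \<psi>:
      "\<And>g k. g \<in> carrier K \<Longrightarrow> k \<in> carrier K \<Longrightarrow> int (N * q) dvd \<psi> g + \<psi> k - \<psi> (g \<otimes> k)"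
      "\<And>g. g \<in> carrier K \<Longrightarrow> int N dvd \<psi> g - h g" "e \<in> F"
      "\<And>g k. g \<in> carrier K \<Longrightarrow> k \<in> carrier K \<Longrightarrow> (\<forall>y\<in>insert e Y. act g y = act k y) \<Longrightarrow> \<psi> g = \<psi> k"
    proof (rule artin_schreier_step[OF level char_prime N(1), unfolded p])
      fix \<psi> :: "'k \<Rightarrow> int" and e
      assume "\<And>g k. g \<in> carrier K \<Longrightarrow> k \<in> carrier K \<Longrightarrow> int (N * q) dvd \<psi> g + \<psi> k - \<psi> (g \<otimes> k)"
        "\<And>g. g \<in> carrier K \<Longrightarrow> int N dvd \<psi> g - h g" "e \<in> F"
        "\<And>g k. g \<in> carrier K \<Longrightarrow> k \<in> carrier K \<Longrightarrow> \<forall>y\<in>insert e Y. act g y = act k y \<Longrightarrow> \<psi> g = \<psi> k"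
      then show thesis by (rule that)
    qed (rule hom, assumption+, rule inv)
    define \<Psi> where "\<Psi> g = cis (2 * pi * of_int (\<psi> g) / of_nat (N * q))" for g
    have Nq: "N * q > 0" using N(1) prime_gt_0_nat[OF q] by simp
    have \<Psi>: "character_on (carrier K) \<Psi>"
      unfolding character_on_def
    proof (intro conjI ballI)
      fix g k assume gk: "g \<in> carrier K" "k \<in> carrier K"
      show "\<Psi> g \<noteq> 0" unfolding \<Psi>_def by simp
      have "cis (2 * pi * of_int (\<psi> g + \<psi> k - \<psi> (g \<otimes> k)) / of_nat (N * q)) = 1"
        using cis_2pi_eq_1_iff[OF Nq] \<psi>(1)[OF gk] by blast
      then show "\<Psi> (g \<otimes> k) = \<Psi> g * \<Psi> k" unfolding cis3 \<Psi>_def by simp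
    qed
    have "\<Psi> (s [^] q) = 1"
    proof (rule character_trivial_on_derived_closure[OF \<Psi> _ _ _ sq])
      show "finite (insert e Y)" "insert e Y \<subseteq> F" using finite_Y Y_F \<psi>(3) by auto
      fix g k assume gk: "g \<in> carrier K" "k \<in> carrier K"
        and "\<And>y. y \<in> insert e Y \<Longrightarrow> act g y = act k y"
      then have "\<forall>y\<in>insert e Y. act g y = act k y" by blast
      with gk have "\<psi> g = \<psi> k" by (rule \<psi>(4))
      then show "\<Psi> g = \<Psi> k" unfolding \<Psi>_def by simp
    qed
    then have "\<Psi> s ^ q = 1" using character_on_pow[OF \<Psi> subgroup_self s] by simp
    then have "cis (2 * pi * of_int (int q * \<psi> s) / of_nat (N * q)) = 1"
      unfolding \<Psi>_def Complex.DeMoivre by (simp add: mult_ac)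
    then have "int (N * q) dvd int q * \<psi> s" using cis_2pi_eq_1_iff[OF Nq] by blast
    then have "int N dvd \<psi> s" using prime_gt_0_nat[OF q] by (simp add: mult.commute)
    then have "int N dvd h s" using \<psi>(2)[OF s] by (metis dvd_diff_right_iff)
    then have "\<theta> s = 1" using h[OF s] cis_2pi_eq_1_iff[OF N(1)] by simp
    with \<theta>(2) show False by simp
  qed
qed

theorem pow_in_derived_closure:
  assumes "n > 0" and "s \<in> carrier K" and "s [^] (n::nat) \<in> derived_closure"
  shows "s \<in> derived_closure"
  using assms
proof (induction n arbitrary: s rule: less_induct)
  case (less n)
  show ?case
  proof (cases "n = 1")
    case True
    then show ?thesis using less.prems by simp
  next
    case False
    then obtain q where q: "Factorial_Ring.prime q" "q dvd n" using prime_factor_nat by blast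
    then obtain m where m: "n = m * q" by (metis dvdE mult.commute)
    have "m < n" "m > 0" using m less.prems(1) prime_gt_1_nat[OF q(1)] by auto
    moreover have "(s [^] m) [^] q \<in> derived_closure" using less.prems m by (simp add: nat_pow_pow)
    then have "s [^] m \<in> derived_closure"
      using prime_pow_in_derived_closure[OF _ q(1)] less.prems(2) by simp
    ultimately show ?thesis using less.IH less.prems(2) by blast
  qed
qed

end

section \<open>The quotient by the derived closure\<close>

lemma (in field_action) derived_closure_subset: "derived_closure \<subseteq> carrier K"
  unfolding derived_closure_def by blast

lemma (in field_action) derived_closureE:
  assumes "a \<in> derived_closure" "finite A" "A \<subseteq> F"
  obtains d where "d \<in> derived K (carrier K)" "d \<in> carrier K" "\<forall>x\<in>A. act d x = act a x"
proof -
  obtain d where d: "d \<in> derived K (carrier K)" "\<forall>x\<in>A. act d x = act a x"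
    using assms unfolding derived_closure_def by blast
  have "d \<in> carrier K" using d(1) derived_in_carrier[of "carrier K"] by auto
  from that[OF d(1) this d(2)] show ?thesis .
qed

lemma (in field_action) act_eq_inv:
  assumes "g \<in> carrier K" "h \<in> carrier K" "x \<in> F" "act g (act (inv h) x) = act h (act (inv h) x)"
  shows "act (inv g) x = act (inv h) x"
proof -
  have hx: "act (inv h) x \<in> F" using assms by (intro act_F) auto
  have "act h (act (inv h) x) = x" using assms by (simp add: act_comp[symmetric] act_one)
  then have "act g (act (inv h) x) = x" using assms(4) by simp
  then have "act (inv g) (act g (act (inv h) x)) = act (inv g) x" by simp
  then show ?thesis using act_inv[OF assms(1) hx] by simp
qed

text \<open>
Group operations are continuous: to approximate \<open>a \<otimes> b\<close> on \<open>A\<close>, approximate \<open>b\<close> on \<open>A\<close> and \<open>a\<close> on the image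
of \<open>A\<close> under \<open>b\<close>, and similarly for inverses and conjugates.
\<close>

lemma (in field_action) derived_closure_normal: "derived_closure \<lhd> K"
proof -
  interpret D: normal "derived K (carrier K)" K by (rule derived_self_is_normal)
  have sub: "subgroup derived_closure K"
  proof (rule subgroupI)
    show "derived_closure \<subseteq> carrier K" by (rule derived_closure_subset)
    have "\<one> \<in> derived_closure" unfolding derived_closure_def using D.one_closed by auto
    then show "derived_closure \<noteq> {}" by auto
  next
    fix a assume a: "a \<in> derived_closure"
    then have aK: "a \<in> carrier K" using derived_closure_subset by auto
    have "\<exists>d\<in>derived K (carrier K). \<forall>x\<in>A. act d x = act (inv a) x" if A: "finite A" "A \<subseteq> F" for A
    proof -
      have "finite (act (inv a) ` A)" "act (inv a) ` A \<subseteq> F" using A aK by (auto intro: act_F)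
      then obtain d where d: "d \<in> derived K (carrier K)" "d \<in> carrier K" "\<forall>x\<in>act (inv a) ` A. act d x = act a x"
        by (rule derived_closureE[OF a])
      have "act (inv d) x = act (inv a) x" if "x \<in> A" for x
        by (rule act_eq_inv) (use d aK A that in auto)
      then show ?thesis using D.m_inv_closed[OF d(1)] by blast
    qed
    then show "inv a \<in> derived_closure" unfolding derived_closure_def using aK by blast
  next
    fix a b assume a: "a \<in> derived_closure" and b: "b \<in> derived_closure"
    then have K: "a \<in> carrier K" "b \<in> carrier K" using derived_closure_subset by auto
    have "\<exists>d\<in>derived K (carrier K). \<forall>x\<in>A. act d x = act (a \<otimes> b) x" if A: "finite A" "A \<subseteq> F" for A
    proof -
      obtain e where e: "e \<in> derived K (carrier K)" "e \<in> carrier K" "\<forall>x\<in>A. act e x = act b x"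
        by (rule derived_closureE[OF b A])
      have "finite (act b ` A)" "act b ` A \<subseteq> F" using A K by (auto intro: act_F)
      then obtain d where d: "d \<in> derived K (carrier K)" "d \<in> carrier K" "\<forall>x\<in>act b ` A. act d x = act a x"
        by (rule derived_closureE[OF a])
      have "act (d \<otimes> e) x = act (a \<otimes> b) x" if "x \<in> A" for x
      proof -
        have "x \<in> F" using A that by auto
        then show ?thesis using d e K that by (simp add: act_comp)
      qed
      then show ?thesis using D.m_closed[OF d(1) e(1)] by blast
    qed
    then show "a \<otimes> b \<in> derived_closure" unfolding derived_closure_def using K by blast
  qed
  show ?thesis
  proof (rule normal_invI[OF sub])
    fix g a assume g: "g \<in> carrier K" and a: "a \<in> derived_closure"
    then have aK: "a \<in> carrier K" using derived_closure_subset by auto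
    have "\<exists>d\<in>derived K (carrier K). \<forall>x\<in>A. act d x = act (g \<otimes> a \<otimes> inv g) x" if A: "finite A" "A \<subseteq> F" for A
    proof -
      have "finite (act (inv g) ` A)" "act (inv g) ` A \<subseteq> F" using A g by (auto intro: act_F)
      then obtain d where d: "d \<in> derived K (carrier K)" "d \<in> carrier K" "\<forall>x\<in>act (inv g) ` A. act d x = act a x"
        by (rule derived_closureE[OF a])
      have "act (g \<otimes> d \<otimes> inv g) x = act (g \<otimes> a \<otimes> inv g) x" if "x \<in> A" for x
      proof -
        have x: "x \<in> F" using A that by auto
        then have gx: "act (inv g) x \<in> F" using g by (intro act_F) auto
        then show ?thesis using d g aK x that by (simp add: act_comp act_F)
      qed
      then show ?thesis using D.inv_op_closed2[OF g d(1)] by blast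
    qed
    then show "g \<otimes> a \<otimes> inv g \<in> derived_closure" unfolding derived_closure_def using g aK by blast
  qed
qed

lemma (in galois_action) torsion_free_mod_derived_closure: "torsion_free (K Mod derived_closure)"
  unfolding torsion_free_def
proof (intro ballI allI impI)
  interpret D: normal derived_closure K by (rule derived_closure_normal)
  fix C and n :: nat
  assume "C \<in> carrier (K Mod derived_closure)" and n: "n > 0"
    and pow: "C [^]\<^bsub>K Mod derived_closure\<^esub> n = \<one>\<^bsub>K Mod derived_closure\<^esub>"
  then obtain s where s: "s \<in> carrier K" "C = derived_closure #> s" by (auto simp: carrier_FactGroup)
  have "derived_closure #> (s [^] n) = derived_closure"
    using pow s D.FactGroup_pow[OF s(1)] by simp
  then have "s [^] n \<in> derived_closure"
    using coset_join1[OF _ _ D.subgroup_axioms] s by simp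
  then have "s \<in> derived_closure" by (rule pow_in_derived_closure[OF n s(1)])
  then show "C = \<one>\<^bsub>K Mod derived_closure\<^esub>"
    using coset_join2[OF _ D.subgroup_axioms] s by simp
qed

section \<open>The separable closure\<close>

abbreviation lift_poly :: "'a::Fields.field poly \<Rightarrow> 'a alg_closure poly" where
  "lift_poly \<equiv> map_poly to_ac"

lemma lift_poly_pCons [simp]: "lift_poly (pCons a p) = pCons (to_ac a) (lift_poly p)"
  by (simp add: map_poly_pCons)

lemma lift_poly_add: "lift_poly (p + q) = lift_poly p + lift_poly q"
  by (rule poly_eqI) (simp add: coeff_map_poly)

lemma lift_poly_diff: "lift_poly (p - q) = lift_poly p - lift_poly q"
  by (rule poly_eqI) (simp add: coeff_map_poly)

lemma lift_poly_mult: "lift_poly (p * q) = lift_poly p * lift_poly q"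
  by (rule poly_eqI) (simp add: coeff_map_poly coeff_mult to_ac_sum)

lemma lift_poly_pcompose: "lift_poly (p \<circ>\<^sub>p q) = lift_poly p \<circ>\<^sub>p lift_poly q"
  by (induction p) (simp_all add: pcompose_pCons lift_poly_add lift_poly_mult)

lemma lift_poly_pderiv: "lift_poly (pderiv p) = pderiv (lift_poly p)"
  by (rule poly_eqI) (simp add: coeff_map_poly coeff_pderiv)

lemma lift_poly_monom: "lift_poly (Polynomial.monom c n) = Polynomial.monom (to_ac c) n"
  by (simp add: map_poly_monom)

lemma lift_poly_eq_0_iff [simp]: "lift_poly p = 0 \<longleftrightarrow> p = 0"
  by (rule map_poly_eq_0_iff) auto

lemma degree_lift_poly [simp]: "Polynomial.degree (lift_poly p) = Polynomial.degree p"
  by (cases "p = 0") (auto intro: map_poly_degree_eq)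

lemma order_eq_1_iff:
  fixes p :: "'f::Fields.field poly"
  assumes "p \<noteq> 0" "poly p a = 0"
  shows "Polynomial.order a p = 1 \<longleftrightarrow> poly (pderiv p) a \<noteq> 0"
proof -
  obtain q where q: "p = [:- a, 1:] * q" using assms(2) unfolding poly_eq_0_iff_dvd by (auto elim: dvdE)
  have "Polynomial.order a p = Polynomial.order a [:- a, 1:] + Polynomial.order a q"
    using assms(1) unfolding q by (rule order_mult)
  also have "Polynomial.order a [:- a, 1:] = 1" using order_power_n_n[of a 1] by simp
  finally have "Polynomial.order a p = 1 \<longleftrightarrow> poly q a \<noteq> 0"
    using assms(1) q by (auto simp: order_root)
  moreover have "poly (pderiv p) a = poly q a"
    unfolding q pderiv_mult by (simp add: pderiv_pCons)
  ultimately show ?thesis by simp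
qed

lemma rsquarefree_iff_simple_roots:
  fixes p :: "'f::Fields.field poly"
  shows "rsquarefree p \<longleftrightarrow> p \<noteq> 0 \<and> (\<forall>a. poly p a = 0 \<longrightarrow> poly (pderiv p) a \<noteq> 0)"
  unfolding rsquarefree_def using order_eq_1_iff[of p] by (metis order_root)

lemma exists_minimal_polynomial:
  fixes x :: "'a::Fields.field alg_closure"
  obtains f :: "'a poly" where "Factorial_Ring.irreducible f" "poly (lift_poly f) x = 0"
    "\<forall>p. poly (lift_poly p) x = 0 \<longrightarrow> f dvd p"
proof -
  obtain p0 :: "'a poly" where p0: "p0 \<noteq> 0" "poly (lift_poly p0) x = 0" by (rule alg_closure_algebraic)
  obtain f :: "'a poly" where f: "f \<noteq> 0" "poly (lift_poly f) x = 0"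
    and least: "\<And>p. p \<noteq> 0 \<Longrightarrow> poly (lift_poly p) x = 0 \<Longrightarrow> Polynomial.degree f \<le> Polynomial.degree p"
    using arg_min_natI[of "\<lambda>p. p \<noteq> 0 \<and> poly (lift_poly p) x = 0" p0 Polynomial.degree]
      arg_min_nat_le[of "\<lambda>p. p \<noteq> 0 \<and> poly (lift_poly p) x = 0" _ Polynomial.degree] p0
    by blast
  have dvd: "f dvd p" if "poly (lift_poly p) x = 0" for p
  proof (rule ccontr)
    assume "\<not> f dvd p"
    then have r: "p mod f \<noteq> 0" by (simp add: mod_eq_0_iff_dvd)
    have "lift_poly p = lift_poly (p div f) * lift_poly f + lift_poly (p mod f)"
      by (simp add: lift_poly_mult[symmetric] lift_poly_add[symmetric])
    then have "poly (lift_poly (p mod f)) x = 0" using that f(2) by simp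
    then have "Polynomial.degree f \<le> Polynomial.degree (p mod f)" using least r by blast
    then show False using degree_mod_less[OF f(1), of p] r by simp
  qed
  have "Factorial_Ring.irreducible f"
  proof (rule comm_semiring_1_class.irreducibleI)
    show "f \<noteq> 0" by (rule f)
    show "\<not> f dvd 1"
    proof
      assume "f dvd 1"
      then obtain g where "1 = f * g" by (auto elim: dvdE)
      then have "lift_poly f * lift_poly g = 1" by (simp add: lift_poly_mult[symmetric])
      then have "poly (lift_poly f) x * poly (lift_poly g) x = 1" by (metis poly_1 poly_mult)
      then show False using f(2) by simp
    qed
    fix a b assume ab: "f = a * b"
    then have "poly (lift_poly a) x * poly (lift_poly b) x = 0" using f(2) by (simp add: lift_poly_mult)
    then have "f dvd a \<or> f dvd b" using dvd by auto
    then show "a dvd 1 \<or> b dvd 1" using ab f(1)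
      by (metis dvd_times_left_cancel_iff dvd_times_right_cancel_iff mult_cancel_left1 mult_1 mult_1_right mult_zero_left mult_zero_right)
  qed
  then show ?thesis using that f(2) dvd by blast
qed

text \<open>
A simple root \<open>x\<close> of \<open>p\<close> is also a simple root of the minimal polynomial \<open>f\<close> of \<open>x\<close>, since
\<open>p = f * g\<close> gives \<open>p' = f' * g\<close> at \<open>x\<close>; and an irreducible polynomial with one simple root has only
simple roots, because a common root with its derivative would make \<open>f\<close> divide \<open>f'\<close>.
\<close>

lemma separable_iff_simple_root:
  fixes x :: "'a::Fields.field alg_closure"
  shows "x \<in> separable_closure \<longleftrightarrow>
    (\<exists>p :: 'a poly. poly (lift_poly p) x = 0 \<and> poly (lift_poly (pderiv p)) x \<noteq> 0)"
proof
  assume "x \<in> separable_closure"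
  then obtain p :: "'a poly" where "poly (lift_poly p) x = 0" "rsquarefree (lift_poly p)"
    unfolding separable_closure_def by blast
  then show "\<exists>p :: 'a poly. poly (lift_poly p) x = 0 \<and> poly (lift_poly (pderiv p)) x \<noteq> 0"
    unfolding rsquarefree_iff_simple_roots lift_poly_pderiv by blast
next
  assume "\<exists>p :: 'a poly. poly (lift_poly p) x = 0 \<and> poly (lift_poly (pderiv p)) x \<noteq> 0"
  then obtain p :: "'a poly" where p: "poly (lift_poly p) x = 0" "poly (lift_poly (pderiv p)) x \<noteq> 0" by blast
  obtain f :: "'a poly" where f: "Factorial_Ring.irreducible f" "poly (lift_poly f) x = 0"
    and min: "\<forall>p. poly (lift_poly p) x = 0 \<longrightarrow> f dvd p"
    by (rule exists_minimal_polynomial[of x])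
  note min = min[rule_format]
  obtain g where g: "p = f * g" using min[OF p(1)] by (auto elim: dvdE)
  have f': "poly (lift_poly (pderiv f)) x \<noteq> 0"
    using p(2) f(2) unfolding g by (auto simp: pderiv_mult lift_poly_add lift_poly_mult)
  have "poly (pderiv (lift_poly f)) a \<noteq> 0" if a: "poly (lift_poly f) a = 0" for a
  proof
    assume a': "poly (pderiv (lift_poly f)) a = 0"
    obtain h :: "'a poly" where h: "Factorial_Ring.irreducible h"
      "\<forall>p. poly (lift_poly p) a = 0 \<longrightarrow> h dvd p" and "poly (lift_poly h) a = 0"
      by (rule exists_minimal_polynomial[of a])
    have "h dvd f" "h dvd pderiv f" using h(2) a a' by (simp_all add: lift_poly_pderiv)
    moreover have "f dvd h"
    proof -
      obtain k where k: "f = h * k" using \<open>h dvd f\<close> by (rule dvdE)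
      have "\<not> h dvd 1" using h(1) by (rule comm_semiring_1_class.irreducible_not_unit)
      then have "k dvd 1" using comm_semiring_1_class.irreducibleD[OF f(1) k] by blast
      then obtain l where "1 = k * l" by (rule dvdE)
      then have "h = f * l" unfolding k mult.assoc by simp
      then show ?thesis by (rule dvdI)
    qed
    ultimately have "f dvd pderiv f" by (metis dvd_trans)
    then obtain k where "pderiv f = f * k" by (auto elim: dvdE)
    then show False using f' f(2) by (simp add: lift_poly_mult)
  qed
  then have "rsquarefree (lift_poly f)"
    using f(1) unfolding rsquarefree_iff_simple_roots by auto
  then show "x \<in> separable_closure" using f unfolding separable_closure_def by blast
qed

text \<open>
By the chain rule \<open>b\<close> is a simple root of \<open>p \<circ> g\<close> when \<open>g(b)\<close> is a simple root of \<open>p\<close> and \<open>g'(b) \<noteq> 0\<close>.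
Kummer and Artin--Schreier equations are instances.
\<close>

lemma separable_of_composition:
  fixes b :: "'a::Fields.field alg_closure"
  assumes "poly (lift_poly g) b \<in> separable_closure" "poly (lift_poly (pderiv g)) b \<noteq> 0"
  shows "b \<in> separable_closure"
proof -
  obtain p :: "'a poly" where p: "poly (lift_poly p) (poly (lift_poly g) b) = 0"
    "poly (lift_poly (pderiv p)) (poly (lift_poly g) b) \<noteq> 0"
    using assms(1) unfolding separable_iff_simple_root by blast
  have "poly (lift_poly (p \<circ>\<^sub>p g)) b = 0" "poly (lift_poly (pderiv (p \<circ>\<^sub>p g))) b \<noteq> 0"
    using p assms(2) by (simp_all add: lift_poly_pcompose poly_pcompose pderiv_pcompose lift_poly_mult)
  then show ?thesis unfolding separable_iff_simple_root by blast
qed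

lemma to_ac_separable: "to_ac a \<in> separable_closure"
  unfolding separable_iff_simple_root
  by (rule exI[of _ "[:-a, 1:]"]) (simp add: pderiv_pCons)

lemma separable_prime_root:
  fixes b :: "'a::Fields.field alg_closure"
  assumes "q > 0" "of_nat q \<noteq> (0 :: 'a alg_closure)" "b ^ q \<in> separable_closure"
  shows "b \<in> separable_closure"
proof (cases "b = 0")
  case True
  then show ?thesis using to_ac_separable[of 0] by simp
next
  case False
  have "(of_nat q :: 'a) \<noteq> 0" using assms(2) by (metis to_ac_0 to_ac_of_nat)
  show ?thesis
    by (rule separable_of_composition[of "Polynomial.monom 1 q"])
      (use assms False in \<open>simp_all add: lift_poly_monom poly_monom pderiv_monom\<close>)
qed

lemma separable_artin_schreier_root:
  fixes b :: "'a::Fields.field alg_closure"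
  assumes p: "Factorial_Ring.prime CHAR('a)" and "b ^ CHAR('a) - b \<in> separable_closure"
  shows "b \<in> separable_closure"
proof (rule separable_of_composition[of "Polynomial.monom 1 CHAR('a) - [:0, 1:]"])
  show "poly (lift_poly (Polynomial.monom 1 CHAR('a) - [:0, 1:])) b \<in> separable_closure"
    using assms by (simp add: lift_poly_diff lift_poly_monom poly_monom)
  have "pderiv (Polynomial.monom 1 CHAR('a) - [:0, 1:] :: 'a poly) = - 1"
    by (simp add: pderiv_diff pderiv_monom pderiv_pCons one_pCons)
  then show "poly (lift_poly (pderiv (Polynomial.monom 1 CHAR('a) - [:0, 1:]))) b \<noteq> 0"
    using lift_poly_diff[of 0 "1 :: 'a poly"] by simp
qed

lemma degree_pos_of_root:
  fixes f :: "'a::Fields.field poly"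
  assumes "f \<noteq> 0" "poly (lift_poly f) x = 0"
  shows "Polynomial.degree f > 0"
proof (rule ccontr)
  assume "\<not> Polynomial.degree f > 0"
  then obtain c where "f = [:c:]" by (auto elim: degree_eq_zeroE)
  then show False using assms by simp
qed

text \<open>
The derivative of the minimal polynomial has smaller degree, so it vanishes at \<open>z\<close> only if it is zero,
which is impossible in characteristic 0.
\<close>

lemma inseparable_minimal_polynomial:
  fixes z :: "'a::Fields.field alg_closure"
  assumes z: "z \<notin> separable_closure"
    and f: "Factorial_Ring.irreducible f" "poly (lift_poly f) z = 0"
      "\<And>p. poly (lift_poly p) z = 0 \<Longrightarrow> f dvd p"
  shows "Factorial_Ring.prime CHAR('a)" "pderiv f = 0"
proof -
  have f0: "f \<noteq> 0" using f(1) by auto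
  have "poly (lift_poly (pderiv f)) z = 0"
    using z f(2) unfolding separable_iff_simple_root by blast
  then have dvd: "f dvd pderiv f" by (rule f(3))
  show f': "pderiv f = 0"
  proof (rule ccontr)
    assume nz: "pderiv f \<noteq> 0"
    let ?d = "Polynomial.degree (pderiv f)"
    have "Polynomial.coeff (pderiv f) ?d \<noteq> 0" using nz by simp
    then have "Polynomial.coeff f (Suc ?d) \<noteq> 0" by (auto simp: coeff_pderiv)
    then have "Suc ?d \<le> Polynomial.degree f" by (rule le_degree)
    then show False using dvd_imp_degree_le[OF dvd nz] by simp
  qed
  have "Polynomial.degree f > 0" by (rule degree_pos_of_root[OF f0 f(2)])
  then have "Polynomial.coeff (pderiv f) (Polynomial.degree f - 1)
      = of_nat (Polynomial.degree f) * Polynomial.coeff f (Polynomial.degree f)"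
    by (simp add: coeff_pderiv)
  then have "(of_nat (Polynomial.degree f) :: 'a) = 0" using f' f0 by simp
  then have "CHAR('a) dvd Polynomial.degree f" by (simp only: of_nat_eq_0_iff_char_dvd)
  then have "CHAR('a) > 0" using \<open>Polynomial.degree f > 0\<close> by (cases "CHAR('a) = 0") auto
  then show "Factorial_Ring.prime CHAR('a)" by (rule prime_CHAR_semidom)
qed

text \<open>
The scalars are the elements of the base field, embedded by \<open>to_ac\<close>.
\<close>

interpretation ac: vector_space "\<lambda>(c :: 'a::Fields.field) x. to_ac c * x"
  by unfold_locales (simp_all add: algebra_simps)

lemma (in vector_space) spans_if_card_ge:
  assumes "finite T" "independent S" "S \<subseteq> span T" "card T \<le> card S"
  shows "T \<subseteq> span S"
proof
  fix v assume v: "v \<in> T"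
  show "v \<in> span S"
  proof (rule ccontr)
    assume nv: "v \<notin> span S"
    then have "independent (insert v S)" using assms(2) by (simp add: independent_insert)
    moreover have "insert v S \<subseteq> span T" using assms(3) v span_base by auto
    ultimately have "finite (insert v S) \<and> card (insert v S) \<le> card T"
      by (rule independent_span_bound[OF assms(1)])
    moreover have "v \<notin> S" using nv span_base by blast
    ultimately show False using assms(4) card_insert_disjoint[of S v] by auto
  qed
qed

lemma (in vector_space) independent_if_card_le:
  assumes "finite T" "independent S" "S \<subseteq> span T" "card T \<le> card S"
  shows "independent T"
proof -
  obtain B where B: "B \<subseteq> T" "independent B" "T \<subseteq> span B" by (rule maximal_independent_subset)
  have "S \<subseteq> span B" using assms(3) B(3) span_mono span_span by (metis subset_trans)
  moreover have fB: "finite B" using B(1) assms(1) by (rule finite_subset)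
  ultimately have "card S \<le> card B" using independent_span_bound[OF _ assms(2)] by blast
  then have "card T \<le> card B" using assms(4) by simp
  then have "B = T" using card_seteq[OF assms(1) B(1)] by simp
  then show ?thesis using B(2) by simp
qed

lemma ac_span_mult:
  assumes u: "u \<in> ac.span A" and v: "v \<in> ac.span B"
  shows "u * v \<in> ac.span {a * b |a b. a \<in> A \<and> b \<in> B}"
proof -
  let ?S = "ac.span {a * b |a b. a \<in> A \<and> b \<in> B}"
  have *: "a * v \<in> ?S" if a: "a \<in> A" for a
    using v
  proof (induction rule: ac.span_induct_alt)
    case (step c x y)
    have "a * x \<in> ?S" using a step by (intro ac.span_base) auto
    then have "to_ac c * (a * x) + a * y \<in> ?S" using step by (intro ac.span_add ac.span_scale)
    then show ?case by (simp add: algebra_simps)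
  qed (simp add: ac.span_zero)
  show ?thesis using u
  proof (induction rule: ac.span_induct_alt)
    case (step c x y)
    then have "to_ac c * (x * v) + y * v \<in> ?S" using * by (intro ac.span_add ac.span_scale)
    then show ?case by (simp add: algebra_simps)
  qed (simp add: ac.span_zero)
qed

lemma poly_lift_poly_conv_sum:
  assumes "Polynomial.degree h < n"
  shows "poly (lift_poly h) w = (\<Sum>i<n. to_ac (Polynomial.coeff h i) * w ^ i)"
proof -
  have "poly (lift_poly h) w = (\<Sum>i\<le>Polynomial.degree h. to_ac (Polynomial.coeff h i) * w ^ i)"
    by (simp add: poly_altdef coeff_map_poly)
  also have "\<dots> = (\<Sum>i<n. to_ac (Polynomial.coeff h i) * w ^ i)"
    using assms by (intro sum.mono_neutral_left) (auto simp: coeff_eq_0)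
  finally show ?thesis .
qed

text \<open>
Independence of the family \<open>w ^ i\<close> for \<open>i < n\<close>.  Independence of the set of these powers is weaker, as
powers may coincide.
\<close>

definition powers_independent :: "'a::Fields.field alg_closure \<Rightarrow> nat \<Rightarrow> bool" where
  "powers_independent w n \<longleftrightarrow>
     (\<forall>h :: 'a poly. Polynomial.degree h < n \<longrightarrow> poly (lift_poly h) w = 0 \<longrightarrow> h = 0)"

lemma powers_independent_inj:
  fixes w :: "'a::Fields.field alg_closure"
  assumes "powers_independent w n"
  shows "inj_on (\<lambda>i. w ^ i) {..<n}"
proof (rule inj_onI, rule ccontr)
  fix i j assume ij: "i \<in> {..<n}" "j \<in> {..<n}" "w ^ i = w ^ j" "i \<noteq> j"
  let ?h = "Polynomial.monom 1 i - Polynomial.monom 1 j :: 'a poly"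
  have "Polynomial.degree ?h < n"
    using ij by (intro degree_diff_less) (simp_all add: degree_monom_eq)
  moreover have "poly (lift_poly ?h) w = 0"
    using ij by (simp add: lift_poly_diff lift_poly_monom poly_monom)
  ultimately have "?h = 0" using assms unfolding powers_independent_def by blast
  then have "Polynomial.coeff ?h i = 0" by simp
  then show False using ij(4) by simp
qed

lemma powers_independent_iff:
  fixes w :: "'a::Fields.field alg_closure"
  shows "powers_independent w n \<longleftrightarrow>
    inj_on (\<lambda>i. w ^ i) {..<n} \<and> ac.independent ((\<lambda>i. w ^ i) ` {..<n})"
proof
  assume L: "powers_independent w n"
  have inj: "inj_on (\<lambda>i. w ^ i) {..<n}" using L by (rule powers_independent_inj)
  have "u v = 0" if sum: "(\<Sum>v\<in>(\<lambda>i. w ^ i) ` {..<n}. to_ac (u v) * v) = 0"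
    and v: "v \<in> (\<lambda>i. w ^ i) ` {..<n}" for u :: "'a alg_closure \<Rightarrow> 'a" and v
  proof -
    obtain i where i: "i < n" "v = w ^ i" using v by auto
    define h where "h = (\<Sum>i<n. Polynomial.monom (u (w ^ i)) i)"
    have coeff: "Polynomial.coeff h j = (if j < n then u (w ^ j) else 0)" for j
      unfolding h_def by (simp add: coeff_sum sum.delta')
    have deg: "Polynomial.degree h < n"
      using i(1) by (intro degree_lessI) (auto simp: coeff)
    have "poly (lift_poly h) w = (\<Sum>i<n. to_ac (u (w ^ i)) * w ^ i)"
      unfolding poly_lift_poly_conv_sum[OF deg] by (intro sum.cong) (auto simp: coeff)
    also have "\<dots> = 0" using sum by (simp add: sum.reindex[OF inj])
    finally have "h = 0" using L deg unfolding powers_independent_def by blast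
    then show "u v = 0" using coeff[of i] i by simp
  qed
  then have "ac.independent ((\<lambda>i. w ^ i) ` {..<n})"
    by (intro ac.independent_if_scalars_zero) auto
  then show "inj_on (\<lambda>i. w ^ i) {..<n} \<and> ac.independent ((\<lambda>i. w ^ i) ` {..<n})" using inj by blast
next
  assume R: "inj_on (\<lambda>i. w ^ i) {..<n} \<and> ac.independent ((\<lambda>i. w ^ i) ` {..<n})"
  show "powers_independent w n"
    unfolding powers_independent_def
  proof (intro allI impI)
    fix h :: "'a poly" assume h: "Polynomial.degree h < n" "poly (lift_poly h) w = 0"
    define u where "u v = Polynomial.coeff h (inv_into {..<n} (\<lambda>i. w ^ i) v)" for v
    have u: "u (w ^ i) = Polynomial.coeff h i" if "i < n" for i
      unfolding u_def using R that by (simp add: inv_into_f_f)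
    have "(\<Sum>v\<in>(\<lambda>i. w ^ i) ` {..<n}. to_ac (u v) * v) = (\<Sum>i<n. to_ac (u (w ^ i)) * w ^ i)"
      using R by (simp add: sum.reindex)
    also have "\<dots> = poly (lift_poly h) w"
      unfolding poly_lift_poly_conv_sum[OF h(1)] by (intro sum.cong) (auto simp: u)
    finally have "(\<Sum>v\<in>(\<lambda>i. w ^ i) ` {..<n}. to_ac (u v) * v) = 0" using h(2) by simp
    then have "\<forall>v\<in>(\<lambda>i. w ^ i) ` {..<n}. u v = 0"
      using R ac.independentD[of "(\<lambda>i. w ^ i) ` {..<n}" "(\<lambda>i. w ^ i) ` {..<n}" u] by auto
    then have "Polynomial.coeff h i = 0" if "i < n" for i using u[OF that] that by force
    then have "Polynomial.coeff h (Polynomial.degree h) = 0" using h(1) by blast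
    then show "h = 0" by simp
  qed
qed

lemma powers_independent_minimal:
  fixes w :: "'a::Fields.field alg_closure"
  assumes "\<And>p. poly (lift_poly p) w = 0 \<Longrightarrow> f dvd p"
  shows "powers_independent w (Polynomial.degree f)"
  unfolding powers_independent_def using assms dvd_imp_degree_le by (metis leD)

definition adjoin :: "'a::Fields.field alg_closure \<Rightarrow> 'a alg_closure set" where
  "adjoin x = range (\<lambda>p. poly (lift_poly p) x)"

lemma power_in_adjoin: "x ^ n \<in> adjoin x"
  unfolding adjoin_def by (rule range_eqI[of _ _ "Polynomial.monom 1 n"]) (simp add: lift_poly_monom poly_monom)

lemma to_ac_in_adjoin: "to_ac c \<in> adjoin x"
  unfolding adjoin_def by (rule range_eqI[of _ _ "[:c:]"]) simp

lemma adjoin_closed: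
  assumes "u \<in> adjoin x" "v \<in> adjoin x"
  shows "u + v \<in> adjoin x" "u * v \<in> adjoin x"
proof -
  obtain p q where "u = poly (lift_poly p) x" "v = poly (lift_poly q) x"
    using assms unfolding adjoin_def by auto
  then have "u + v = poly (lift_poly (p + q)) x" "u * v = poly (lift_poly (p * q)) x"
    by (simp_all add: lift_poly_add lift_poly_mult)
  then show "u + v \<in> adjoin x" "u * v \<in> adjoin x" unfolding adjoin_def by auto
qed

lemma adjoin_subset_span:
  assumes f: "f \<noteq> 0" "poly (lift_poly f) x = 0"
  shows "adjoin x \<subseteq> ac.span ((\<lambda>i. x ^ i) ` {..<Polynomial.degree f})"
proof
  fix u assume "u \<in> adjoin x"
  then obtain p where p: "u = poly (lift_poly p) x" unfolding adjoin_def by auto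
  have deg: "Polynomial.degree f > 0" by (rule degree_pos_of_root[OF f])
  have r: "Polynomial.degree (p mod f) < Polynomial.degree f"
    using degree_mod_less[OF f(1), of p] deg by auto
  have "lift_poly p = lift_poly (p div f) * lift_poly f + lift_poly (p mod f)"
    by (simp add: lift_poly_mult[symmetric] lift_poly_add[symmetric])
  then have "u = poly (lift_poly (p mod f)) x" using p f(2) by simp
  also have "\<dots> \<in> ac.span ((\<lambda>i. x ^ i) ` {..<Polynomial.degree f})"
    unfolding poly_lift_poly_conv_sum[OF r]
    by (intro ac.span_sum ac.span_scale ac.span_base) auto
  finally show "u \<in> ac.span ((\<lambda>i. x ^ i) ` {..<Polynomial.degree f})" .
qed

text \<open>
For \<open>x \<noteq> 0\<close> the constant term \<open>c\<close> of the minimal polynomial \<open>c + t * g(t)\<close> is not zero, and \<open>- g(x) / c\<close> is the inverse.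
\<close>

lemma inverse_in_adjoin: "inverse x \<in> adjoin x"
proof (cases "x = 0")
  case True
  then show ?thesis using to_ac_in_adjoin[of 0] by simp
next
  case False
  obtain f :: "'a poly" where f: "Factorial_Ring.irreducible f" "poly (lift_poly f) x = 0"
    and min: "\<forall>p. poly (lift_poly p) x = 0 \<longrightarrow> f dvd p"
    by (rule exists_minimal_polynomial[of x])
  note min = min[rule_format]
  obtain c g where fg: "f = pCons c g" by (cases f)
  have c: "c \<noteq> 0"
  proof
    assume "c = 0"
    then have "poly (lift_poly g) x = 0" using f(2) False unfolding fg by simp
    then have "f dvd g" by (rule min)
    moreover have "g \<noteq> 0" using f(1) \<open>c = 0\<close> unfolding fg by auto
    ultimately show False using dvd_imp_degree_le[of f g] unfolding fg by simp
  qed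
  have "to_ac c + x * poly (lift_poly g) x = 0" using f(2) unfolding fg by simp
  then have "x * poly (lift_poly g) x = - to_ac c" by (simp add: eq_neg_iff_add_eq_0 add.commute)
  moreover have "x * (to_ac (- inverse c) * poly (lift_poly g) x) = to_ac (- inverse c) * (x * poly (lift_poly g) x)"
    by (rule mult.left_commute)
  ultimately have "x * (to_ac (- inverse c) * poly (lift_poly g) x) = 1" using c by simp
  then have "inverse x = to_ac (- inverse c) * poly (lift_poly g) x" by (metis inverse_unique)
  moreover have "\<dots> \<in> adjoin x"
    by (intro adjoin_closed to_ac_in_adjoin) (auto simp: adjoin_def)
  ultimately show ?thesis by simp
qed

lemma card_roots_rsquarefree:
  fixes P :: "'f::alg_closed_field poly"
  assumes "rsquarefree P"
  shows "card {a. poly P a = 0} = Polynomial.degree P"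
proof -
  have P0: "P \<noteq> 0" using assms unfolding rsquarefree_def by simp
  obtain A where A: "size A = Polynomial.degree P" "P = Polynomial.smult (Polynomial.lead_coeff P) (\<Prod>x\<in>#A. [:-x, 1:])"
    using alg_closed_imp_factorization[OF P0] by blast
  have roots: "{a. poly P a = 0} = set_mset A"
  proof (intro Set.set_eqI)
    fix a
    have "poly P a = Polynomial.lead_coeff P * (\<Prod>x\<in>#A. a - x)"
      by (subst A(2)) (simp add: poly_prod_mset image_mset.compositionality o_def)
    then show "a \<in> {a. poly P a = 0} \<longleftrightarrow> a \<in> set_mset A"
      using P0 by (auto simp: prod_mset_zero_iff)
  qed
  have "count A a \<le> 1" for a
  proof (rule ccontr)
    assume "\<not> count A a \<le> 1"
    then have "2 \<le> count A a" by simp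
    then have "{#a, a#} \<subseteq># A" by (auto simp: subseteq_mset_def)
    then obtain B where B: "A = {#a, a#} + B" by (metis subset_mset.le_iff_add)
    define Q where "Q = Polynomial.smult (Polynomial.lead_coeff P) (\<Prod>x\<in>#B. [:-x, 1:])"
    have Q: "P = [:-a, 1:] * ([:-a, 1:] * Q)"
      by (subst A(2)) (simp add: B Q_def mult.assoc)
    have "poly P a = 0" "poly (pderiv P) a = 0"
      unfolding Q pderiv_mult by (simp_all del: mult_pCons_left)
    then show False using assms unfolding rsquarefree_iff_simple_roots by blast
  qed
  then have "A = mset_set (set_mset A)"
    by (intro multiset_eqI) (metis One_nat_def count_eq_zero_iff count_mset_set(1) count_mset_set(3) finite_set_mset le_Suc_eq le_zero_eq)
  then have "size A = card (set_mset A)" by (metis size_mset_set)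
  then show ?thesis using A(1) roots by simp
qed

lemma inj_Frobenius:
  assumes "Factorial_Ring.prime CHAR('f::Fields.field)"
  shows "inj (\<lambda>a :: 'f. a ^ CHAR('f))"
proof (rule injI)
  fix a b :: 'f assume "a ^ CHAR('f) = b ^ CHAR('f)"
  moreover have "(a - b + b) ^ CHAR('f) = (a - b) ^ CHAR('f) + b ^ CHAR('f)"
    by (rule freshmans_dream[OF assms refl])
  ultimately have "(a - b) ^ CHAR('f) = 0" by simp
  then show "a = b" by simp
qed

text \<open>
A relation \<open>h\<close> among the powers of \<open>x ^ p\<close> gives a polynomial \<open>h(t ^ p)\<close> divisible by the minimal
polynomial \<open>f\<close>.  Thus the \<open>p\<close>-th powers of the roots of \<open>f\<close>, which are as many as the degree of \<open>f\<close>,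
are roots of \<open>h\<close>, too many for its degree.
\<close>

lemma separable_powers_independent:
  fixes x :: "'a::Fields.field alg_closure"
  assumes p: "Factorial_Ring.prime CHAR('a)" and f: "poly (lift_poly f) x = 0" "rsquarefree (lift_poly f)"
    and min: "\<And>p. poly (lift_poly p) x = 0 \<Longrightarrow> f dvd p"
  shows "powers_independent (x ^ CHAR('a)) (Polynomial.degree f)"
  unfolding powers_independent_def
proof (intro allI impI, rule ccontr)
  fix h :: "'a poly" assume h: "Polynomial.degree h < Polynomial.degree f" "poly (lift_poly h) (x ^ CHAR('a)) = 0" "h \<noteq> 0"
  let ?p = "CHAR('a)"
  have p': "Factorial_Ring.prime CHAR('a alg_closure)" "?p = CHAR('a alg_closure)" using p by simp_all
  have comp: "poly (lift_poly (h \<circ>\<^sub>p Polynomial.monom 1 ?p)) a = poly (lift_poly h) (a ^ ?p)" for a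
    by (simp add: lift_poly_pcompose lift_poly_monom poly_pcompose poly_monom)
  have "f dvd h \<circ>\<^sub>p Polynomial.monom 1 ?p" using h(2) comp by (intro min) simp
  then obtain g where g: "h \<circ>\<^sub>p Polynomial.monom 1 ?p = f * g" by (auto elim: dvdE)
  have sub: "(\<lambda>a. a ^ ?p) ` {a. poly (lift_poly f) a = 0} \<subseteq> {a. poly (lift_poly h) a = 0}"
  proof clarify
    fix a assume "poly (lift_poly f) a = 0"
    then show "poly (lift_poly h) (a ^ ?p) = 0" using comp[of a] unfolding g lift_poly_mult by simp
  qed
  have inj: "inj (\<lambda>a :: 'a alg_closure. a ^ ?p)"
    using inj_Frobenius[OF p'(1)] unfolding p'(2)[symmetric] .
  have "Polynomial.degree f = card {a. poly (lift_poly f) a = 0}"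
    using card_roots_rsquarefree[OF f(2)] by simp
  also have "\<dots> = card ((\<lambda>a. a ^ ?p) ` {a. poly (lift_poly f) a = 0})"
    by (rule card_image[symmetric]) (rule inj_on_subset[OF inj subset_UNIV])
  also have "\<dots> \<le> card {a. poly (lift_poly h) a = 0}"
    using sub h(3) by (intro card_mono poly_roots_finite) simp_all
  also have "\<dots> \<le> Polynomial.degree h" using card_poly_roots_bound[of "lift_poly h"] h(3) by simp
  finally show False using h(1) by simp
qed

text \<open>
The powers of \<open>x ^ p\<close> are as many independent elements as the dimension of \<open>adjoin x\<close>, so they span it.
\<close>

lemma separable_adjoin_Frobenius:
  fixes x :: "'a::Fields.field alg_closure"
  assumes p: "Factorial_Ring.prime CHAR('a)" and x: "x \<in> separable_closure"
  obtains n where "adjoin x \<subseteq> ac.span ((\<lambda>i. x ^ i) ` {..<n})"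
    "adjoin x \<subseteq> ac.span ((\<lambda>i. (x ^ i) ^ CHAR('a)) ` {..<n})"
proof -
  let ?p = "CHAR('a)"
  obtain f0 :: "'a poly" where f0: "poly (lift_poly f0) x = 0" "rsquarefree (lift_poly f0)"
    using x unfolding separable_closure_def by blast
  obtain f :: "'a poly" where f: "Factorial_Ring.irreducible f" "poly (lift_poly f) x = 0"
    and min: "\<forall>p. poly (lift_poly p) x = 0 \<longrightarrow> f dvd p"
    by (rule exists_minimal_polynomial[of x])
  note min = min[rule_format]
  obtain g where g: "f0 = f * g" using min[OF f0(1)] by (auto elim: dvdE)
  have f_nz: "f \<noteq> 0" using f(1) by auto
  have sf: "rsquarefree (lift_poly f)"
    using f0(2) f_nz unfolding rsquarefree_iff_simple_roots g
    by (auto simp: lift_poly_mult pderiv_mult)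
  let ?n = "Polynomial.degree f"
  let ?B = "(\<lambda>i. x ^ i) ` {..<?n}" and ?C = "(\<lambda>i. (x ^ ?p) ^ i) ` {..<?n}"
  have B: "adjoin x \<subseteq> ac.span ?B" by (rule adjoin_subset_span[OF f_nz f(2)])
  have L: "powers_independent (x ^ ?p) ?n" by (rule separable_powers_independent[OF p f(2) sf min])
  have "?B \<subseteq> ac.span ?C"
  proof (rule ac.spans_if_card_ge)
    show "finite ?B" by simp
    show "ac.independent ?C" using L unfolding powers_independent_iff by blast
    show "?C \<subseteq> ac.span ?B"
      using B power_in_adjoin[of x] by (auto simp: power_mult[symmetric])
    have "card ?C = ?n" using card_image[OF powers_independent_inj[OF L]] by simp
    then show "card ?B \<le> card ?C" using card_image_le[of "{..<?n}" "\<lambda>i. x ^ i"] by simp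
  qed
  then have "ac.span ?B \<subseteq> ac.span ?C" by (simp add: ac.span_minimal)
  moreover have "?C = (\<lambda>i. (x ^ i) ^ ?p) ` {..<?n}"
    by (simp add: power_mult[symmetric] mult.commute)
  ultimately show ?thesis using that[of ?n] B by auto
qed


text \<open>
MacLane's criterion.  Let a finite-dimensional space be spanned by the \<open>p\<close>-th powers of its elements.
Then the Frobenius map carries a basis to a basis, hence independent families to independent
families.  If the minimal polynomial of \<open>z\<close> were a polynomial \<open>g\<close> of degree \<open>m\<close> in \<open>t ^ p\<close>, then
\<open>1, z, ..., z ^ m\<close> would be independent but their \<open>p\<close>-th powers would not.
\<close>

lemma separable_of_Frobenius_span:
  fixes z :: "'a::Fields.field alg_closure"
  assumes fin: "finite B" and pow: "\<And>i. z ^ i \<in> ac.span B"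
    and frob: "B \<subseteq> ac.span ((\<lambda>b. b ^ CHAR('a)) ` B)"
  shows "z \<in> separable_closure"
proof (rule ccontr)
  assume nsep: "z \<notin> separable_closure"
  let ?p = "CHAR('a)"
  obtain f :: "'a poly" where f: "Factorial_Ring.irreducible f" "poly (lift_poly f) z = 0"
    and min: "\<forall>p. poly (lift_poly p) z = 0 \<longrightarrow> f dvd p"
    by (rule exists_minimal_polynomial[of z])
  note min = min[rule_format]
  have p: "Factorial_Ring.prime ?p" by (rule inseparable_minimal_polynomial(1)[OF nsep f min])
  have f': "pderiv f = 0" by (rule inseparable_minimal_polynomial(2)[OF nsep f min])
  have p': "Factorial_Ring.prime CHAR('a alg_closure)" "?p = CHAR('a alg_closure)" using p by simp_all
  have f0: "f \<noteq> 0" using f(1) by auto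
  let ?n = "Polynomial.degree f"
  define m where "m = ?n div ?p"
  have coeff0: "Polynomial.coeff f i = 0" if "\<not> ?p dvd i" for i
  proof (cases i)
    case 0
    then show ?thesis using that by simp
  next
    case (Suc j)
    have "of_nat (Suc j) * Polynomial.coeff f (Suc j) = 0"
      using f' by (metis coeff_0 coeff_pderiv)
    moreover have "(of_nat (Suc j) :: 'a) \<noteq> 0"
      using that Suc by (simp only: of_nat_eq_0_iff_char_dvd not_False_eq_True)
    ultimately show ?thesis using Suc by simp
  qed
  have dvd: "?p dvd ?n" using coeff0[of ?n] f0 by auto
  then have n: "?n = m * ?p" unfolding m_def by simp
  have "?n > 0" by (rule degree_pos_of_root[OF f0 f(2)])
  then have m: "m > 0" "Suc m \<le> ?n" using n prime_gt_1_nat[OF p] by (auto simp: Suc_le_eq)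
  \<comment> \<open>The minimal polynomial is \<open>g(t ^ p)\<close>.\<close>
  define g where "g = (\<Sum>i\<le>m. Polynomial.monom (Polynomial.coeff f (i * ?p)) i)"
  have g_coeff: "Polynomial.coeff g j = (if j \<le> m then Polynomial.coeff f (j * ?p) else 0)" for j
    unfolding g_def by (simp add: coeff_sum)
  have g_deg: "Polynomial.degree g < Suc m"
    by (intro degree_lessI) (auto simp: g_coeff)
  have "Polynomial.coeff g m \<noteq> 0" using g_coeff[of m] n f0 by (metis leading_coeff_0_iff order_refl)
  then have g0: "g \<noteq> 0" by auto
  have "poly (lift_poly g) (z ^ ?p) = (\<Sum>i<Suc m. to_ac (Polynomial.coeff f (i * ?p)) * z ^ (i * ?p))"
    unfolding poly_lift_poly_conv_sum[OF g_deg]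
    by (intro sum.cong) (auto simp: g_coeff power_mult[symmetric] mult.commute)
  also have "\<dots> = (\<Sum>j\<in>(\<lambda>i. i * ?p) ` {..<Suc m}. to_ac (Polynomial.coeff f j) * z ^ j)"
    using prime_gt_0_nat[OF p] by (subst sum.reindex) (auto simp: inj_on_def)
  also have "\<dots> = (\<Sum>j<Suc ?n. to_ac (Polynomial.coeff f j) * z ^ j)"
  proof (rule sum.mono_neutral_left)
    show "(\<lambda>i. i * ?p) ` {..<Suc m} \<subseteq> {..<Suc ?n}" using n by (auto simp: less_Suc_eq_le)
    show "\<forall>j\<in>{..<Suc ?n} - (\<lambda>i. i * ?p) ` {..<Suc m}. to_ac (Polynomial.coeff f j) * z ^ j = 0"
    proof
      fix j assume j: "j \<in> {..<Suc ?n} - (\<lambda>i. i * ?p) ` {..<Suc m}"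
      have "\<not> ?p dvd j"
      proof
        assume "?p dvd j"
        then obtain i where i: "j = i * ?p" by (metis dvdE mult.commute)
        then have "i \<le> m" using j n prime_gt_0_nat[OF p] by (auto simp: less_Suc_eq_le)
        then show False using j i by auto
      qed
      then show "to_ac (Polynomial.coeff f j) * z ^ j = 0" using coeff0 by simp
    qed
  qed simp
  also have "\<dots> = 0" using f(2) poly_lift_poly_conv_sum[of f "Suc ?n" z] by simp
  finally have gz: "poly (lift_poly g) (z ^ ?p) = 0" .
  have Lz: "powers_independent z (Suc m)"
    using powers_independent_minimal[OF min] m(2) unfolding powers_independent_def by (meson less_le_trans)
  let ?S = "(\<lambda>i. z ^ i) ` {..<Suc m}"
  let ?fr = "\<lambda>b :: 'a alg_closure. b ^ ?p"
  have "?S \<subseteq> ac.span B" using pow by auto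
  moreover have "ac.independent ?S" using Lz unfolding powers_independent_iff by blast
  ultimately obtain B' where B': "?S \<subseteq> B'" "B' \<subseteq> ac.span B" "ac.independent B'" "ac.span B \<subseteq> ac.span B'"
    by (rule ac.maximal_independent_subset_extend)
  have finB': "finite B'" using ac.independent_span_bound[OF fin B'(3,2)] by blast
  have fr_span: "?fr u \<in> ac.span (?fr ` A)" if "u \<in> ac.span A" for u A
    using that
  proof (induction rule: ac.span_induct_alt)
    case base
    then show ?case using prime_gt_0_nat[OF p] by (simp add: ac.span_zero zero_power)
  next
    case (step c a y)
    have "?fr (to_ac c * a + y) = to_ac (c ^ ?p) * ?fr a + ?fr y"
      by (simp add: freshmans_dream[OF p'] power_mult_distrib)
    moreover have "?fr a \<in> ac.span (?fr ` A)" using step by (intro ac.span_base imageI)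
    then have "to_ac (c ^ ?p) * ?fr a + ?fr y \<in> ac.span (?fr ` A)"
      using step by (intro ac.span_add ac.span_scale)
    ultimately show ?case by simp
  qed
  have "?fr ` B \<subseteq> ac.span (?fr ` B')" using fr_span B'(4) ac.span_base by blast
  then have "ac.span (?fr ` B) \<subseteq> ac.span (?fr ` B')" by (simp add: ac.span_minimal)
  then have "B \<subseteq> ac.span (?fr ` B')" using frob by blast
  then have "ac.span B \<subseteq> ac.span (?fr ` B')" by (simp add: ac.span_minimal)
  then have "B' \<subseteq> ac.span (?fr ` B')" using B'(2) by blast
  then have indep: "ac.independent (?fr ` B')"
    by (intro ac.independent_if_card_le[OF _ B'(3)]) (use finB' card_image_le in auto)
  have inj: "inj ?fr"
    using inj_Frobenius[OF p'(1)] unfolding p'(2)[symmetric] .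
  have eq: "(\<lambda>i. (z ^ ?p) ^ i) = (\<lambda>i. ?fr (z ^ i))"
    by (simp add: power_mult[symmetric] mult.commute)
  have "powers_independent (z ^ ?p) (Suc m)"
    unfolding powers_independent_iff
  proof
    show "inj_on (\<lambda>i. (z ^ ?p) ^ i) {..<Suc m}"
      unfolding eq using powers_independent_inj[OF Lz] inj by (auto simp: inj_on_def)
    have "(\<lambda>i. (z ^ ?p) ^ i) ` {..<Suc m} \<subseteq> ?fr ` B'" unfolding eq using B'(1) by auto
    then show "ac.independent ((\<lambda>i. (z ^ ?p) ^ i) ` {..<Suc m})"
      using indep ac.independent_mono by blast
  qed
  then have "g = 0" using g_deg gz unfolding powers_independent_def by blast
  with g0 show False by simp
qed

text \<open>
In characteristic \<open>p\<close> the span of the products of \<open>adjoin x\<close> and \<open>adjoin y\<close> is an algebra that meets MacLane's criterion,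
because both factors do.  Sums and products of separable elements lie in it.
\<close>

lemma separable_in_composite:
  fixes x y :: "'a::Fields.field alg_closure"
  assumes x: "x \<in> separable_closure" and y: "y \<in> separable_closure"
    and z: "z \<in> ac.span {u * v | u v. u \<in> adjoin x \<and> v \<in> adjoin y}"
  shows "z \<in> separable_closure"
proof (cases "Factorial_Ring.prime CHAR('a)")
  case False
  obtain f :: "'a poly" where f: "Factorial_Ring.irreducible f" "poly (lift_poly f) z = 0"
    and min: "\<forall>p. poly (lift_poly p) z = 0 \<longrightarrow> f dvd p"
    by (rule exists_minimal_polynomial[of z])
  note min = min[rule_format]
  show ?thesis
    using inseparable_minimal_polynomial(1)[OF _ f min] False by blast
next
  case True
  let ?p = "CHAR('a)"
  obtain n where n: "adjoin x \<subseteq> ac.span ((\<lambda>i. x ^ i) ` {..<n})"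
    "adjoin x \<subseteq> ac.span ((\<lambda>i. (x ^ i) ^ ?p) ` {..<n})"
    by (rule separable_adjoin_Frobenius[OF True x])
  obtain m where m: "adjoin y \<subseteq> ac.span ((\<lambda>i. y ^ i) ` {..<m})"
    "adjoin y \<subseteq> ac.span ((\<lambda>i. (y ^ i) ^ ?p) ` {..<m})"
    by (rule separable_adjoin_Frobenius[OF True y])
  define B where "B = (\<lambda>(i, j). x ^ i * y ^ j) ` ({..<n} \<times> {..<m})"
  let ?M = "{u * v | u v. u \<in> adjoin x \<and> v \<in> adjoin y}"
  have M_B: "?M \<subseteq> ac.span B"
  proof
    fix w assume "w \<in> ?M"
    then obtain u v where w: "w = u * v" "u \<in> adjoin x" "v \<in> adjoin y" by blast
    have "{a * b |a b. a \<in> (\<lambda>i. x ^ i) ` {..<n} \<and> b \<in> (\<lambda>i. y ^ i) ` {..<m}} = B"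
      unfolding B_def by auto
    moreover have "u * v \<in> ac.span {a * b |a b. a \<in> (\<lambda>i. x ^ i) ` {..<n} \<and> b \<in> (\<lambda>i. y ^ i) ` {..<m}}"
      by (rule ac_span_mult[OF subsetD[OF n(1) w(2)] subsetD[OF m(1) w(3)]])
    ultimately show "w \<in> ac.span B" unfolding w(1) by simp
  qed
  have M_FB: "?M \<subseteq> ac.span ((\<lambda>b. b ^ ?p) ` B)"
  proof
    fix w assume "w \<in> ?M"
    then obtain u v where w: "w = u * v" "u \<in> adjoin x" "v \<in> adjoin y" by blast
    have sub: "{a * b |a b. a \<in> (\<lambda>i. (x ^ i) ^ ?p) ` {..<n} \<and> b \<in> (\<lambda>i. (y ^ i) ^ ?p) ` {..<m}} \<subseteq> (\<lambda>b. b ^ ?p) ` B"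
    proof clarify
      fix i j assume "i < n" "j < m"
      then have "x ^ i * y ^ j \<in> B" unfolding B_def by force
      then have "(x ^ i * y ^ j) ^ ?p \<in> (\<lambda>b. b ^ ?p) ` B" by (rule imageI)
      then show "(x ^ i) ^ ?p * (y ^ j) ^ ?p \<in> (\<lambda>b. b ^ ?p) ` B" by (simp only: power_mult_distrib)
    qed
    have "u * v \<in> ac.span {a * b |a b. a \<in> (\<lambda>i. (x ^ i) ^ ?p) ` {..<n} \<and> b \<in> (\<lambda>i. (y ^ i) ^ ?p) ` {..<m}}"
      by (rule ac_span_mult[OF subsetD[OF n(2) w(2)] subsetD[OF m(2) w(3)]])
    then show "w \<in> ac.span ((\<lambda>b. b ^ ?p) ` B)" unfolding w(1) by (rule subsetD[OF ac.span_mono[OF sub]])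
  qed
  have M_mult: "a * b \<in> ac.span ?M" if "a \<in> ac.span ?M" "b \<in> ac.span ?M" for a b
  proof -
    have "{a * b |a b. a \<in> ?M \<and> b \<in> ?M} \<subseteq> ?M"
    proof clarify
      fix u v u' v' assume "u \<in> adjoin x" "v \<in> adjoin y" "u' \<in> adjoin x" "v' \<in> adjoin y"
      then show "\<exists>s t. (u * v) * (u' * v') = s * t \<and> s \<in> adjoin x \<and> t \<in> adjoin y"
        by (intro exI[of _ "u * u'"] exI[of _ "v * v'"]) (simp add: adjoin_closed mult_ac)
    qed
    then show ?thesis using ac_span_mult[OF that] ac.span_mono by blast
  qed
  have one: "1 \<in> ac.span ?M"
    by (rule ac.span_base) (use power_in_adjoin[of x 0] power_in_adjoin[of y 0] in force)
  have pow: "z ^ i \<in> ac.span ?M" for i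
    by (induction i) (use one M_mult z in auto)
  show ?thesis
  proof (rule separable_of_Frobenius_span)
    show "finite B" unfolding B_def by simp
    show "z ^ i \<in> ac.span B" for i
      using pow[of i] ac.span_minimal[OF M_B ac.subspace_span] by blast
    have "B \<subseteq> ?M" unfolding B_def using power_in_adjoin by auto
    then show "B \<subseteq> ac.span ((\<lambda>b. b ^ ?p) ` B)" using M_FB by blast
  qed
qed

lemma adjoin_subset_separable:
  assumes "x \<in> separable_closure"
  shows "adjoin x \<subseteq> separable_closure"
proof
  fix u assume "u \<in> adjoin x"
  moreover have "1 \<in> adjoin x" using to_ac_in_adjoin[of 1 x] by simp
  ultimately have "u * 1 \<in> {u * v | u v. u \<in> adjoin x \<and> v \<in> adjoin x}" by blast
  then have "u * 1 \<in> separable_closure" by (intro separable_in_composite[OF assms assms] ac.span_base)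
  then show "u \<in> separable_closure" by simp
qed

lemma separable_add:
  assumes "x \<in> separable_closure" "y \<in> separable_closure"
  shows "x + y \<in> separable_closure"
proof -
  have "x \<in> adjoin x" "1 \<in> adjoin x" "y \<in> adjoin y" "1 \<in> adjoin y"
    using power_in_adjoin[of x 1] power_in_adjoin[of y 1] to_ac_in_adjoin[of 1] by simp_all
  then have "x * 1 \<in> {u * v | u v. u \<in> adjoin x \<and> v \<in> adjoin y}"
    "1 * y \<in> {u * v | u v. u \<in> adjoin x \<and> v \<in> adjoin y}" by blast+
  then have "x * 1 + 1 * y \<in> ac.span {u * v | u v. u \<in> adjoin x \<and> v \<in> adjoin y}"
    by (intro ac.span_add ac.span_base)
  then show ?thesis using separable_in_composite[OF assms, of "x + y"] by simp
qed

lemma separable_mult: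
  assumes "x \<in> separable_closure" "y \<in> separable_closure"
  shows "x * y \<in> separable_closure"
proof (rule separable_in_composite[OF assms], rule ac.span_base)
  show "x * y \<in> {u * v | u v. u \<in> adjoin x \<and> v \<in> adjoin y}"
    using power_in_adjoin[of x 1] power_in_adjoin[of y 1] unfolding power_one_right by blast
qed

lemma separable_uminus: "x \<in> separable_closure \<Longrightarrow> - x \<in> separable_closure"
  using separable_mult[OF to_ac_separable[of "- 1"], of x] by simp

lemma separable_inverse: "x \<in> separable_closure \<Longrightarrow> inverse x \<in> separable_closure"
  using adjoin_subset_separable inverse_in_adjoin by blast

section \<open>The absolute Galois group\<close>

abbreviation "ksep \<equiv> separable_closure"
abbreviation "galois_group \<equiv> galois_fixing (range to_ac)"

lemma base_field_separable: "range to_ac \<subseteq> separable_closure"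
  using to_ac_separable by auto

lemma galois_fixing_subgroup:
  assumes "E \<subseteq> separable_closure"
  shows "subgroup (galois_fixing E) (BijGroup separable_closure)"
proof -
  let ?S = "separable_closure :: 'a alg_closure set"
  interpret B: group "BijGroup ?S" by (rule group_BijGroup)
  show ?thesis
  proof (rule B.subgroupI)
    show "galois_fixing E \<subseteq> carrier (BijGroup ?S)"
      unfolding galois_fixing_def BijGroup_def by auto
    have "(\<lambda>x\<in>?S. x) \<in> galois_fixing E"
      unfolding galois_fixing_def using assms id_Bij[of ?S] by (auto simp: separable_add separable_mult)
    then show "galois_fixing E \<noteq> {}" by auto
  next
    fix \<sigma> assume \<sigma>: "\<sigma> \<in> galois_fixing E"
    then have bij: "\<sigma> \<in> Bij ?S" unfolding galois_fixing_def by blast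
    let ?i = "\<lambda>x\<in>?S. inv_into ?S \<sigma> x"
    have "?i \<in> Bij ?S" using bij by (rule restrict_inv_into_Bij)
    moreover have "inv_into ?S \<sigma> (x + y) = inv_into ?S \<sigma> x + inv_into ?S \<sigma> y" if "x \<in> ?S" "y \<in> ?S" for x y
      by (rule Bij_inv_into_lemma[where g = "(+)"]) (use \<sigma> bij that in \<open>auto simp: galois_fixing_def separable_add\<close>)
    moreover have "inv_into ?S \<sigma> (x * y) = inv_into ?S \<sigma> x * inv_into ?S \<sigma> y" if "x \<in> ?S" "y \<in> ?S" for x y
      by (rule Bij_inv_into_lemma[where g = "(*)"]) (use \<sigma> bij that in \<open>auto simp: galois_fixing_def separable_mult\<close>)
    moreover have "inv_into ?S \<sigma> x = x" if "x \<in> E" for x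
    proof -
      have "inj_on \<sigma> ?S" using bij unfolding Bij_def bij_betw_def by auto
      moreover have "\<sigma> x = x" "x \<in> ?S" using \<sigma> that assms unfolding galois_fixing_def by auto
      ultimately show ?thesis by (metis inv_into_f_f)
    qed
    ultimately have "?i \<in> galois_fixing E"
      unfolding galois_fixing_def using assms by (auto simp: subset_iff separable_add separable_mult)
    then show "inv\<^bsub>BijGroup ?S\<^esub> \<sigma> \<in> galois_fixing E" using inv_BijGroup[OF bij] by simp
  next
    fix \<sigma> \<tau> assume \<sigma>: "\<sigma> \<in> galois_fixing E" and \<tau>: "\<tau> \<in> galois_fixing E"
    then have bij: "\<sigma> \<in> Bij ?S" "\<tau> \<in> Bij ?S" unfolding galois_fixing_def by blast+
    have \<tau>S: "\<tau> x \<in> ?S" if "x \<in> ?S" for x using Bij_imp_funcset[OF bij(2)] that by auto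
    have "compose ?S \<sigma> \<tau> \<in> galois_fixing E"
      unfolding galois_fixing_def
    proof (intro CollectI conjI ballI)
      show "compose ?S \<sigma> \<tau> \<in> Bij ?S" using bij by (rule compose_Bij)
      fix x y assume xy: "x \<in> ?S" "y \<in> ?S"
      then show "compose ?S \<sigma> \<tau> (x + y) = compose ?S \<sigma> \<tau> x + compose ?S \<sigma> \<tau> y"
        "compose ?S \<sigma> \<tau> (x * y) = compose ?S \<sigma> \<tau> x * compose ?S \<sigma> \<tau> y"
        using \<sigma> \<tau> \<tau>S separable_add[OF xy] separable_mult[OF xy]
        unfolding galois_fixing_def by (simp_all add: compose_eq)
    next
      fix x assume "x \<in> E"
      then show "compose ?S \<sigma> \<tau> x = x"
        using \<sigma> \<tau> assms unfolding galois_fixing_def by (auto simp: compose_eq subset_iff)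
    qed
    then show "\<sigma> \<otimes>\<^bsub>BijGroup ?S\<^esub> \<tau> \<in> galois_fixing E"
      using bij by (simp add: BijGroup_def)
  qed
qed

lemma carrier_absolute_galois_group [simp]: "carrier absolute_galois_group = galois_fixing (range to_ac)"
  unfolding absolute_galois_group_def by simp

lemma group_absolute_galois_group: "Group.group absolute_galois_group"
  unfolding absolute_galois_group_def
  by (rule group.subgroup_imp_group[OF group_BijGroup galois_fixing_subgroup[OF base_field_separable]])

lemma galois_closed: "\<sigma> \<in> galois_group \<Longrightarrow> x \<in> ksep \<Longrightarrow> \<sigma> x \<in> ksep"
  unfolding galois_fixing_def using Bij_imp_funcset by blast

lemma galois_add: "\<sigma> \<in> galois_group \<Longrightarrow> x \<in> ksep \<Longrightarrow> y \<in> ksep \<Longrightarrow> \<sigma> (x + y) = \<sigma> x + \<sigma> y"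
  unfolding galois_fixing_def by blast

lemma galois_mult: "\<sigma> \<in> galois_group \<Longrightarrow> x \<in> ksep \<Longrightarrow> y \<in> ksep \<Longrightarrow> \<sigma> (x * y) = \<sigma> x * \<sigma> y"
  unfolding galois_fixing_def by blast

lemma galois_to_ac: "\<sigma> \<in> galois_group \<Longrightarrow> \<sigma> (to_ac c) = to_ac c"
  unfolding galois_fixing_def by blast

lemma galois_eqI:
  assumes "\<sigma> \<in> galois_group" "\<tau> \<in> galois_group" "\<And>x. x \<in> ksep \<Longrightarrow> \<sigma> x = \<tau> x"
  shows "\<sigma> = \<tau>"
proof (rule extensionalityI)
  show "\<sigma> \<in> extensional ksep" "\<tau> \<in> extensional ksep"
    using assms(1,2) unfolding galois_fixing_def by (auto intro: Bij_imp_extensional)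
qed (rule assms(3))

lemma galois_one: "x \<in> ksep \<Longrightarrow> \<one>\<^bsub>absolute_galois_group\<^esub> x = x"
  unfolding absolute_galois_group_def BijGroup_def by simp

lemma galois_comp:
  assumes "\<sigma> \<in> galois_group" "\<tau> \<in> galois_group" "x \<in> ksep"
  shows "(\<sigma> \<otimes>\<^bsub>absolute_galois_group\<^esub> \<tau>) x = \<sigma> (\<tau> x)"
proof -
  have "\<sigma> \<in> Bij ksep" "\<tau> \<in> Bij ksep" using assms unfolding galois_fixing_def by blast+
  then show ?thesis using assms(3) unfolding absolute_galois_group_def BijGroup_def by (simp add: compose_eq)
qed

lemma galois_poly:
  assumes "\<sigma> \<in> galois_group" "x \<in> ksep"
  shows "\<sigma> (poly (lift_poly p) x) = poly (lift_poly p) (\<sigma> x)"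
proof (induction p)
  case 0
  then show ?case using galois_to_ac[OF assms(1), of 0] by simp
next
  case (pCons a p)
  have "poly (lift_poly p) x \<in> ksep"
    using adjoin_subset_separable[OF assms(2)] unfolding adjoin_def by auto
  then show ?case using pCons assms
    by (simp add: galois_add galois_mult galois_to_ac separable_mult to_ac_separable)
qed

definition conjugates :: "'a::Fields.field alg_closure \<Rightarrow> 'a alg_closure set" where
  "conjugates x = {y \<in> ksep. \<forall>p :: 'a poly. poly (lift_poly p) x = 0 \<longrightarrow> poly (lift_poly p) y = 0}"

lemma finite_conjugates:
  fixes x :: "'a::Fields.field alg_closure"
  shows "finite (conjugates x)"
proof -
  obtain p :: "'a poly" where p: "p \<noteq> 0" "poly (lift_poly p) x = 0" by (rule alg_closure_algebraic)
  have "conjugates x \<subseteq> {y. poly (lift_poly p) y = 0}" using p(2) unfolding conjugates_def by blast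
  moreover have "finite {y. poly (lift_poly p) y = 0}" using p(1) by (intro poly_roots_finite) simp
  ultimately show ?thesis by (rule finite_subset)
qed

lemma galois_conjugate:
  assumes "\<sigma> \<in> galois_group" "x \<in> ksep"
  shows "\<sigma> x \<in> conjugates x"
proof -
  have "poly (lift_poly p) (\<sigma> x) = 0" if "poly (lift_poly p) x = 0" for p
    using galois_poly[OF assms, of p] galois_to_ac[OF assms(1), of 0] that by simp
  then show ?thesis unfolding conjugates_def using galois_closed[OF assms] by blast
qed

lemma galois_action_on_ksep:
  fixes H :: "('a::Fields.field alg_closure \<Rightarrow> 'a alg_closure) set"
  assumes roots_of_unity: "\<And>(n::nat) (z::'a alg_closure). n > 0 \<Longrightarrow> z ^ n = 1 \<Longrightarrow> z \<in> range to_ac"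
    and H: "subgroup H absolute_galois_group"
  shows "galois_action (absolute_galois_group\<lparr>carrier := H\<rparr>) ksep (\<lambda>\<sigma> x. \<sigma> x)"
proof -
  interpret G: group "absolute_galois_group :: ('a alg_closure \<Rightarrow> 'a alg_closure) monoid"
    by (rule group_absolute_galois_group)
  interpret H: group "absolute_galois_group\<lparr>carrier := H\<rparr>" by (rule G.subgroup_imp_group[OF H])
  have HG: "\<sigma> \<in> galois_group" if "\<sigma> \<in> H" for \<sigma> using subgroup.mem_carrier[OF H that] by simp
  show ?thesis
  proof unfold_locales
    show "(1 :: 'a alg_closure) \<in> ksep" using to_ac_separable[of 1] by simp
    fix x assume x: "x \<in> (ksep :: 'a alg_closure set)"
    show "finite ((\<lambda>g. g x) ` carrier (absolute_galois_group\<lparr>carrier := H\<rparr>))"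
    proof (rule finite_subset[OF _ finite_conjugates[of x]], rule image_subsetI)
      fix g assume "g \<in> carrier (absolute_galois_group\<lparr>carrier := H\<rparr>)"
      then have "g \<in> galois_group" by (intro HG) simp
      then show "g x \<in> conjugates x" by (rule galois_conjugate[OF _ x])
    qed
  next
    fix q and b :: "'a alg_closure"
    assume "Factorial_Ring.prime q" "of_nat q \<noteq> (0 :: 'a alg_closure)" "b ^ q \<in> ksep"
    then show "b \<in> ksep" by (rule separable_prime_root[OF prime_gt_0_nat])
  next
    fix b :: "'a alg_closure"
    assume "Factorial_Ring.prime CHAR('a alg_closure)" "b ^ CHAR('a alg_closure) - b \<in> ksep"
    then show "b \<in> ksep" using separable_artin_schreier_root[of b] by simp
  next
    fix n :: nat and z :: "'a alg_closure" assume "n > 0" "z ^ n = 1"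
    then obtain c where c: "z = to_ac c" using roots_of_unity by blast
    show "z \<in> ksep" unfolding c by (rule to_ac_separable)
    fix g assume "g \<in> carrier (absolute_galois_group\<lparr>carrier := H\<rparr>)"
    then show "g z = z" unfolding c using galois_to_ac[OF HG] by simp
  qed (simp_all add: HG separable_add separable_mult separable_uminus separable_inverse
        galois_add galois_mult galois_closed galois_one galois_comp)
qed

section \<open>The Krull topology\<close>

abbreviation ac_ring :: "'a::Fields.field alg_closure ring" where
  "ac_ring \<equiv> ring_of_type_algebra"

lemma ac_ring_sel [simp]:
  "carrier ac_ring = UNIV" "x \<otimes>\<^bsub>ac_ring\<^esub> y = x * y" "\<one>\<^bsub>ac_ring\<^esub> = 1" "\<zero>\<^bsub>ac_ring\<^esub> = 0" "x \<oplus>\<^bsub>ac_ring\<^esub> y = x + y"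
  unfolding ring_of_type_algebra_def by simp_all

lemma field_ac_ring: "field ac_ring"
  by (rule field_from_type_algebra)

lemma subfield_ac_ringI:
  assumes "1 \<in> E" "\<And>x. x \<in> E \<Longrightarrow> - x \<in> E" "\<And>x y. x \<in> E \<Longrightarrow> y \<in> E \<Longrightarrow> x + y \<in> E"
    "\<And>x y. x \<in> E \<Longrightarrow> y \<in> E \<Longrightarrow> x * y \<in> E" "\<And>x. x \<in> E \<Longrightarrow> inverse x \<in> E"
  shows "subfield E ac_ring"
proof -
  interpret R: field ac_ring by (rule field_ac_ring)
  have uminus: "\<ominus>\<^bsub>ac_ring\<^esub> x = - x" for x :: "'a alg_closure"
    by (rule R.minus_equality) simp_all
  have inv: "inv\<^bsub>ac_ring\<^esub> x = inverse x" if "x \<noteq> 0" for x :: "'a alg_closure"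
    by (rule R.comm_inv_char) (use that in simp_all)
  show ?thesis
  proof (rule R.subfieldI')
    show "subring E ac_ring" by (rule R.subringI) (use assms in \<open>auto simp: uminus\<close>)
    show "inv\<^bsub>ac_ring\<^esub> k \<in> E" if "k \<in> E - {\<zero>\<^bsub>ac_ring\<^esub>}" for k
      using that assms(5) inv by auto
  qed
qed

lemma subfield_base: "subfield (range to_ac) ac_ring"
proof (rule subfield_ac_ringI)
  show "1 \<in> range to_ac" by (metis rangeI to_ac_1)
qed (auto simp flip: to_ac_minus to_ac_add to_ac_mult to_ac_inverse)

text \<open>
Links the list-based linear algebra of carriers, in which finite extensions are defined, to the
vector space above.
\<close>

lemma Span_eq_ac_span: "ring.Span ac_ring (range to_ac) Us = ac.span (set Us)"
proof -
  interpret R: field ac_ring by (rule field_ac_ring)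
  show ?thesis
  proof (induction Us)
    case Nil
    then show ?case by simp
  next
    case (Cons u Us)
    have "R.Span (range to_ac) (u # Us) = R.line_extension (range to_ac) u (ac.span (set Us))"
      using Cons by simp
    also have "\<dots> = ac.span (set (u # Us))"
    proof (intro Set.set_eqI)
      fix x
      have "x \<in> R.line_extension (range to_ac) u (ac.span (set Us)) \<longleftrightarrow> (\<exists>c. \<exists>v\<in>ac.span (set Us). x = to_ac c * u + v)"
        unfolding R.line_extension_mem_iff by auto
      also have "\<dots> \<longleftrightarrow> (\<exists>c. x - to_ac c * u \<in> ac.span (set Us))"
        by (metis add_diff_cancel_left' add.commute diff_add_cancel)
      also have "\<dots> \<longleftrightarrow> x \<in> ac.span (set (u # Us))"
        by (simp add: ac.span_insert)
      finally show "x \<in> R.line_extension (range to_ac) u (ac.span (set Us)) \<longleftrightarrow> x \<in> ac.span (set (u # Us))" .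
    qed
    finally show ?case .
  qed
qed

lemma adjoin_eq_span:
  obtains Us where "adjoin x = ac.span (set Us)"
proof -
  obtain f :: "'a poly" where f: "f \<noteq> 0" "poly (lift_poly f) x = 0" by (rule alg_closure_algebraic)
  have "adjoin x = ac.span ((\<lambda>i. x ^ i) ` {..<Polynomial.degree f})"
  proof
    show "adjoin x \<subseteq> ac.span ((\<lambda>i. x ^ i) ` {..<Polynomial.degree f})" by (rule adjoin_subset_span[OF f])
    have "ac.subspace (adjoin x)"
      unfolding ac.subspace_def using to_ac_in_adjoin[of 0 x] by (simp add: adjoin_closed to_ac_in_adjoin)
    then show "ac.span ((\<lambda>i. x ^ i) ` {..<Polynomial.degree f}) \<subseteq> adjoin x"
      by (intro ac.span_minimal) (auto simp: power_in_adjoin)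
  qed
  then show ?thesis using that[of "map (\<lambda>i. x ^ i) [0..<Polynomial.degree f]"]
    by (simp add: atLeast0LessThan)
qed

lemma finite_separable_extension_adjoin:
  assumes x: "x \<in> ksep"
  shows "finite_separable_extension (adjoin x)"
proof -
  interpret R: field ac_ring by (rule field_ac_ring)
  have "subfield (adjoin x) ac_ring"
  proof (rule subfield_ac_ringI)
    show "1 \<in> adjoin x" using to_ac_in_adjoin[of 1 x] by simp
    show "- u \<in> adjoin x" if "u \<in> adjoin x" for u
      using adjoin_closed(2)[OF to_ac_in_adjoin[of "- 1"] that] by simp
    show "inverse u \<in> adjoin x" if u: "u \<in> adjoin x" for u
    proof -
      obtain p where p: "u = poly (lift_poly p) x" using u unfolding adjoin_def by auto
      have "inverse u \<in> adjoin u" by (rule inverse_in_adjoin)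
      then obtain q where "inverse u = poly (lift_poly q) u" unfolding adjoin_def by auto
      then have "inverse u = poly (lift_poly (q \<circ>\<^sub>p p)) x" using p by (simp add: lift_poly_pcompose poly_pcompose)
      then show ?thesis unfolding adjoin_def by auto
    qed
  qed (auto intro: adjoin_closed)
  moreover have "range to_ac \<subseteq> adjoin x" using to_ac_in_adjoin by auto
  moreover have "adjoin x \<subseteq> ksep" by (rule adjoin_subset_separable[OF x])
  moreover obtain Us where "adjoin x = ac.span (set Us)" by (rule adjoin_eq_span)
  then have "R.finite_dimension (range to_ac) (adjoin x)"
    using R.Span_finite_dimension[OF subfield_base, of Us] by (simp only: Span_eq_ac_span) simp
  ultimately show ?thesis unfolding finite_separable_extension_def by blast
qed

text \<open>
An automorphism over the base field is linear, so it is determined on a finite extension by its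
values on a spanning set.
\<close>

lemma finite_separable_extension_determined:
  assumes "finite_separable_extension E"
  obtains A where "finite A" "A \<subseteq> E"
    "\<And>\<sigma> \<tau>. \<sigma> \<in> galois_group \<Longrightarrow> \<tau> \<in> galois_group \<Longrightarrow> (\<forall>x\<in>A. \<sigma> x = \<tau> x) \<Longrightarrow> (\<forall>x\<in>E. \<sigma> x = \<tau> x)"
proof -
  interpret R: field ac_ring by (rule field_ac_ring)
  have E: "E \<subseteq> ksep" using assms unfolding finite_separable_extension_def by blast
  obtain n where "R.dimension n (range to_ac) E"
    using assms unfolding finite_separable_extension_def R.finite_dimension_def by blast
  then obtain Us where "R.Span (range to_ac) Us = E" using R.exists_base[OF subfield_base] by blast
  then have span: "E = ac.span (set Us)" by (simp only: Span_eq_ac_span)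
  show ?thesis
  proof (rule that)
    show "finite (set Us)" by simp
    show UE: "set Us \<subseteq> E" unfolding span by (rule ac.span_superset)
    fix \<sigma> \<tau> assume \<sigma>: "\<sigma> \<in> galois_group" and \<tau>: "\<tau> \<in> galois_group" and agree: "\<forall>x\<in>set Us. \<sigma> x = \<tau> x"
    have "x \<in> ksep \<and> \<sigma> x = \<tau> x" if "x \<in> ac.span (set Us)" for x
      using that
    proof (induction rule: ac.span_induct_alt)
      case base
      then show ?case
        using to_ac_separable[of 0] galois_to_ac[OF \<sigma>, of 0] galois_to_ac[OF \<tau>, of 0] by simp
    next
      case (step c u y)
      have u: "u \<in> ksep" using step UE E by auto
      then show ?case using step agree \<sigma> \<tau>
        by (simp add: galois_add galois_mult galois_to_ac separable_add separable_mult to_ac_separable)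
    qed
    then show "\<forall>x\<in>E. \<sigma> x = \<tau> x" using span by blast
  qed
qed

definition agreeing :: "('a::Fields.field alg_closure \<Rightarrow> 'a alg_closure) \<Rightarrow> 'a alg_closure set \<Rightarrow> _ set" where
  "agreeing \<sigma> A = {\<tau> \<in> galois_group. \<forall>x\<in>A. \<tau> x = \<sigma> x}"

lemma agreeing_refl: "\<sigma> \<in> galois_group \<Longrightarrow> \<sigma> \<in> agreeing \<sigma> A"
  unfolding agreeing_def by blast

lemma coset_galois_fixing:
  assumes \<sigma>: "\<sigma> \<in> galois_group" and E: "range to_ac \<subseteq> E" "E \<subseteq> ksep"
  shows "\<sigma> <#\<^bsub>absolute_galois_group\<^esub> galois_fixing E = agreeing \<sigma> E"
proof -
  interpret G: group "absolute_galois_group :: ('a alg_closure \<Rightarrow> 'a alg_closure) monoid"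
    by (rule group_absolute_galois_group)
  have sub: "galois_fixing E \<subseteq> galois_group" using E(1) unfolding galois_fixing_def by blast
  show ?thesis
  proof (intro Set.set_eqI iffI)
    fix \<tau> assume "\<tau> \<in> \<sigma> <#\<^bsub>absolute_galois_group\<^esub> galois_fixing E"
    then obtain \<rho> where \<rho>: "\<rho> \<in> galois_fixing E" "\<tau> = \<sigma> \<otimes>\<^bsub>absolute_galois_group\<^esub> \<rho>" unfolding l_coset_def by blast
    then have \<rho>G: "\<rho> \<in> galois_group" using sub by blast
    have "\<tau> \<in> galois_group" using G.m_closed[of \<sigma> \<rho>] \<sigma> \<rho>G \<rho>(2) by simp
    moreover have "\<tau> x = \<sigma> x" if "x \<in> E" for x
    proof -
      have "\<rho> x = x" using \<rho>(1) that unfolding galois_fixing_def by blast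
      then show ?thesis using galois_comp[OF \<sigma> \<rho>G, of x] E(2) that \<rho>(2) by auto
    qed
    ultimately show "\<tau> \<in> agreeing \<sigma> E" unfolding agreeing_def by blast
  next
    fix \<tau> assume \<tau>: "\<tau> \<in> agreeing \<sigma> E"
    then have \<tau>G: "\<tau> \<in> galois_group" unfolding agreeing_def by blast
    define \<rho> where "\<rho> = inv\<^bsub>absolute_galois_group\<^esub> \<sigma> \<otimes>\<^bsub>absolute_galois_group\<^esub> \<tau>"
    have i: "inv\<^bsub>absolute_galois_group\<^esub> \<sigma> \<in> galois_group" using G.inv_closed[of \<sigma>] \<sigma> by simp
    have \<rho>G: "\<rho> \<in> galois_group" using G.m_closed[of "inv\<^bsub>absolute_galois_group\<^esub> \<sigma>" \<tau>] i \<tau>G unfolding \<rho>_def by simp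
    have "\<tau> = \<sigma> \<otimes>\<^bsub>absolute_galois_group\<^esub> \<rho>"
      unfolding \<rho>_def using \<sigma> \<tau>G i by (simp add: G.m_assoc[symmetric])
    moreover have "\<rho> x = x" if "x \<in> E" for x
    proof -
      have x: "x \<in> ksep" using that E(2) by blast
      have "\<rho> x = (inv\<^bsub>absolute_galois_group\<^esub> \<sigma>) (\<sigma> x)"
        unfolding \<rho>_def using galois_comp[OF i \<tau>G x] \<tau> that unfolding agreeing_def by simp
      also have "\<dots> = x" using galois_comp[OF i \<sigma> x] galois_one[OF x] \<sigma> by simp
      finally show ?thesis .
    qed
    then have "\<rho> \<in> galois_fixing E" using \<rho>G unfolding galois_fixing_def by blast
    ultimately show "\<tau> \<in> \<sigma> <#\<^bsub>absolute_galois_group\<^esub> galois_fixing E" unfolding l_coset_def by blast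
  qed
qed

text \<open>
The Krull topology is the topology of pointwise convergence: agreement on a finite extension is
agreement on a finite spanning set, and agreement at \<open>x\<close> is implied by agreement on \<open>adjoin x\<close>.
\<close>

lemma openin_krull_iff:
  fixes U :: "('a::Fields.field alg_closure \<Rightarrow> 'a alg_closure) set"
  shows "openin krull_topology U \<longleftrightarrow>
    U \<subseteq> galois_group \<and> (\<forall>\<sigma>\<in>U. \<exists>A. finite A \<and> A \<subseteq> ksep \<and> agreeing \<sigma> A \<subseteq> U)"
proof
  define \<B> where "\<B> = {\<sigma> <#\<^bsub>absolute_galois_group\<^esub> galois_fixing E | \<sigma> E.
        \<sigma> \<in> carrier absolute_galois_group \<and> finite_separable_extension (E :: 'a alg_closure set)}"
  have krull: "krull_topology = topology_generated_by \<B>" unfolding krull_topology_def \<B>_def ..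
  have coset: "\<sigma> <#\<^bsub>absolute_galois_group\<^esub> galois_fixing E = agreeing \<sigma> E"
    if "\<sigma> \<in> galois_group" "finite_separable_extension E" for \<sigma> and E :: "'a alg_closure set"
    using that unfolding finite_separable_extension_def by (intro coset_galois_fixing) blast+
  {
    assume "openin krull_topology U"
    then have "generate_topology_on \<B> U" unfolding krull openin_topology_generated_by_iff .
    then show "U \<subseteq> galois_group \<and> (\<forall>\<sigma>\<in>U. \<exists>A. finite A \<and> A \<subseteq> ksep \<and> agreeing \<sigma> A \<subseteq> U)"
    proof induction
      case Empty
      then show ?case by simp
    next
      case (Int V W)
      have "\<exists>A. finite A \<and> A \<subseteq> ksep \<and> agreeing \<sigma> A \<subseteq> V \<inter> W" if \<sigma>: "\<sigma> \<in> V \<inter> W" for \<sigma>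
      proof -
        obtain A where "finite A" "A \<subseteq> ksep" "agreeing \<sigma> A \<subseteq> V" using Int.IH(1) \<sigma> by blast
        moreover obtain B where "finite B" "B \<subseteq> ksep" "agreeing \<sigma> B \<subseteq> W" using Int.IH(2) \<sigma> by blast
        ultimately show ?thesis by (intro exI[of _ "A \<union> B"]) (auto simp: agreeing_def)
      qed
      then show ?case using Int.IH by blast
    next
      case (UN \<K>)
      then show ?case by (meson Union_iff Union_least Union_upper subset_trans)
    next
      case (Basis V)
      then obtain \<sigma> E where \<sigma>: "\<sigma> \<in> galois_group" and E: "finite_separable_extension E"
        and "V = \<sigma> <#\<^bsub>absolute_galois_group\<^esub> galois_fixing E" unfolding \<B>_def by auto
      then have V: "V = agreeing \<sigma> E" using coset by simp
      obtain A where A: "finite A" "A \<subseteq> E"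
        "\<And>\<sigma> \<tau>. \<sigma> \<in> galois_group \<Longrightarrow> \<tau> \<in> galois_group \<Longrightarrow> (\<forall>x\<in>A. \<sigma> x = \<tau> x) \<Longrightarrow> (\<forall>x\<in>E. \<sigma> x = \<tau> x)"
        by (rule finite_separable_extension_determined[OF E]) (rule that; assumption)
      have "A \<subseteq> ksep" using A(2) E unfolding finite_separable_extension_def by blast
      moreover have "agreeing \<tau> A \<subseteq> V" if "\<tau> \<in> V" for \<tau>
      proof
        fix \<rho> assume "\<rho> \<in> agreeing \<tau> A"
        then have \<rho>: "\<rho> \<in> galois_group" "\<forall>x\<in>A. \<rho> x = \<tau> x" unfolding agreeing_def by auto
        have \<tau>: "\<tau> \<in> galois_group" "\<forall>x\<in>E. \<tau> x = \<sigma> x" using that unfolding V agreeing_def by auto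
        have "\<forall>x\<in>E. \<rho> x = \<tau> x" by (rule A(3)[OF \<rho>(1) \<tau>(1) \<rho>(2)])
        then show "\<rho> \<in> V" unfolding V agreeing_def using \<rho>(1) \<tau>(2) by simp
      qed
      moreover have "V \<subseteq> galois_group" unfolding V agreeing_def by blast
      ultimately show ?case using A(1) by (intro conjI ballI exI[of _ A])
    qed
  next
    assume R: "U \<subseteq> galois_group \<and> (\<forall>\<sigma>\<in>U. \<exists>A. finite A \<and> A \<subseteq> ksep \<and> agreeing \<sigma> A \<subseteq> U)"
    have basic: "openin krull_topology (agreeing \<sigma> (adjoin x))" if "\<sigma> \<in> galois_group" "x \<in> ksep"
      for \<sigma> and x :: "'a alg_closure"
    proof -
      have "agreeing \<sigma> (adjoin x) \<in> \<B>"
        using coset[OF that(1) finite_separable_extension_adjoin[OF that(2)]] that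
          finite_separable_extension_adjoin[OF that(2)] unfolding \<B>_def by fastforce
      then show ?thesis unfolding krull by (rule topology_generated_by_Basis)
    qed
    show "openin krull_topology U"
      unfolding openin_subopen[of krull_topology U]
    proof
      fix \<sigma> assume \<sigma>U: "\<sigma> \<in> U"
      then obtain A where A: "finite A" "A \<subseteq> ksep" "agreeing \<sigma> A \<subseteq> U" using R by blast
      have \<sigma>: "\<sigma> \<in> galois_group" using \<sigma>U R by blast
      \<comment> \<open>The element 0 makes the index set non-empty; over an empty one the intersection would not be open.\<close>
      define V where "V = (\<Inter>x\<in>insert 0 A. agreeing \<sigma> (adjoin x))"
      have "0 \<in> ksep" using to_ac_separable[of 0] by simp
      then have "openin krull_topology V"
        unfolding V_def using A by (intro openin_INT2) (auto intro!: basic[OF \<sigma>])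
      moreover have "\<sigma> \<in> V" unfolding V_def using agreeing_refl[OF \<sigma>] by blast
      moreover have "V \<subseteq> agreeing \<sigma> A"
      proof
        fix \<tau> assume \<tau>: "\<tau> \<in> V"
        have "x \<in> adjoin x" for x :: "'a alg_closure" using power_in_adjoin[of x 1] by simp
        then show "\<tau> \<in> agreeing \<sigma> A" using \<tau> unfolding V_def agreeing_def by blast
      qed
      ultimately show "\<exists>T. openin krull_topology T \<and> \<sigma> \<in> T \<and> T \<subseteq> U" using A(3) by blast
    qed
  }
qed

lemma topspace_krull [simp]: "topspace krull_topology = galois_group"
proof
  show "topspace krull_topology \<subseteq> galois_group"
    using openin_topspace[of krull_topology] unfolding openin_krull_iff by blast
  have "openin krull_topology galois_group" unfolding openin_krull_iff agreeing_def by blast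
  then show "galois_group \<subseteq> topspace krull_topology" by (rule openin_subset)
qed

lemma openin_agreeing:
  assumes "finite A" "A \<subseteq> ksep"
  shows "openin krull_topology (agreeing \<sigma> A)"
  unfolding openin_krull_iff
proof (intro conjI ballI)
  show "agreeing \<sigma> A \<subseteq> galois_group" unfolding agreeing_def by blast
  fix \<tau> assume "\<tau> \<in> agreeing \<sigma> A"
  then have "agreeing \<tau> A \<subseteq> agreeing \<sigma> A" unfolding agreeing_def by auto
  then show "\<exists>B. finite B \<and> B \<subseteq> ksep \<and> agreeing \<tau> B \<subseteq> agreeing \<sigma> A" using assms by blast
qed

lemma galois_inv:
  assumes "\<sigma> \<in> galois_group" "x \<in> ksep"
  shows "inv\<^bsub>absolute_galois_group\<^esub> \<sigma> \<in> galois_group"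
    "(inv\<^bsub>absolute_galois_group\<^esub> \<sigma>) (\<sigma> x) = x" "\<sigma> ((inv\<^bsub>absolute_galois_group\<^esub> \<sigma>) x) = x"
proof -
  interpret G: group "absolute_galois_group :: ('a alg_closure \<Rightarrow> 'a alg_closure) monoid"
    by (rule group_absolute_galois_group)
  show i: "inv\<^bsub>absolute_galois_group\<^esub> \<sigma> \<in> galois_group" using G.inv_closed[of \<sigma>] assms(1) by simp
  show "(inv\<^bsub>absolute_galois_group\<^esub> \<sigma>) (\<sigma> x) = x"
    using galois_comp[OF i assms] galois_one[OF assms(2)] assms(1) by simp
  show "\<sigma> ((inv\<^bsub>absolute_galois_group\<^esub> \<sigma>) x) = x"
    using galois_comp[OF assms(1) i assms(2)] galois_one[OF assms(2)] assms(1) by simp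
qed

lemma topological_group_krull:
  "topological_group (absolute_galois_group :: ('a::Fields.field alg_closure \<Rightarrow> 'a alg_closure) monoid) krull_topology"
  unfolding topological_group_def
proof (intro conjI)
  let ?G = "absolute_galois_group :: ('a alg_closure \<Rightarrow> 'a alg_closure) monoid"
  interpret G: group ?G by (rule group_absolute_galois_group)
  show "Group.group ?G" by (rule group_absolute_galois_group)
  show "topspace krull_topology = carrier ?G" by simp
  show "continuous_map (prod_topology krull_topology krull_topology) krull_topology (\<lambda>(x, y). x \<otimes>\<^bsub>?G\<^esub> y)"
    unfolding continuous_map_def
  proof (intro conjI allI impI)
    show "(\<lambda>(x, y). x \<otimes>\<^bsub>?G\<^esub> y) \<in> topspace (prod_topology krull_topology krull_topology) \<rightarrow> topspace krull_topology"
      using G.m_closed by auto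
    fix U :: "('a alg_closure \<Rightarrow> 'a alg_closure) set" assume U: "openin krull_topology U"
    let ?P = "{p \<in> topspace (prod_topology krull_topology krull_topology). (case p of (x, y) \<Rightarrow> x \<otimes>\<^bsub>?G\<^esub> y) \<in> U}"
    show "openin (prod_topology krull_topology krull_topology) ?P"
      unfolding openin_prod_topology_alt
    proof (intro allI impI)
      fix \<sigma> \<tau> assume "(\<sigma>, \<tau>) \<in> ?P"
      then have \<sigma>: "\<sigma> \<in> galois_group" and \<tau>: "\<tau> \<in> galois_group" and st: "\<sigma> \<otimes>\<^bsub>?G\<^esub> \<tau> \<in> U" by auto
      obtain A where A: "finite A" "A \<subseteq> ksep" "agreeing (\<sigma> \<otimes>\<^bsub>?G\<^esub> \<tau>) A \<subseteq> U"
        using U st unfolding openin_krull_iff by blast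
      have \<tau>A: "finite (\<tau> ` A)" "\<tau> ` A \<subseteq> ksep" using A galois_closed[OF \<tau>] by auto
      have "agreeing \<sigma> (\<tau> ` A) \<times> agreeing \<tau> A \<subseteq> ?P"
      proof
        fix p assume "p \<in> agreeing \<sigma> (\<tau> ` A) \<times> agreeing \<tau> A"
        then obtain \<sigma>' \<tau>' where p: "p = (\<sigma>', \<tau>')" and "\<sigma>' \<in> agreeing \<sigma> (\<tau> ` A)" "\<tau>' \<in> agreeing \<tau> A"
          by blast
        then have \<sigma>': "\<sigma>' \<in> galois_group" "\<And>x. x \<in> A \<Longrightarrow> \<sigma>' (\<tau> x) = \<sigma> (\<tau> x)"
          and \<tau>': "\<tau>' \<in> galois_group" "\<And>x. x \<in> A \<Longrightarrow> \<tau>' x = \<tau> x" unfolding agreeing_def by auto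
        have "(\<sigma>' \<otimes>\<^bsub>?G\<^esub> \<tau>') x = (\<sigma> \<otimes>\<^bsub>?G\<^esub> \<tau>) x" if x: "x \<in> A" for x
        proof -
          have "x \<in> ksep" using A(2) x by blast
          then show ?thesis using galois_comp[OF \<sigma>'(1) \<tau>'(1)] galois_comp[OF \<sigma> \<tau>] \<sigma>'(2)[OF x] \<tau>'(2)[OF x] by simp
        qed
        moreover have "\<sigma>' \<otimes>\<^bsub>?G\<^esub> \<tau>' \<in> galois_group" using G.m_closed[of \<sigma>' \<tau>'] \<sigma>'(1) \<tau>'(1) by simp
        ultimately have "\<sigma>' \<otimes>\<^bsub>?G\<^esub> \<tau>' \<in> agreeing (\<sigma> \<otimes>\<^bsub>?G\<^esub> \<tau>) A" unfolding agreeing_def by blast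
        then show "p \<in> ?P" using A(3) \<sigma>'(1) \<tau>'(1) unfolding p by auto
      qed
      then show "\<exists>V W. openin krull_topology V \<and> openin krull_topology W \<and> \<sigma> \<in> V \<and> \<tau> \<in> W \<and> V \<times> W \<subseteq> ?P"
        using openin_agreeing[OF \<tau>A, of \<sigma>] openin_agreeing[OF A(1,2), of \<tau>] agreeing_refl[OF \<sigma>, of "\<tau> ` A"]
          agreeing_refl[OF \<tau>, of A]
        by (intro exI[of _ "agreeing \<sigma> (\<tau> ` A)"] exI[of _ "agreeing \<tau> A"] conjI)
    qed
  qed
  show "continuous_map krull_topology krull_topology (\<lambda>x. inv\<^bsub>?G\<^esub> x)"
    unfolding continuous_map_def
  proof (intro conjI allI impI)
    show "(\<lambda>x. inv\<^bsub>?G\<^esub> x) \<in> topspace krull_topology \<rightarrow> topspace krull_topology"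
      using G.inv_closed by auto
    fix U :: "('a alg_closure \<Rightarrow> 'a alg_closure) set" assume U: "openin krull_topology U"
    let ?P = "{x \<in> topspace krull_topology. inv\<^bsub>?G\<^esub> x \<in> U}"
    show "openin krull_topology ?P"
      unfolding openin_krull_iff
    proof (intro conjI ballI)
      show "?P \<subseteq> galois_group" by auto
      fix \<sigma> assume "\<sigma> \<in> ?P"
      then have \<sigma>: "\<sigma> \<in> galois_group" "inv\<^bsub>?G\<^esub> \<sigma> \<in> U" by auto
      obtain A where A: "finite A" "A \<subseteq> ksep" "agreeing (inv\<^bsub>?G\<^esub> \<sigma>) A \<subseteq> U"
        using U \<sigma>(2) unfolding openin_krull_iff by blast
      have i: "inv\<^bsub>?G\<^esub> \<sigma> \<in> galois_group" using G.inv_closed[of \<sigma>] \<sigma>(1) by simp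
      let ?B = "(inv\<^bsub>?G\<^esub> \<sigma>) ` A"
      have B: "finite ?B" "?B \<subseteq> ksep" using A galois_closed[OF i] by auto
      have "agreeing \<sigma> ?B \<subseteq> ?P"
      proof
        fix \<tau> assume "\<tau> \<in> agreeing \<sigma> ?B"
        then have \<tau>: "\<tau> \<in> galois_group" "\<And>x. x \<in> A \<Longrightarrow> \<tau> ((inv\<^bsub>?G\<^esub> \<sigma>) x) = \<sigma> ((inv\<^bsub>?G\<^esub> \<sigma>) x)"
          unfolding agreeing_def by auto
        have j: "inv\<^bsub>?G\<^esub> \<tau> \<in> galois_group" using G.inv_closed[of \<tau>] \<tau>(1) by simp
        have "(inv\<^bsub>?G\<^esub> \<tau>) x = (inv\<^bsub>?G\<^esub> \<sigma>) x" if x: "x \<in> A" for x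
        proof -
          have xs: "x \<in> ksep" using A(2) x by blast
          have "\<tau> ((inv\<^bsub>?G\<^esub> \<sigma>) x) = x" using \<tau>(2)[OF x] galois_inv(3)[OF \<sigma>(1) xs] by simp
          then show ?thesis using galois_inv(2)[OF \<tau>(1) galois_closed[OF i xs]] by simp
        qed
        then have "inv\<^bsub>?G\<^esub> \<tau> \<in> agreeing (inv\<^bsub>?G\<^esub> \<sigma>) A" using j unfolding agreeing_def by blast
        then show "\<tau> \<in> ?P" using A(3) \<tau>(1) by auto
      qed
      then show "\<exists>B. finite B \<and> B \<subseteq> ksep \<and> agreeing \<sigma> B \<subseteq> ?P" using B by blast
    qed
  qed
qed

lemma galois_separate:
  assumes "\<sigma> \<in> galois_group" "\<tau> \<in> galois_group" "\<sigma> \<noteq> \<tau>"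
  obtains x where "x \<in> ksep" "\<sigma> x \<noteq> \<tau> x"
  using galois_eqI[OF assms(1,2)] assms(3) by blast

lemma Hausdorff_krull: "Hausdorff_space krull_topology"
  unfolding Hausdorff_space_def
proof (intro allI impI)
  fix \<sigma> \<tau> :: "'a::Fields.field alg_closure \<Rightarrow> 'a alg_closure"
  assume "\<sigma> \<in> topspace krull_topology \<and> \<tau> \<in> topspace krull_topology \<and> \<sigma> \<noteq> \<tau>"
  then have st: "\<sigma> \<in> galois_group" "\<tau> \<in> galois_group" "\<sigma> \<noteq> \<tau>" by auto
  obtain x where x: "x \<in> ksep" "\<sigma> x \<noteq> \<tau> x" by (rule galois_separate[OF st])
  have "openin krull_topology (agreeing \<sigma> {x})" "openin krull_topology (agreeing \<tau> {x})"
    using x(1) by (intro openin_agreeing; simp)+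
  moreover have "disjnt (agreeing \<sigma> {x}) (agreeing \<tau> {x})"
    using x(2) unfolding disjnt_def agreeing_def by auto
  ultimately show "\<exists>U V. openin krull_topology U \<and> openin krull_topology V \<and> \<sigma> \<in> U \<and> \<tau> \<in> V \<and> disjnt U V"
    using agreeing_refl st by blast
qed

text \<open>
The set of automorphisms that agree with \<open>\<sigma>\<close> at a point is open and closed.
\<close>

lemma totally_disconnected_krull:
  fixes \<sigma> :: "'a::Fields.field alg_closure \<Rightarrow> 'a alg_closure"
  assumes \<sigma>: "\<sigma> \<in> galois_group"
  shows "connected_component_of_set krull_topology \<sigma> = {\<sigma>}"
proof
  show "{\<sigma>} \<subseteq> connected_component_of_set krull_topology \<sigma>"
    using \<sigma> connected_component_of_refl[of krull_topology \<sigma>] by simp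
  show "connected_component_of_set krull_topology \<sigma> \<subseteq> {\<sigma>}"
  proof (rule subsetI, rule ccontr)
    fix \<tau> assume "\<tau> \<in> connected_component_of_set krull_topology \<sigma>" and "\<tau> \<notin> {\<sigma>}"
    then obtain C where C: "connectedin krull_topology C" "\<sigma> \<in> C" "\<tau> \<in> C" and neq: "\<sigma> \<noteq> \<tau>"
      unfolding connected_component_of_def by blast
    have CG: "C \<subseteq> galois_group" using connectedin_subset_topspace[OF C(1)] by simp
    obtain x where x: "x \<in> ksep" "\<sigma> x \<noteq> \<tau> x"
      using galois_separate[of \<sigma> \<tau>] CG C neq by blast
    let ?U = "agreeing \<sigma> {x}" and ?V = "galois_group - agreeing \<sigma> {x}"
    have "openin krull_topology ?U" by (rule openin_agreeing) (use x in auto)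
    moreover have "openin krull_topology ?V"
      unfolding openin_krull_iff
    proof (intro conjI ballI)
      fix \<rho> assume "\<rho> \<in> ?V"
      then have "agreeing \<rho> {x} \<subseteq> ?V" unfolding agreeing_def by auto
      then show "\<exists>A. finite A \<and> A \<subseteq> ksep \<and> agreeing \<rho> A \<subseteq> ?V" using x(1) by (intro exI[of _ "{x}"]) simp
    qed simp
    moreover have "C \<subseteq> ?U \<union> ?V" "?U \<inter> ?V \<inter> C = {}" using CG by auto
    moreover have "\<sigma> \<in> ?U \<inter> C" "\<tau> \<in> ?V \<inter> C"
      using C CG x \<sigma> unfolding agreeing_def by auto
    ultimately show False using C(1) unfolding connectedin by blast
  qed
qed

text \<open>
The conditions on the right are visibly closed in the product of the finite sets of conjugates.  They
suffice: elements of the base field are their own only conjugates, and an injective map of a finite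
set of conjugates to itself is surjective.
\<close>

lemma galois_group_eq:
  "(galois_group :: ('a::Fields.field alg_closure \<Rightarrow> 'a alg_closure) set) =
    {\<sigma> \<in> Pi\<^sub>E ksep conjugates. \<forall>x\<in>ksep. \<forall>y\<in>ksep. \<sigma> (x + y) = \<sigma> x + \<sigma> y \<and> \<sigma> (x * y) = \<sigma> x * \<sigma> y}"
    (is "_ = ?R")
proof (intro Set.set_eqI iffI)
  fix \<sigma> :: "'a alg_closure \<Rightarrow> 'a alg_closure" assume \<sigma>: "\<sigma> \<in> galois_group"
  then have "\<sigma> \<in> extensional ksep" unfolding galois_fixing_def by (auto intro: Bij_imp_extensional)
  then have "\<sigma> \<in> Pi\<^sub>E ksep conjugates" using galois_conjugate[OF \<sigma>] unfolding PiE_def by auto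
  then show "\<sigma> \<in> ?R" using galois_add[OF \<sigma>] galois_mult[OF \<sigma>] by blast
next
  fix \<sigma> :: "'a alg_closure \<Rightarrow> 'a alg_closure" assume "\<sigma> \<in> ?R"
  then have conj: "\<And>x. x \<in> ksep \<Longrightarrow> \<sigma> x \<in> conjugates x" and ext: "\<sigma> \<in> extensional ksep"
    and add: "\<And>x y. x \<in> ksep \<Longrightarrow> y \<in> ksep \<Longrightarrow> \<sigma> (x + y) = \<sigma> x + \<sigma> y"
    and mult: "\<And>x y. x \<in> ksep \<Longrightarrow> y \<in> ksep \<Longrightarrow> \<sigma> (x * y) = \<sigma> x * \<sigma> y"
    by (auto simp: PiE_def)
  have S: "\<sigma> x \<in> ksep" if "x \<in> ksep" for x using conj[OF that] unfolding conjugates_def by blast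
  have base: "\<sigma> (to_ac c) = to_ac c" for c
  proof -
    have "poly (lift_poly [:- c, 1:]) (to_ac c) = 0" by simp
    then have "poly (lift_poly [:- c, 1:]) (\<sigma> (to_ac c)) = 0"
      using conj[OF to_ac_separable] unfolding conjugates_def by blast
    then show ?thesis by simp
  qed
  have inj: "inj_on \<sigma> ksep"
  proof (rule inj_onI, rule ccontr)
    fix x y assume xy: "x \<in> ksep" "y \<in> ksep" "\<sigma> x = \<sigma> y" "x \<noteq> y"
    have d: "x - y \<in> ksep" using separable_add[OF xy(1) separable_uminus[OF xy(2)]] by simp
    have "\<sigma> (x - y) + \<sigma> y = \<sigma> x" using add[OF d xy(2)] by simp
    then have "\<sigma> (x - y) = 0" using xy(3) by simp
    moreover have "\<sigma> (x - y) * \<sigma> (inverse (x - y)) = 1"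
      using mult[OF d separable_inverse[OF d]] base[of 1] xy(4) by simp
    ultimately show False by simp
  qed
  have surj: "\<sigma> ` ksep = ksep"
  proof
    show "\<sigma> ` ksep \<subseteq> ksep" using S by auto
    show "ksep \<subseteq> \<sigma> ` ksep"
    proof
      fix x :: "'a alg_closure" assume x: "x \<in> ksep"
      have "\<sigma> ` conjugates x \<subseteq> conjugates x"
        using conj unfolding conjugates_def by blast
      moreover have "conjugates x \<subseteq> ksep" unfolding conjugates_def by blast
      then have "inj_on \<sigma> (conjugates x)" using inj by (rule inj_on_subset[rotated])
      ultimately have "\<sigma> ` conjugates x = conjugates x"
        using endo_inj_surj[OF finite_conjugates] by blast
      moreover have "x \<in> conjugates x" using x unfolding conjugates_def by blast
      ultimately show "x \<in> \<sigma> ` ksep" using \<open>conjugates x \<subseteq> ksep\<close> by blast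
    qed
  qed
  have "\<sigma> \<in> Bij ksep" unfolding Bij_def bij_betw_def using ext inj surj by blast
  then show "\<sigma> \<in> galois_group" unfolding galois_fixing_def using add mult base by auto
qed

text \<open>
By Tychonoff's theorem, as the Galois group is closed in a product of finite discrete spaces.
\<close>

lemma compact_krull: "compact_space (krull_topology :: ('a::Fields.field alg_closure \<Rightarrow> 'a alg_closure) topology)"
proof -
  let ?D = "\<lambda>x :: 'a alg_closure. discrete_topology (conjugates x)"
  let ?P = "product_topology ?D ksep"
  let ?G = "galois_group :: ('a alg_closure \<Rightarrow> 'a alg_closure) set"
  have top: "topspace ?P = Pi\<^sub>E ksep conjugates" by simp
  have open1: "openin ?P {\<tau> \<in> topspace ?P. \<tau> x = \<sigma> x}" if "x \<in> ksep" for \<sigma> x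
  proof -
    have "continuous_map ?P (?D x) (\<lambda>\<tau>. \<tau> x)" by (rule continuous_map_product_projection[OF that])
    then have "openin ?P {\<tau> \<in> topspace ?P. \<tau> x \<in> {\<sigma> x} \<inter> conjugates x}"
      by (rule openin_continuous_map_preimage) simp
    moreover have "{\<tau> \<in> topspace ?P. \<tau> x \<in> {\<sigma> x} \<inter> conjugates x} = {\<tau> \<in> topspace ?P. \<tau> x = \<sigma> x}"
      using that unfolding top by (auto simp: PiE_def Pi_def)
    ultimately show ?thesis by simp
  qed
  have openA: "openin ?P {\<tau> \<in> topspace ?P. \<forall>x\<in>A. \<tau> x = \<sigma> x}" if "finite A" "A \<subseteq> ksep" for \<sigma> A
    using that
  proof (induction A)
    case empty
    have "openin ?P (topspace ?P)" by (rule openin_topspace)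
    then show ?case by (simp only: Ball_def empty_iff simp_thms Collect_mem_eq)
  next
    case (insert x A)
    have "{\<tau> \<in> topspace ?P. \<forall>y\<in>insert x A. \<tau> y = \<sigma> y} = {\<tau> \<in> topspace ?P. \<tau> x = \<sigma> x} \<inter> {\<tau> \<in> topspace ?P. \<forall>y\<in>A. \<tau> y = \<sigma> y}"
      by blast
    then show ?case using openin_Int[OF open1 insert.IH] insert.prems by simp
  qed
  have GP: "?G \<subseteq> topspace ?P" unfolding galois_group_eq top by blast
  have "openin ?P (topspace ?P - ?G)"
    unfolding openin_subopen[of ?P "topspace ?P - ?G"]
  proof
    fix \<sigma> assume \<sigma>: "\<sigma> \<in> topspace ?P - ?G"
    then obtain x y where xy: "x \<in> ksep" "y \<in> ksep" "\<not> (\<sigma> (x + y) = \<sigma> x + \<sigma> y \<and> \<sigma> (x * y) = \<sigma> x * \<sigma> y)"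
      unfolding galois_group_eq top by blast
    let ?A = "{x, y, x + y, x * y}"
    let ?V = "{\<tau> \<in> topspace ?P. \<forall>x\<in>?A. \<tau> x = \<sigma> x}"
    have "openin ?P ?V" by (rule openA) (use xy separable_add separable_mult in auto)
    moreover have "\<sigma> \<in> ?V" using \<sigma> by blast
    moreover have "?V \<subseteq> topspace ?P - ?G"
    proof
      fix \<tau> assume \<tau>: "\<tau> \<in> ?V"
      then have "\<tau> x = \<sigma> x" "\<tau> y = \<sigma> y" "\<tau> (x + y) = \<sigma> (x + y)" "\<tau> (x * y) = \<sigma> (x * y)" by auto
      then have "\<not> (\<tau> (x + y) = \<tau> x + \<tau> y \<and> \<tau> (x * y) = \<tau> x * \<tau> y)" using xy(3) by simp
      then have "\<tau> \<notin> ?G" using xy(1,2) unfolding galois_group_eq by blast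
      then show "\<tau> \<in> topspace ?P - ?G" using \<tau> by blast
    qed
    ultimately show "\<exists>T. openin ?P T \<and> \<sigma> \<in> T \<and> T \<subseteq> topspace ?P - ?G" by blast
  qed
  then have closed: "closedin ?P ?G" unfolding closedin_def using GP by blast
  have "compact_space ?P"
    unfolding compact_space_product_topology by (auto simp: compact_space_discrete_topology finite_conjugates)
  then have "compactin ?P ?G" using closed by (rule closedin_compact_space)
  then have compG: "compactin (subtopology ?P ?G) ?G" by (simp add: compactin_subtopology)
  have "continuous_map (subtopology ?P ?G) krull_topology id"
    unfolding continuous_map_def
  proof (intro conjI allI impI)
    show "id \<in> topspace (subtopology ?P ?G) \<rightarrow> topspace krull_topology" by auto
    fix U :: "('a alg_closure \<Rightarrow> 'a alg_closure) set" assume U: "openin krull_topology U"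
    have UG: "U \<subseteq> ?G" using U unfolding openin_krull_iff by blast
    have "openin (subtopology ?P ?G) U"
      unfolding openin_subopen[of _ U]
    proof
      fix \<sigma> assume \<sigma>: "\<sigma> \<in> U"
      then obtain A where A: "finite A" "A \<subseteq> ksep" "agreeing \<sigma> A \<subseteq> U"
        using U unfolding openin_krull_iff by blast
      let ?V = "{\<tau> \<in> topspace ?P. \<forall>x\<in>A. \<tau> x = \<sigma> x}"
      have "openin (subtopology ?P ?G) (?V \<inter> ?G)"
        unfolding openin_subtopology using openA[OF A(1,2)] by blast
      moreover have "\<sigma> \<in> ?V \<inter> ?G" using \<sigma> UG GP by blast
      moreover have "?V \<inter> ?G \<subseteq> U" using A(3) unfolding agreeing_def by blast
      ultimately show "\<exists>T. openin (subtopology ?P ?G) T \<and> \<sigma> \<in> T \<and> T \<subseteq> U" by blast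
    qed
    moreover have "{x \<in> topspace (subtopology ?P ?G). id x \<in> U} = U" using UG GP by auto
    ultimately show "openin (subtopology ?P ?G) {x \<in> topspace (subtopology ?P ?G). id x \<in> U}" by simp
  qed
  then have "compactin krull_topology (id ` ?G)" by (rule image_compactin[OF compG])
  then show ?thesis unfolding compact_space_def by simp
qed

lemma profinite_group_krull: "profinite_group absolute_galois_group krull_topology"
  unfolding profinite_group_def
  using topological_group_krull compact_krull Hausdorff_krull totally_disconnected_krull by auto

section \<open>Torsion in profinite abelianizations\<close>

text \<open>
The closure in the whole Galois group is taken inside \<open>H\<close> because \<open>H\<close> is closed.
\<close>

lemma closure_of_derived_eq:
  fixes H :: "('a::Fields.field alg_closure \<Rightarrow> 'a alg_closure) set"
  assumes H: "subgroup H absolute_galois_group" "closedin krull_topology H"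
    and action: "field_action (absolute_galois_group\<lparr>carrier := H\<rparr>) ksep (\<lambda>\<sigma> x. \<sigma> x)"
  shows "krull_topology closure_of (derived absolute_galois_group H) =
    field_action.derived_closure (absolute_galois_group\<lparr>carrier := H\<rparr>) ksep (\<lambda>\<sigma> x. \<sigma> x)"
proof -
  let ?G = "absolute_galois_group :: ('a alg_closure \<Rightarrow> 'a alg_closure) monoid"
  interpret G: group ?G by (rule group_absolute_galois_group)
  interpret field_action "?G\<lparr>carrier := H\<rparr>" ksep "\<lambda>\<sigma> x. \<sigma> x" by (rule action)
  have HG: "H \<subseteq> galois_group" using subgroup.subset[OF H(1)] by simp
  have derived: "derived (?G\<lparr>carrier := H\<rparr>) (carrier (?G\<lparr>carrier := H\<rparr>)) = derived ?G H"
    using G.derived_consistent[OF subset_refl H(1)] by simp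
  have DH: "derived ?G H \<subseteq> H" by (rule G.derived_incl[OF subset_refl H(1)])
  have cl_H: "krull_topology closure_of (derived ?G H) \<subseteq> H" using DH H(2) by (rule closure_of_minimal)
  have "\<sigma> \<in> krull_topology closure_of (derived ?G H) \<longleftrightarrow>
      \<sigma> \<in> H \<and> (\<forall>A. finite A \<longrightarrow> A \<subseteq> ksep \<longrightarrow> (\<exists>d\<in>derived ?G H. \<forall>x\<in>A. d x = \<sigma> x))" for \<sigma>
  proof (intro iffI conjI allI impI)
    assume \<sigma>: "\<sigma> \<in> krull_topology closure_of (derived ?G H)"
    then show \<sigma>H: "\<sigma> \<in> H" using cl_H by blast
    fix A assume A: "finite A" "A \<subseteq> (ksep :: 'a alg_closure set)"
    have "\<sigma> \<in> agreeing \<sigma> A" using \<sigma>H HG by (intro agreeing_refl) blast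
    then obtain d where "d \<in> derived ?G H" "d \<in> agreeing \<sigma> A"
      using \<sigma> openin_agreeing[OF A, of \<sigma>] unfolding in_closure_of by blast
    then show "\<exists>d\<in>derived ?G H. \<forall>x\<in>A. d x = \<sigma> x" unfolding agreeing_def by blast
  next
    assume R: "\<sigma> \<in> H \<and> (\<forall>A. finite A \<longrightarrow> A \<subseteq> ksep \<longrightarrow> (\<exists>d\<in>derived ?G H. \<forall>x\<in>A. d x = \<sigma> x))"
    show "\<sigma> \<in> krull_topology closure_of (derived ?G H)"
      unfolding in_closure_of
    proof (intro conjI allI impI)
      show "\<sigma> \<in> topspace krull_topology" using R HG by auto
      fix U assume "\<sigma> \<in> U \<and> openin krull_topology U"
      then obtain A where A: "finite A" "A \<subseteq> ksep" "agreeing \<sigma> A \<subseteq> U" unfolding openin_krull_iff by blast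
      then obtain d where d: "d \<in> derived ?G H" "\<forall>x\<in>A. d x = \<sigma> x" using R by blast
      then have "d \<in> agreeing \<sigma> A" using DH HG unfolding agreeing_def by blast
      then show "\<exists>y. y \<in> derived ?G H \<and> y \<in> U" using d(1) A(3) by blast
    qed
  qed
  then show ?thesis unfolding derived_closure_def derived by auto
qed

theorem proposition3p2:
  assumes roots_of_unity: "\<And>(n::nat) (z::'a::field alg_closure). n > 0 \<Longrightarrow> z ^ n = 1 \<Longrightarrow> z \<in> range to_ac"
  shows "totally_torsion_free
           (absolute_galois_group :: ('a alg_closure \<Rightarrow> 'a alg_closure) monoid) krull_topology"
  unfolding totally_torsion_free_def
proof (intro conjI allI impI)
  show "profinite_group (absolute_galois_group :: ('a alg_closure \<Rightarrow> 'a alg_closure) monoid) krull_topology"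
    by (rule profinite_group_krull)
  fix H :: "('a alg_closure \<Rightarrow> 'a alg_closure) set"
  assume H: "subgroup H absolute_galois_group" "closedin krull_topology H"
  interpret galois_action "absolute_galois_group\<lparr>carrier := H\<rparr>" ksep "\<lambda>\<sigma> x. \<sigma> x"
    by (rule galois_action_on_ksep[OF roots_of_unity H(1)])
  have "profinite_abelianization absolute_galois_group krull_topology H
      = (absolute_galois_group\<lparr>carrier := H\<rparr>) Mod derived_closure"
    unfolding profinite_abelianization_def using closure_of_derived_eq[OF H field_action_axioms] by simp
  then show "torsion_free (profinite_abelianization absolute_galois_group krull_topology H)"
    using torsion_free_mod_derived_closure by simp
qed

end
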